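(* Let $k$ be a perfect field of characteristic $p>0$. A Hopf algebra $H\in\mathcal H_*(k)$ is primitively generated if and only if $H$ is split and $QH$ is a trivial $V$-module (i.e. $V=0$ on $QH$).
   Context: Graded vector spaces are non-negatively graded over $k$ and of finite type (finite dimensional in each degree), with graded tensor product and braiding $x\otimes y\mapsto (-1)^{|x||y|}y\otimes x$. $\bar M$ is the positive degree part of $M$; $M$ is reduced if $M_0=0$. $\mathcal H_*(k)$ is the category of connected ($H_0=k$) graded cocommutative Hopf algebras over $k$ of finite type. $PH\subset\bar H$ is the subspace of primitives and $QH=\bar H/\bar H^2$ is the module of indecomposables; $H$ is primitively generated if it is generated as an algebra by $PH$, equivalently $PH\to\bar H\to QH$ is onto. A $V$-module is a reduced graded $k$-vector space $M$ of finite type with additive maps $V:M_{pn}\to M_n$, for all $n$ if $p=2$ and for even $n$ if $p$ is odd, with $V(\lambda x)=\lambda^{1/p}V(x)$; morphisms are degree preserving linear maps commuting with $V$. For $H\in\mathcal H_*(k)$, $\bar H$ is a $V$-module with $V$ dual to the $p$-th power map of the dual commutative algebra $H^\vee$ ($\langle a,V(x)\rangle^p=\langle a^p,x\rangle$), and $QH$ is a quotient $V$-module of $\bar H$. $H$ is split if the quotient map $\bar H\to QH$ has a section that is a morphism of $V$-modules. *)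

theory Defs
  imports
    Complex_Main
    "HOL-Library.Function_Algebras"
    "HOL-Library.Set_Algebras"
begin

section \<open>Tensor products of vector spaces\<close>

text \<open>
  The tensor product of two vector spaces is modelled inside the space of functionals on bilinear
  forms: the pure tensor of \<open>a\<close> and \<open>b\<close> is the functional sending a bilinear form \<open>\<beta>\<close> to
  \<open>\<beta> a b\<close>, and the tensor product is the span of the pure tensors.  (Functions that are not
  bilinear are sent to 0, so that equality of tensors is equality of functions.)
  Over a field this is the usual tensor product: see \<open>pure_tensor_bilinear\<close> and
  \<open>tensor_universal\<close> below.  All vector spaces are whole types with an explicit scalar
  multiplication.
\<close>

type_synonym ('k, 'a, 'b) tensor = "('a \<Rightarrow> 'b \<Rightarrow> 'k) \<Rightarrow> 'k"

definition bilinear_map ::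
  "('k::field \<Rightarrow> 'a::ab_group_add \<Rightarrow> 'a) \<Rightarrow> ('k \<Rightarrow> 'b::ab_group_add \<Rightarrow> 'b) \<Rightarrow>
   ('k \<Rightarrow> 'c::ab_group_add \<Rightarrow> 'c) \<Rightarrow> ('a \<Rightarrow> 'b \<Rightarrow> 'c) \<Rightarrow> bool" where
  "bilinear_map s1 s2 s3 f \<longleftrightarrow>
     (\<forall>y. Vector_Spaces.linear s1 s3 (\<lambda>x. f x y)) \<and> (\<forall>x. Vector_Spaces.linear s2 s3 (f x))"

definition fun_scale :: "'k::field \<Rightarrow> ('a \<Rightarrow> 'k) \<Rightarrow> 'a \<Rightarrow> 'k" where
  "fun_scale c t = (\<lambda>\<beta>. c * t \<beta>)"

definition pure_tensor ::
  "('k::field \<Rightarrow> 'a::ab_group_add \<Rightarrow> 'a) \<Rightarrow> ('k \<Rightarrow> 'b::ab_group_add \<Rightarrow> 'b) \<Rightarrow>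
   'a \<Rightarrow> 'b \<Rightarrow> ('k, 'a, 'b) tensor" where
  "pure_tensor s1 s2 a b = (\<lambda>\<beta>. if bilinear_map s1 s2 (*) \<beta> then \<beta> a b else 0)"

definition tensor_product ::
  "('k::field \<Rightarrow> 'a::ab_group_add \<Rightarrow> 'a) \<Rightarrow> ('k \<Rightarrow> 'b::ab_group_add \<Rightarrow> 'b) \<Rightarrow>
   ('k, 'a, 'b) tensor set" where
  "tensor_product s1 s2 = module.span fun_scale (range (\<lambda>(a, b). pure_tensor s1 s2 a b))"

text \<open>
  The linear map induced by a bilinear map \<open>f\<close>.  Its values are determined on
  \<open>tensor_product s1 s2\<close> only, and it is only ever applied there.
\<close>

definition tensor_lift ::
  "('k::field \<Rightarrow> 'a::ab_group_add \<Rightarrow> 'a) \<Rightarrow> ('k \<Rightarrow> 'b::ab_group_add \<Rightarrow> 'b) \<Rightarrow>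
   ('k \<Rightarrow> 'c::ab_group_add \<Rightarrow> 'c) \<Rightarrow> ('a \<Rightarrow> 'b \<Rightarrow> 'c) \<Rightarrow> ('k, 'a, 'b) tensor \<Rightarrow> 'c" where
  "tensor_lift s1 s2 s3 f =
     (SOME F. Vector_Spaces.linear fun_scale s3 F \<and> (\<forall>a b. F (pure_tensor s1 s2 a b) = f a b))"

lemma vector_space_fun_scale: "vector_space (fun_scale :: 'k::field \<Rightarrow> ('a \<Rightarrow> 'k) \<Rightarrow> 'a \<Rightarrow> 'k)"
  by unfold_locales (auto simp: fun_scale_def fun_eq_iff algebra_simps)

lemma vector_space_mult: "vector_space ((*) :: 'k::field \<Rightarrow> 'k \<Rightarrow> 'k)"
  by unfold_locales (auto simp: algebra_simps)

lemma linear_iff_raw: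
  assumes "vector_space s1" "vector_space s2"
  shows "Vector_Spaces.linear s1 s2 f \<longleftrightarrow>
    (\<forall>x y. f (x + y) = f x + f y) \<and> (\<forall>c x. f (s1 c x) = s2 c (f x))"
  using assms by (simp add: Vector_Spaces.linear_iff)

lemma pure_tensor_bilinear:
  assumes "vector_space s1" "vector_space s2"
  shows "bilinear_map s1 s2 fun_scale (pure_tensor s1 s2)"
  using assms
  by (auto simp: bilinear_map_def linear_iff_raw vector_space_fun_scale vector_space_mult
      pure_tensor_def fun_scale_def fun_eq_iff)

lemma functional_separates:
  assumes V: "vector_space (s :: 'k::field \<Rightarrow> 'c::ab_group_add \<Rightarrow> 'c)" and "w \<noteq> 0"
  shows "\<exists>\<phi>. Vector_Spaces.linear s (*) \<phi> \<and> \<phi> w \<noteq> 0"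
proof -
  interpret vector_space_pair s "(*) :: 'k \<Rightarrow> 'k \<Rightarrow> 'k"
    using V vector_space_mult by (simp add: vector_space_pair_def)
  have "vs1.independent {w}" using assms(2) by (simp add: vs1.dependent_single)
  from linear_independent_extend[OF this, of "\<lambda>_. 1"] show ?thesis by auto
qed

text \<open>The universal property (uniqueness on the span is \<open>linear_eq_on_span\<close>).\<close>

lemma tensor_universal:
  assumes V1: "vector_space (s1 :: 'k::field \<Rightarrow> 'a::ab_group_add \<Rightarrow> 'a)"
    and V2: "vector_space (s2 :: 'k \<Rightarrow> 'b::ab_group_add \<Rightarrow> 'b)"
    and V3: "vector_space (s3 :: 'k \<Rightarrow> 'c::ab_group_add \<Rightarrow> 'c)"
    and f: "bilinear_map s1 s2 s3 f"
  shows "\<exists>F. Vector_Spaces.linear fun_scale s3 F \<and> (\<forall>a b. F (pure_tensor s1 s2 a b) = f a b)"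
proof -
  interpret T: vector_space "fun_scale :: 'k \<Rightarrow> ('k, 'a, 'b) tensor \<Rightarrow> _"
    by (rule vector_space_fun_scale)
  interpret P: vector_space_pair "fun_scale :: 'k \<Rightarrow> ('k, 'a, 'b) tensor \<Rightarrow> _" s3
    using V3 vector_space_fun_scale by (simp add: vector_space_pair_def)
  define pt where "pt = pure_tensor s1 s2"
  obtain B where B: "B \<subseteq> range (\<lambda>(a, b). pt a b)" "T.independent B"
      "range (\<lambda>(a, b). pt a b) \<subseteq> T.span B"
    using T.maximal_independent_subset by metis
  have "\<forall>t\<in>B. \<exists>a b. t = pt a b" using B(1) by fast
  then obtain l r where lr: "\<And>t. t \<in> B \<Longrightarrow> t = pt (l t) (r t)" by metis
  obtain F where F: "Vector_Spaces.linear fun_scale s3 F" "\<And>t. t \<in> B \<Longrightarrow> F t = f (l t) (r t)"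
    using P.linear_independent_extend[OF B(2), of "\<lambda>t. f (l t) (r t)"] by blast
  have "F (pt a b) = f a b" for a b
  proof (rule ccontr)
    assume "F (pt a b) \<noteq> f a b"
    then obtain \<phi> where \<phi>: "Vector_Spaces.linear s3 (*) \<phi>" "\<phi> (F (pt a b) - f a b) \<noteq> 0"
      using functional_separates[OF V3, of "F (pt a b) - f a b"] by auto
    define \<beta> where "\<beta> = (\<lambda>x y. \<phi> (f x y))"
    have \<beta>: "bilinear_map s1 s2 (*) \<beta>"
      using f \<phi>(1) unfolding bilinear_map_def \<beta>_def
      by (simp add: linear_iff_raw V1 V2 V3 vector_space_mult)
    have ev: "pt x y \<beta> = \<phi> (f x y)" for x y
      using \<beta> by (simp add: pt_def pure_tensor_def \<beta>_def)
    interpret Q: vector_space_pair "fun_scale :: 'k \<Rightarrow> ('k, 'a, 'b) tensor \<Rightarrow> _"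
        "(*) :: 'k \<Rightarrow> 'k \<Rightarrow> 'k"
      using vector_space_mult vector_space_fun_scale by (simp add: vector_space_pair_def)
    have 1: "Vector_Spaces.linear fun_scale (*) (\<lambda>t. t \<beta>)"
      by (simp add: linear_iff_raw vector_space_fun_scale vector_space_mult fun_scale_def)
    have 2: "Vector_Spaces.linear fun_scale (*) (\<lambda>t. \<phi> (F t))"
      using F(1) \<phi>(1) by (simp add: linear_iff_raw V3 vector_space_fun_scale vector_space_mult)
    have 3: "t \<beta> = \<phi> (F t)" if "t \<in> B" for t
    proof -
      have "t \<beta> = \<phi> (f (l t) (r t))" using lr[OF that] ev[of "l t" "r t"] by simp
      then show ?thesis using F(2)[OF that] by simp
    qed
    have "pt a b \<in> T.span B" using B(3) by auto
    from Q.linear_eq_on[OF 1 2 this 3] have "\<phi> (F (pt a b)) = \<phi> (f a b)" by (simp add: ev)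
    moreover have "\<phi> (F (pt a b) - f a b) = \<phi> (F (pt a b)) - \<phi> (f a b)"
      by (rule Vector_Spaces.linear.axioms(3)[OF \<phi>(1), THEN module_hom.diff])
    ultimately show False using \<phi>(2) by simp
  qed
  then show ?thesis using F(1) unfolding pt_def by blast
qed

section \<open>Graded vector spaces\<close>

text \<open>
  A graded vector space is the internal direct sum, over all \<open>n\<close>, of subspaces \<open>G n\<close>.
\<close>

locale graded_vector_space = vector_space s
  for s :: "'k::field \<Rightarrow> 'v::ab_group_add \<Rightarrow> 'v" +
  fixes G :: "nat \<Rightarrow> 'v set"
  assumes subspace_piece: "module.subspace s (G n)"
    and decomposition:
      "\<exists>!c. (\<forall>n. c n \<in> G n) \<and> finite {n. c n \<noteq> 0} \<and> x = (\<Sum>n | c n \<noteq> 0. c n)"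
    and finite_type: "\<exists>B. finite B \<and> module.span s B = G n"

definition component :: "(nat \<Rightarrow> 'v::ab_group_add set) \<Rightarrow> 'v \<Rightarrow> nat \<Rightarrow> 'v" where
  "component G x =
     (THE c. (\<forall>n. c n \<in> G n) \<and> finite {n. c n \<noteq> 0} \<and> x = (\<Sum>n | c n \<noteq> 0. c n))"

text \<open>
  For bilinear \<open>f\<close>, the bilinear map with value \<open>(-1)^(|x||y|) f x y\<close> on homogeneous \<open>x\<close>, \<open>y\<close>.
\<close>

definition koszul ::
  "(nat \<Rightarrow> 'v::ab_group_add set) \<Rightarrow> ('v \<Rightarrow> 'v \<Rightarrow> 'w::ab_group_add) \<Rightarrow> 'v \<Rightarrow> 'v \<Rightarrow> 'w" where
  "koszul G f x y =
     (\<Sum>i | component G x i \<noteq> 0. \<Sum>j | component G y j \<noteq> 0.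
        if even (i * j) then f (component G x i) (component G y j)
        else - f (component G x i) (component G y j))"

definition tensor_piece ::
  "('k::field \<Rightarrow> 'v::ab_group_add \<Rightarrow> 'v) \<Rightarrow> (nat \<Rightarrow> 'v set) \<Rightarrow> nat \<Rightarrow> ('k, 'v, 'v) tensor set" where
  "tensor_piece s G n =
     module.span fun_scale {pure_tensor s s a b | a b i j. a \<in> G i \<and> b \<in> G j \<and> i + j = n}"

text \<open>The braiding \<open>a \<otimes> b \<mapsto> (-1)^(|a||b|) b \<otimes> a\<close>.\<close>

definition braiding ::
  "('k::field \<Rightarrow> 'v::ab_group_add \<Rightarrow> 'v) \<Rightarrow> (nat \<Rightarrow> 'v set) \<Rightarrow>
   ('k, 'v, 'v) tensor \<Rightarrow> ('k, 'v, 'v) tensor" where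
  "braiding s G = tensor_lift s s fun_scale (koszul G (\<lambda>a b. pure_tensor s s b a))"

text \<open>The product \<open>(a \<otimes> b) (c \<otimes> d) = (-1)^(|b||c|) ac \<otimes> bd\<close>.\<close>

definition tensor_mult ::
  "('k::field \<Rightarrow> 'h::ring_1 \<Rightarrow> 'h) \<Rightarrow> (nat \<Rightarrow> 'h set) \<Rightarrow>
   ('k, 'h, 'h) tensor \<Rightarrow> ('k, 'h, 'h) tensor \<Rightarrow> ('k, 'h, 'h) tensor" where
  "tensor_mult s G t u =
     tensor_lift s s fun_scale
       (\<lambda>a b. tensor_lift s s fun_scale
          (\<lambda>c d. koszul G (\<lambda>b' c'. pure_tensor s s (a * c') (b' * d)) b c) u) t"

section \<open>Connected cocommutative Hopf algebras of finite type\<close>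

text \<open>
  The multiplication is that of the ring \<open>'h\<close>.  As usual for connected graded Hopf algebras
  (Milnor and Moore), no antipode is listed: it exists and is unique because
  of connectedness.  In \<open>coassoc\<close>, both sides live in \<open>H \<otimes> (H \<otimes> H)\<close>.
\<close>

locale connected_cocommutative_hopf_algebra = graded_vector_space s G
  for s :: "'k::field \<Rightarrow> 'h::ring_1 \<Rightarrow> 'h" and G :: "nat \<Rightarrow> 'h set" +
  fixes \<Delta> :: "'h \<Rightarrow> ('k, 'h, 'h) tensor" and \<epsilon> :: "'h \<Rightarrow> 'k"
  assumes scale_mult_left: "s c x * y = s c (x * y)"
    and scale_mult_right: "x * s c y = s c (x * y)"
    and graded_mult: "\<lbrakk>x \<in> G m; y \<in> G n\<rbrakk> \<Longrightarrow> x * y \<in> G (m + n)"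
    and connected: "G 0 = range (\<lambda>c. s c 1)"
    and comult_linear: "Vector_Spaces.linear s fun_scale \<Delta>"
    and comult_graded: "x \<in> G n \<Longrightarrow> \<Delta> x \<in> tensor_piece s G n"
    and counit_linear: "Vector_Spaces.linear s (*) \<epsilon>"
    and counit_graded: "\<lbrakk>x \<in> G n; n > 0\<rbrakk> \<Longrightarrow> \<epsilon> x = 0"
    and counit_left: "tensor_lift s s s (\<lambda>a b. s (\<epsilon> a) b) (\<Delta> x) = x"
    and counit_right: "tensor_lift s s s (\<lambda>a b. s (\<epsilon> b) a) (\<Delta> x) = x"
    and coassoc:
      "tensor_lift s s fun_scale
         (\<lambda>a b. tensor_lift s s fun_scale
            (\<lambda>u v. pure_tensor s fun_scale u (pure_tensor s s v b)) (\<Delta> a)) (\<Delta> x)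
       = tensor_lift s s fun_scale (\<lambda>a b. pure_tensor s fun_scale a (\<Delta> b)) (\<Delta> x)"
    and cocommutative: "braiding s G (\<Delta> x) = \<Delta> x"
    and comult_one: "\<Delta> 1 = pure_tensor s s 1 1"
    and comult_mult: "\<Delta> (x * y) = tensor_mult s G (\<Delta> x) (\<Delta> y)"
    and counit_one: "\<epsilon> 1 = 1"
    and counit_mult: "\<epsilon> (x * y) = \<epsilon> x * \<epsilon> y"

text \<open>The ideal \<open>\<Oplus>\<^bsub>n > 0\<^esub> G n\<close>.\<close>

definition positive_part ::
  "('k::field \<Rightarrow> 'h::ring_1 \<Rightarrow> 'h) \<Rightarrow> (nat \<Rightarrow> 'h set) \<Rightarrow> 'h set" where
  "positive_part s G = module.span s (\<Union>n\<in>{0<..}. G n)"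

definition primitives ::
  "('k::field \<Rightarrow> 'h::ring_1 \<Rightarrow> 'h) \<Rightarrow> (nat \<Rightarrow> 'h set) \<Rightarrow> ('h \<Rightarrow> ('k, 'h, 'h) tensor) \<Rightarrow> 'h set" where
  "primitives s G \<Delta> =
     {x \<in> positive_part s G. \<Delta> x = pure_tensor s s x 1 + pure_tensor s s 1 x}"

definition subalgebra :: "('k::field \<Rightarrow> 'h::ring_1 \<Rightarrow> 'h) \<Rightarrow> 'h set \<Rightarrow> bool" where
  "subalgebra s S \<longleftrightarrow> module.subspace s S \<and> 1 \<in> S \<and> (\<forall>x\<in>S. \<forall>y\<in>S. x * y \<in> S)"

definition primitively_generated ::
  "('k::field \<Rightarrow> 'h::ring_1 \<Rightarrow> 'h) \<Rightarrow> (nat \<Rightarrow> 'h set) \<Rightarrow> ('h \<Rightarrow> ('k, 'h, 'h) tensor) \<Rightarrow> bool" where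
  "primitively_generated s G \<Delta> \<longleftrightarrow> subalgebra s hull primitives s G \<Delta> = UNIV"

section \<open>The Verschiebung\<close>

text \<open>The degree \<open>n\<close> part of the graded dual.\<close>

definition dual_piece ::
  "('k::field \<Rightarrow> 'v::ab_group_add \<Rightarrow> 'v) \<Rightarrow> (nat \<Rightarrow> 'v set) \<Rightarrow> nat \<Rightarrow> ('v \<Rightarrow> 'k) set" where
  "dual_piece s G n =
     {a. Vector_Spaces.linear s (*) a \<and> (\<forall>m. m \<noteq> n \<longrightarrow> (\<forall>x\<in>G m. a x = 0))}"

text \<open>
  The product of the dual algebra, with the unsigned pairing of \<open>H \<otimes> H\<close> with its dual.  The
  Verschiebung only involves powers of elements of even degree, or of any degree in characteristic
  2, for which the usual sign conventions agree.
\<close>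

definition dual_mult ::
  "('k::field \<Rightarrow> 'h::ring_1 \<Rightarrow> 'h) \<Rightarrow> ('h \<Rightarrow> ('k, 'h, 'h) tensor) \<Rightarrow>
   ('h \<Rightarrow> 'k) \<Rightarrow> ('h \<Rightarrow> 'k) \<Rightarrow> 'h \<Rightarrow> 'k" where
  "dual_mult s \<Delta> a b x = tensor_lift s s (*) (\<lambda>u v. a u * b v) (\<Delta> x)"

primrec dual_power ::
  "('k::field \<Rightarrow> 'h::ring_1 \<Rightarrow> 'h) \<Rightarrow> ('h \<Rightarrow> ('k, 'h, 'h) tensor) \<Rightarrow> ('h \<Rightarrow> 'k) \<Rightarrow>
   nat \<Rightarrow> ('h \<Rightarrow> 'k) \<Rightarrow> 'h \<Rightarrow> 'k" where
  "dual_power s \<Delta> \<epsilon> 0 a = \<epsilon>"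
| "dual_power s \<Delta> \<epsilon> (Suc m) a = dual_mult s \<Delta> a (dual_power s \<Delta> \<epsilon> m a)"

text \<open>\<open>verschiebung s G \<Delta> \<epsilon> p n\<close> is the map \<open>V\<close> from degree \<open>p n\<close> to degree \<open>n\<close>.\<close>

definition verschiebung ::
  "('k::field \<Rightarrow> 'h::ring_1 \<Rightarrow> 'h) \<Rightarrow> (nat \<Rightarrow> 'h set) \<Rightarrow> ('h \<Rightarrow> ('k, 'h, 'h) tensor) \<Rightarrow>
   ('h \<Rightarrow> 'k) \<Rightarrow> nat \<Rightarrow> nat \<Rightarrow> 'h \<Rightarrow> 'h" where
  "verschiebung s G \<Delta> \<epsilon> p n x =
     (THE y. y \<in> G n \<and> (\<forall>a\<in>dual_piece s G n. a y ^ p = dual_power s \<Delta> \<epsilon> p a x))"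

section \<open>V-modules\<close>

text \<open>
  The data of a V-module with values in a type \<open>'m\<close>: the homogeneous pieces, the
  vector space operations, and for each \<open>n\<close> the map \<open>V\<close> from degree \<open>p n\<close> to degree \<open>n\<close>,
  which is meaningful only if \<open>V_defined p n\<close>.
\<close>

record ('k, 'm) V_structure =
  piece :: "nat \<Rightarrow> 'm set"
  vplus :: "'m \<Rightarrow> 'm \<Rightarrow> 'm"
  vzero :: 'm
  vscale :: "'k \<Rightarrow> 'm \<Rightarrow> 'm"
  vmap :: "nat \<Rightarrow> 'm \<Rightarrow> 'm"

definition V_defined :: "nat \<Rightarrow> nat \<Rightarrow> bool" where
  "V_defined p n \<longleftrightarrow> p = 2 \<or> even n"

definition V_morphism ::
  "nat \<Rightarrow> ('k, 'm) V_structure \<Rightarrow> ('k, 'n) V_structure \<Rightarrow> ('m \<Rightarrow> 'n) \<Rightarrow> bool" where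
  "V_morphism p M N f \<longleftrightarrow>
     (\<forall>n. \<forall>x\<in>piece M n. f x \<in> piece N n) \<and>
     (\<forall>n. \<forall>x\<in>piece M n. \<forall>y\<in>piece M n. f (vplus M x y) = vplus N (f x) (f y)) \<and>
     (\<forall>n. \<forall>x\<in>piece M n. \<forall>c. f (vscale M c x) = vscale N c (f x)) \<and>
     (\<forall>n. V_defined p n \<longrightarrow> (\<forall>x\<in>piece M (p * n). f (vmap M n x) = vmap N n (f x)))"

definition V_trivial :: "nat \<Rightarrow> ('k, 'm) V_structure \<Rightarrow> bool" where
  "V_trivial p M \<longleftrightarrow> (\<forall>n. V_defined p n \<longrightarrow> (\<forall>x\<in>piece M (p * n). vmap M n x = vzero M))"

definition positive_V_module ::
  "('k::field \<Rightarrow> 'h::ring_1 \<Rightarrow> 'h) \<Rightarrow> (nat \<Rightarrow> 'h set) \<Rightarrow> ('h \<Rightarrow> ('k, 'h, 'h) tensor) \<Rightarrow>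
   ('h \<Rightarrow> 'k) \<Rightarrow> nat \<Rightarrow> ('k, 'h) V_structure" where
  "positive_V_module s G \<Delta> \<epsilon> p =
     \<lparr>piece = (\<lambda>n. if n = 0 then {0} else G n), vplus = (+), vzero = 0, vscale = s,
      vmap = verschiebung s G \<Delta> \<epsilon> p\<rparr>"

definition decomposables ::
  "('k::field \<Rightarrow> 'h::ring_1 \<Rightarrow> 'h) \<Rightarrow> (nat \<Rightarrow> 'h set) \<Rightarrow> 'h set" where
  "decomposables s G = module.span s {x * y | x y. x \<in> positive_part s G \<and> y \<in> positive_part s G}"

definition indec_class ::
  "('k::field \<Rightarrow> 'h::ring_1 \<Rightarrow> 'h) \<Rightarrow> (nat \<Rightarrow> 'h set) \<Rightarrow> 'h \<Rightarrow> 'h set" where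
  "indec_class s G x = x +o decomposables s G"

text \<open>
  The quotient V-module \<open>QH\<close>, with cosets of the decomposables as elements; the operations and
  \<open>V\<close> are induced by those on representatives.  (In \<open>vscale\<close> the decomposables are added
  again because multiplication by the scalar 0 does not map cosets onto cosets.)
\<close>

definition indecomposables ::
  "('k::field \<Rightarrow> 'h::ring_1 \<Rightarrow> 'h) \<Rightarrow> (nat \<Rightarrow> 'h set) \<Rightarrow> ('h \<Rightarrow> ('k, 'h, 'h) tensor) \<Rightarrow>
   ('h \<Rightarrow> 'k) \<Rightarrow> nat \<Rightarrow> ('k, 'h set) V_structure" where
  "indecomposables s G \<Delta> \<epsilon> p =
     (let M = positive_V_module s G \<Delta> \<epsilon> p; D = decomposables s G in
      \<lparr>piece = (\<lambda>n. indec_class s G ` piece M n), vplus = (+), vzero = D,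
       vscale = (\<lambda>c X. s c ` X + D),
       vmap = (\<lambda>n X. the_elem ((\<lambda>x. indec_class s G (vmap M n x)) ` (X \<inter> piece M (p * n))))\<rparr>)"

definition split_hopf ::
  "('k::field \<Rightarrow> 'h::ring_1 \<Rightarrow> 'h) \<Rightarrow> (nat \<Rightarrow> 'h set) \<Rightarrow> ('h \<Rightarrow> ('k, 'h, 'h) tensor) \<Rightarrow>
   ('h \<Rightarrow> 'k) \<Rightarrow> nat \<Rightarrow> bool" where
  "split_hopf s G \<Delta> \<epsilon> p \<longleftrightarrow>
     (\<exists>\<sigma>. V_morphism p (indecomposables s G \<Delta> \<epsilon> p) (positive_V_module s G \<Delta> \<epsilon> p) \<sigma> \<and>
        (\<forall>n. \<forall>X\<in>piece (indecomposables s G \<Delta> \<epsilon> p) n. indec_class s G (\<sigma> X) = X))"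

end

theory Submission
  imports Defs "HOL-Computational_Algebra.Primes"
begin

text \<open>
  Let \<open>A\<close> be the graded dual of \<open>H\<close>.  For a primitive \<open>h\<close> the operator \<open>D\<^sub>h a = a (h * _)\<close> is a
  derivation of \<open>A\<close>, so it kills \<open>p\<close>-th powers.  If the primitives generate \<open>H\<close>, then all \<open>p\<close>-th powers
  in positive degree vanish, i.e. \<open>V = 0\<close> on the positive part of \<open>H\<close>, and any linear section of
  \<open>H \<rightarrow> QH\<close> is a morphism of V-modules.

  Conversely, argue by induction on the degree \<open>N\<close>.  A section compatible with \<open>V = 0\<close> on \<open>QH\<close>, together
  with the induction hypothesis, shows that \<open>p\<close>-th powers vanish in \<open>A\<close> up to degree \<open>N\<close>.  It remains to
  see that a functional \<open>z\<close> of degree \<open>N\<close> that kills both the primitives and the decomposables of \<open>H\<close> is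
  zero (this is the theorem of Milnor and Moore that a primitive decomposable element of \<open>A\<close> vanishes).
  Since \<open>z\<close> kills the primitives, it is decomposable in \<open>A\<close>.  Pick generators \<open>x\<^sub>1, x\<^sub>2, \<dots>\<close> of \<open>A\<close> in
  degrees below \<open>N\<close>, dual to primitives \<open>h\<^sub>j\<close> and ordered by degree, so that \<open>D\<^sub>j x\<^sub>j = 1\<close> and
  \<open>D\<^sub>j x\<^sub>i = 0\<close> for \<open>i < j\<close>.  In an expansion \<open>z = \<Sum> c\<^sub>i x\<^sub>r\<^sup>i\<close> over the subalgebra of the previous
  generators, with \<open>i < p\<close> (and \<open>i < 2\<close> when \<open>p\<close> and the degree are odd), the equation \<open>D\<^sub>r z = 0\<close> leaves
  only \<open>c\<^sub>0\<close>; as this is again decomposable, descending in \<open>r\<close> gives \<open>z = 0\<close>.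
\<close>

section \<open>Derivations of graded commutative algebras\<close>

text \<open>The nilpotency index forced on an element of degree \<open>d\<close> when \<open>p\<close>-th powers vanish.\<close>

definition height :: "nat \<Rightarrow> nat \<Rightarrow> nat" where
  "height p d = (if V_defined p d then p else 2)"

text \<open>All laws are stated for homogeneous arguments: in the application the type is that of
  all functions \<open>'h \<Rightarrow> 'k\<close>, and \<open>dual_mult\<close> is controlled only
  on linear functionals.\<close>

locale graded_commutative_algebra = vector_space sc
  for sc :: "'k::field \<Rightarrow> 'a::ab_group_add \<Rightarrow> 'a" (infixr "*\<^sub>k" 75) +
  fixes A :: "nat \<Rightarrow> 'a set"
    and mul :: "'a \<Rightarrow> 'a \<Rightarrow> 'a" (infixl "\<star>" 70)
    and e :: 'a
  assumes subspace_A: "subspace (A n)"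
    and mul_closed: "\<lbrakk>x \<in> A m; y \<in> A n\<rbrakk> \<Longrightarrow> x \<star> y \<in> A (m + n)"
    and add_mul: "\<lbrakk>x \<in> A m; x' \<in> A m; y \<in> A n\<rbrakk> \<Longrightarrow> (x + x') \<star> y = x \<star> y + x' \<star> y"
    and mul_add: "\<lbrakk>x \<in> A m; y \<in> A n; y' \<in> A n\<rbrakk> \<Longrightarrow> x \<star> (y + y') = x \<star> y + x \<star> y'"
    and scale_mul: "\<lbrakk>x \<in> A m; y \<in> A n\<rbrakk> \<Longrightarrow> (c *\<^sub>k x) \<star> y = c *\<^sub>k (x \<star> y)"
    and mul_scale: "\<lbrakk>x \<in> A m; y \<in> A n\<rbrakk> \<Longrightarrow> x \<star> (c *\<^sub>k y) = c *\<^sub>k (x \<star> y)"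
    and mul_assoc: "\<lbrakk>x \<in> A l; y \<in> A m; z \<in> A n\<rbrakk> \<Longrightarrow> (x \<star> y) \<star> z = x \<star> (y \<star> z)"
    and unit_closed: "e \<in> A 0"
    and unit_mul: "x \<in> A n \<Longrightarrow> e \<star> x = x"
    and mul_unit: "x \<in> A n \<Longrightarrow> x \<star> e = x"
    and mul_commute: "\<lbrakk>x \<in> A m; y \<in> A n\<rbrakk> \<Longrightarrow> x \<star> y = (- 1) ^ (m * n) *\<^sub>k (y \<star> x)"
begin

primrec pw :: "'a \<Rightarrow> nat \<Rightarrow> 'a" where
  "pw x 0 = e"
| "pw x (Suc n) = x \<star> pw x n"

text \<open>A graded derivation of degree \<open>-d\<close>. Subtraction is truncated: for
  \<open>n < d\<close> the value is only asked to lie in \<open>A 0\<close>. The sign is that of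
  \<open>D\<close> moving past \<open>x\<close>.\<close>

definition derivation :: "nat \<Rightarrow> ('a \<Rightarrow> 'a) \<Rightarrow> bool" where
  "derivation d D \<longleftrightarrow> Vector_Spaces.linear sc sc D \<and> (\<forall>n. \<forall>x\<in>A n. D x \<in> A (n - d)) \<and>
     (\<forall>m n. \<forall>x\<in>A m. \<forall>y\<in>A n. D (x \<star> y) = D x \<star> y + (- 1) ^ (d * m) *\<^sub>k (x \<star> D y))"

lemma zero_closed [simp]: "0 \<in> A n"
  using subspace_A subspace_0 by blast

lemma zero_mul [simp]: "y \<in> A n \<Longrightarrow> 0 \<star> y = 0"
  using add_mul[of 0 n 0 y n] by simp

lemma mul_zero [simp]: "y \<in> A n \<Longrightarrow> y \<star> 0 = 0"
  using mul_add[of y n 0 n 0] by simp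

lemma pw_closed: "x \<in> A d \<Longrightarrow> pw x i \<in> A (i * d)"
  by (induction i) (auto simp: unit_closed intro: mul_closed)

lemma pw_add: "x \<in> A d \<Longrightarrow> pw x (i + j) = pw x i \<star> pw x j"
proof (induction i)
  case 0
  then show ?case using unit_mul[OF pw_closed] by simp
next
  case (Suc i)
  then show ?case using mul_assoc[OF _ pw_closed pw_closed] by simp
qed

lemma derivation_linear: "derivation d D \<Longrightarrow> Vector_Spaces.linear sc sc D"
  and derivation_closed: "\<lbrakk>derivation d D; x \<in> A n\<rbrakk> \<Longrightarrow> D x \<in> A (n - d)"
  and derivation_mul: "\<lbrakk>derivation d D; x \<in> A m; y \<in> A n\<rbrakk> \<Longrightarrow>
    D (x \<star> y) = D x \<star> y + (- 1) ^ (d * m) *\<^sub>k (x \<star> D y)"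
  by (auto simp: derivation_def)

lemma derivation_unit: "derivation d D \<Longrightarrow> D e = 0"
  using derivation_mul[OF _ unit_closed unit_closed]
    mul_unit[OF derivation_closed[OF _ unit_closed]] unit_mul[OF derivation_closed[OF _ unit_closed]]
    unit_mul[OF unit_closed]
  by simp

text \<open>Either \<open>d\<close> is even, or the characteristic is 2 and -1 = 1. So elements in
  degrees where \<open>V\<close> is defined commute with all homogeneous elements, and operators
  pass them without sign.\<close>

lemma V_defined_sign:
  assumes "V_defined CHAR('k) d"
  shows "(- 1 :: 'k) ^ (d * m) = 1" "(- 1 :: 'k) ^ (m * d) = 1"
proof -
  have "(- 1 :: 'k) = 1 \<or> even d"
    using assms uminus_CHAR_2[where 'a='k, of 1] by (auto simp only: V_defined_def)
  then show "(- 1 :: 'k) ^ (d * m) = 1" "(- 1 :: 'k) ^ (m * d) = 1"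
    by (metis power_one even_mult_iff neg_one_even_power)+
qed

text \<open>The classical power rule works because \<open>x\<close> commutes with \<open>D x\<close>
  and \<open>D\<close> passes \<open>x\<close> without sign, the degree of \<open>x\<close> being
  one where \<open>V\<close> is defined.\<close>

lemma derivation_pw:
  assumes D: "derivation \<delta> D" and x: "x \<in> A d" and V: "V_defined CHAR('k) d"
  shows "D (pw x (Suc i)) = of_nat (Suc i) *\<^sub>k (D x \<star> pw x i)"
proof (induction i)
  case 0
  then show ?case
    using derivation_unit[OF D] mul_unit[OF x] mul_unit[OF derivation_closed[OF D x]] by simp
next
  case (Suc i)
  let ?y = "pw x i"
  have y: "?y \<in> A (i * d)" by (rule pw_closed[OF x])
  have Dx: "D x \<in> A (d - \<delta>)" by (rule derivation_closed[OF D x])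
  have "x \<star> (D x \<star> ?y) = D x \<star> (x \<star> ?y)"
    using mul_assoc[OF x Dx y] mul_assoc[OF Dx x y] mul_commute[OF x Dx] V_defined_sign[OF V]
    by simp
  moreover have "D (x \<star> (x \<star> ?y)) = D x \<star> (x \<star> ?y) + x \<star> (of_nat (Suc i) *\<^sub>k (D x \<star> ?y))"
    using derivation_mul[OF D x mul_closed[OF x y]] V_defined_sign[OF V] Suc by simp
  moreover have "x \<star> (of_nat (Suc i) *\<^sub>k (D x \<star> ?y)) = of_nat (Suc i) *\<^sub>k (x \<star> (D x \<star> ?y))"
    by (rule mul_scale[OF x mul_closed[OF Dx y]])
  ultimately show ?case by (simp only: pw.simps of_nat_Suc scale_left_distrib scale_one)
qed

end

section \<open>Characteristic \<open>p\<close>: monomials in a triangular system of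
  generators\<close>

locale graded_commutative_algebra_char_p = graded_commutative_algebra sc A mul e
  for sc :: "'k::field \<Rightarrow> 'a::ab_group_add \<Rightarrow> 'a" (infixr "*\<^sub>k" 75)
    and A and mul (infixl "\<star>" 70) and e +
  fixes p :: nat
  assumes char: "CHAR('k) = p" and p_pos: "p > 0"
begin

text \<open>
  The span of the monomials of degree \<open>n\<close> with at least \<open>w\<close> factors, and with every exponent below
  the height, in the generators \<open>x\<close> of the list.  The operators \<open>D\<close> only matter for \<open>triangular\<close>.
\<close>

fun monomials :: "(nat \<times> 'a \<times> ('a \<Rightarrow> 'a)) list \<Rightarrow> nat \<Rightarrow> nat \<Rightarrow> 'a set" where
  "monomials [] n w = (if n = 0 \<and> w = 0 then span {e} else {0})"
| "monomials ((d, x, D) # gs) n w =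
     span {c \<star> pw x i | c i l v. i < height p d \<and> c \<in> monomials gs l v \<and> l + i * d = n \<and> w \<le> v + i}"

text \<open>The head is the generator adjoined last. Its operator kills all generators of the tail,
  while the operators of the tail may act on the head in any way.\<close>

fun triangular :: "(nat \<times> 'a \<times> ('a \<Rightarrow> 'a)) list \<Rightarrow> bool" where
  "triangular [] \<longleftrightarrow> True"
| "triangular ((d, x, D) # gs) \<longleftrightarrow> x \<in> A d \<and> derivation d D \<and> D x = e \<and>
     (\<forall>(d', x', D')\<in>set gs. D x' = 0) \<and> triangular gs"

lemma prime_char: "prime p"
  using prime_CHAR_semidom[where 'a='k] char p_pos by simp

lemma height_gt_1: "height p d > 1"
  using prime_gt_1_nat[OF prime_char] by (simp add: height_def)

text \<open>\<open>\<kappa>\<close> is the sign of moving \<open>D\<close> past \<open>c\<close>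
  times the factor \<open>Suc i\<close> of the power rule. This factor is invertible since
  \<open>Suc i < p\<close>; in degrees where \<open>V\<close> is not defined, the height 2 forces
  \<open>i = 0\<close> and the factor is 1.\<close>

lemma derivation_mul_pw:
  assumes D: "derivation d D" and x: "x \<in> A d" "D x = e" and c: "c \<in> A l" "D c = 0"
    and i: "Suc i < height p d"
  shows "\<exists>\<kappa>. \<kappa> \<noteq> 0 \<and> D (c \<star> pw x (Suc i)) = (\<kappa> *\<^sub>k c) \<star> pw x i"
proof -
  obtain \<mu> :: 'k where \<mu>: "\<mu> \<noteq> 0" "D (pw x (Suc i)) = \<mu> *\<^sub>k pw x i"
  proof (cases "V_defined p d")
    case True
    have "\<not> p dvd Suc i"
      using i True by (auto simp: height_def dest: dvd_imp_le)
    then have "of_nat (Suc i) \<noteq> (0::'k)"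
      by (simp only: of_nat_eq_0_iff_char_dvd char not_False_eq_True)
    with that show thesis
      using derivation_pw[OF D x(1), of i] True char unit_mul[OF pw_closed[OF x(1)]] x(2) by metis
  next
    case False
    then have "i = 0" using i by (simp add: height_def)
    with that[of 1] show thesis using mul_unit[OF x(1)] x(2) by simp
  qed
  have "D (c \<star> pw x (Suc i)) = (- 1) ^ (d * l) *\<^sub>k (c \<star> (\<mu> *\<^sub>k pw x i))"
    unfolding derivation_mul[OF D c(1) pw_closed[OF x(1)]] c(2) \<mu>(2)
      zero_mul[OF pw_closed[OF x(1)]] by simp
  also have "\<dots> = ((- 1) ^ (d * l) * \<mu>) *\<^sub>k (c \<star> pw x i)"
    using mul_scale[OF c(1) pw_closed[OF x(1)]] by simp
  also have "\<dots> = (((- 1) ^ (d * l) * \<mu>) *\<^sub>k c) \<star> pw x i"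
    using scale_mul[OF c(1) pw_closed[OF x(1)]] by simp
  finally show ?thesis using \<mu>(1) by (intro exI[of _ "(- 1) ^ (d * l) * \<mu>"]) simp
qed

text \<open>Applying \<open>D\<close> to the relation kills \<open>c 0\<close> and lowers all
  exponents by one. This leaves a shorter relation whose coefficients are nonzero multiples of
  \<open>c 1\<close>, \<open>c 2\<close> and so on; once these vanish, the original relation reads
  \<open>c 0 = 0\<close>.\<close>

lemma taylor:
  assumes D: "derivation d D" and x: "x \<in> A d" "D x = e"
  assumes "\<And>i. i < q \<Longrightarrow> \<exists>l. c i \<in> A l" "\<And>i. i < q \<Longrightarrow> D (c i) = 0" "q \<le> height p d"
    "(\<Sum>i<q. c i \<star> pw x i) = 0"
  shows "\<forall>i<q. c i = 0"
  using assms(4-)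
proof (induction q arbitrary: c)
  case 0
  then show ?case by simp
next
  case (Suc q)
  interpret D: Vector_Spaces.linear sc sc D by (rule derivation_linear[OF D])
  have "\<exists>\<kappa>. \<kappa> \<noteq> 0 \<and> D (c (Suc i) \<star> pw x (Suc i)) = (\<kappa> *\<^sub>k c (Suc i)) \<star> pw x i"
    if "i < q" for i
  proof -
    obtain l where "c (Suc i) \<in> A l" using Suc.prems(1)[of "Suc i"] \<open>i < q\<close> by auto
    from derivation_mul_pw[OF D x this] show ?thesis using Suc.prems that by auto
  qed
  then obtain \<kappa> where \<kappa>: "\<And>i. i < q \<Longrightarrow> \<kappa> i \<noteq> 0"
    "\<And>i. i < q \<Longrightarrow> D (c (Suc i) \<star> pw x (Suc i)) = (\<kappa> i *\<^sub>k c (Suc i)) \<star> pw x i"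
    by metis
  obtain l0 where l0: "c 0 \<in> A l0" using Suc.prems(1)[of 0] by auto
  have c0: "c 0 \<star> pw x 0 = c 0" using mul_unit[OF l0] by simp
  have "0 = D (\<Sum>i<Suc q. c i \<star> pw x i)" using Suc.prems(4) by simp
  also have "\<dots> = D (c 0) + (\<Sum>i<q. D (c (Suc i) \<star> pw x (Suc i)))"
    unfolding sum.lessThan_Suc_shift D.add D.sum c0 ..
  also have "\<dots> = (\<Sum>i<q. (\<kappa> i *\<^sub>k c (Suc i)) \<star> pw x i)"
    using Suc.prems(2)[of 0] \<kappa>(2) by simp
  finally have sum0: "(\<Sum>i<q. (\<kappa> i *\<^sub>k c (Suc i)) \<star> pw x i) = 0" ..
  have "\<forall>i<q. \<kappa> i *\<^sub>k c (Suc i) = 0"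
  proof (rule Suc.IH[OF _ _ _ sum0])
    show "\<exists>l. \<kappa> i *\<^sub>k c (Suc i) \<in> A l" if "i < q" for i
      using Suc.prems(1)[of "Suc i"] that subspace_scale[OF subspace_A] by auto
    show "D (\<kappa> i *\<^sub>k c (Suc i)) = 0" if "i < q" for i
      using Suc.prems(2)[of "Suc i"] that by (simp add: D.scale)
  qed (use Suc.prems in auto)
  then have cS: "c (Suc i) = 0" if "i < q" for i using \<kappa>(1) that by auto
  have "c 0 = (\<Sum>i<Suc q. c i \<star> pw x i)"
    unfolding sum.lessThan_Suc_shift c0 using cS zero_mul[OF pw_closed[OF x(1)]] by (simp del: pw.simps)
  then have "c 0 = 0" using Suc.prems(4) by simp
  with cS show ?case by (metis Suc_less_eq not0_implies_Suc)
qed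

lemma triangularD: "\<lbrakk>triangular gs; (d, x, D) \<in> set gs\<rbrakk> \<Longrightarrow> x \<in> A d"
  by (induction gs rule: triangular.induct) auto

lemma subspace_monomials: "subspace (monomials gs n w)"
  by (cases "(gs, n, w)" rule: monomials.cases) (auto intro: subspace_span)

lemma monomials_subset:
  assumes "triangular gs"
  shows "monomials gs n w \<subseteq> A n"
  using assms
proof (induction gs n w rule: monomials.induct)
  case (1 n w)
  then show ?case using span_minimal[OF _ subspace_A, of "{e}"] unit_closed by auto
next
  case (2 d x D gs n w)
  show ?case unfolding monomials.simps
  proof (rule span_minimal[OF _ subspace_A], clarify)
    fix c i l v assume "c \<in> monomials gs l v" "w \<le> v + i" "i < height p d"
    with 2 have "c \<in> A l" "x \<in> A d" by auto
    then show "c \<star> pw x i \<in> A (l + i * d)" by (intro mul_closed pw_closed)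
  qed
qed

lemma monomials_mono: "w' \<le> w \<Longrightarrow> monomials gs n w \<subseteq> monomials gs n w'"
proof (cases gs)
  case Nil
  assume "w' \<le> w"
  then show ?thesis using Nil span_zero by auto
next
  case (Cons g gs')
  assume "w' \<le> w"
  then show ?thesis unfolding Cons
    by (cases g) (simp, rule span_mono, fastforce)
qed

lemma monomials_Cons:
  assumes "triangular gs" "c \<in> monomials gs n w"
  shows "c \<in> monomials ((d, x, D) # gs) n w"
proof -
  have "c = c \<star> pw x 0" using mul_unit monomials_subset assms by (metis in_mono pw.simps(1))
  then show ?thesis unfolding monomials.simps
    by (intro span_base CollectI exI[of _ c] exI[of _ "0::nat"] exI[of _ n] exI[of _ w])
      (use height_gt_1[of d] assms in auto)
qed

lemma unit_monomials: "triangular gs \<Longrightarrow> e \<in> monomials gs 0 0"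
proof (induction gs)
  case Nil
  then show ?case by (simp add: span_base)
next
  case (Cons g gs)
  then show ?case using monomials_Cons[of gs e 0 0] by (cases g) auto
qed

lemma generator_monomials:
  assumes "triangular gs" "(d, x, D) \<in> set gs"
  shows "x \<in> monomials gs d 1"
  using assms
proof (induction gs)
  case (Cons g gs)
  show ?case
  proof (cases "g = (d, x, D)")
    case True
    with Cons.prems have x: "x \<in> A d" and gs: "triangular gs" by auto
    have "x = e \<star> pw x 1" using unit_mul[OF x] mul_unit[OF x] by simp
    then show ?thesis unfolding True monomials.simps
      by (intro span_base CollectI exI[of _ e] exI[of _ "1::nat"] exI[of _ "0::nat"])
        (use height_gt_1[of d] unit_monomials[OF gs] in auto)
  next
    case False
    with Cons show ?thesis using monomials_Cons by (cases g) auto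
  qed
qed simp

text \<open>Coefficients are multiplied by induction and the powers of the head generator merge into
  one; if the exponent reaches the height, the product is zero. The bound \<open>N\<close> restricts
  the nilpotency hypothesis to the degrees in which it is known during the final induction on the
  degree.\<close>

lemma monomials_mul:
  assumes "triangular gs"
    and nilp: "\<And>d x D. \<lbrakk>(d, x, D) \<in> set gs; height p d * d \<le> N\<rbrakk> \<Longrightarrow> pw x (height p d) = 0"
    and "a \<in> monomials gs n w" "a' \<in> monomials gs n' w'" "n + n' \<le> N"
  shows "a \<star> a' \<in> monomials gs (n + n') (w + w')"
  using assms
proof (induction gs arbitrary: a a' n w n' w')
  case Nil
  show ?case
  proof (cases "n = 0 \<and> w = 0 \<and> n' = 0 \<and> w' = 0")
    case True
    with Nil.prems obtain b b' where "a = b *\<^sub>k e" "a' = b' *\<^sub>k e"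
      by (auto simp: span_singleton)
    then have "a \<star> a' = (b * b') *\<^sub>k e"
      using scale_mul[OF unit_closed subspace_scale[OF subspace_A unit_closed]]
        mul_scale[OF unit_closed unit_closed] unit_mul[OF unit_closed] by simp
    then show ?thesis using True by (simp add: span_scale span_base)
  next
    case False
    then have "a = 0 \<or> a' = 0" using Nil.prems by (auto split: if_splits)
    moreover have "a \<in> A n" "a' \<in> A n'"
      using Nil.prems monomials_subset[of "[]"] by auto
    ultimately have "a \<star> a' = 0" by auto
    then show ?thesis by (simp only: subspace_0[OF subspace_monomials])
  qed
next
  case (Cons g gs)
  obtain d x D where g: "g = (d, x, D)" by (cases g)
  have x: "x \<in> A d" and gs: "triangular gs" using Cons.prems by (auto simp: g)
  let ?M = "\<lambda>n w. {c \<star> pw x i | c i l v. i < height p d \<and> c \<in> monomials gs l v \<and> l + i * d = n \<and> w \<le> v + i}"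
  let ?S = "monomials (g # gs) (n + n') (w + w')"
  have MA: "?M n w \<subseteq> A n" for n w
  proof -
    have "?M n w \<subseteq> monomials (g # gs) n w" unfolding g monomials.simps by (rule span_superset)
    then show ?thesis using monomials_subset[OF Cons.prems(1)] by blast
  qed
  have gen: "t \<star> t' \<in> ?S" if t: "t \<in> ?M n w" "t' \<in> ?M n' w'" for t t'
  proof -
    obtain c i l v where c: "t = c \<star> pw x i" "i < height p d" "c \<in> monomials gs l v" "l + i * d = n"
      "w \<le> v + i" using t by blast
    obtain c' i' l' v' where c': "t' = c' \<star> pw x i'" "i' < height p d" "c' \<in> monomials gs l' v'"
      "l' + i' * d = n'" "w' \<le> v' + i'" using t by blast
    have cA: "c \<in> A l" "c' \<in> A l'" using monomials_subset[OF gs] c(3) c'(3) by auto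
    let ?y = "pw x i" and ?y' = "pw x i'"
    have y: "?y \<in> A (i * d)" "?y' \<in> A (i' * d)" by (intro pw_closed x)+
    \<comment> \<open>The Koszul sign for moving \<open>pw x i\<close>, of degree
      \<open>i * d\<close>, past \<open>c'\<close>.\<close>
    define \<sigma> :: 'k where "\<sigma> = (- 1) ^ (i * d * l')"
    have "t \<star> t' = c \<star> ((?y \<star> c') \<star> ?y')"
      unfolding c c' using mul_assoc[OF cA(1) y(1) mul_closed[OF cA(2) y(2)]]
        mul_assoc[OF y(1) cA(2) y(2)] by simp
    also have "?y \<star> c' = \<sigma> *\<^sub>k (c' \<star> ?y)" unfolding \<sigma>_def by (rule mul_commute[OF y(1) cA(2)])
    also have "(\<sigma> *\<^sub>k (c' \<star> ?y)) \<star> ?y' = \<sigma> *\<^sub>k ((c' \<star> ?y) \<star> ?y')"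
      by (rule scale_mul[OF mul_closed[OF cA(2) y(1)] y(2)])
    also have "(c' \<star> ?y) \<star> ?y' = c' \<star> pw x (i + i')"
      using mul_assoc[OF cA(2) y] pw_add[OF x] by simp
    also have "c \<star> (\<sigma> *\<^sub>k (c' \<star> pw x (i + i'))) = \<sigma> *\<^sub>k (c \<star> (c' \<star> pw x (i + i')))"
      by (rule mul_scale[OF cA(1) mul_closed[OF cA(2) pw_closed[OF x]]])
    also have "c \<star> (c' \<star> pw x (i + i')) = (c \<star> c') \<star> pw x (i + i')"
      using mul_assoc[OF cA pw_closed[OF x]] by simp
    finally have eq: "t \<star> t' = \<sigma> *\<^sub>k ((c \<star> c') \<star> pw x (i + i'))" .
    have "(c \<star> c') \<star> pw x (i + i') \<in> ?S"
    proof (cases "i + i' < height p d")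
      case True
      have "c \<star> c' \<in> monomials gs (l + l') (v + v')"
      proof (rule Cons.IH[OF gs _ c(3) c'(3)])
        show "l + l' \<le> N" using c(4) c'(4) Cons.prems by linarith
      qed (use Cons.prems in auto)
      then show ?thesis unfolding g monomials.simps
        by (intro span_base CollectI exI[of _ "c \<star> c'"] exI[of _ "i + i'"] exI[of _ "l + l'"]
            exI[of _ "v + v'"])
          (use True c(4,5) c'(4,5) in \<open>auto simp: algebra_simps\<close>)
    next
      case False
      \<comment> \<open>An overflowing exponent contains the factor
        \<open>pw x (height p d)\<close>, whose degree is at most \<open>(i + i') * d\<close>, hence
        at most \<open>n + n' \<le> N\<close>; so the nilpotency hypothesis applies.\<close>
      then obtain j where j: "i + i' = height p d + j" by (metis le_Suc_ex not_le)
      have "height p d * d \<le> (i + i') * d" using False by simp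
      also have "\<dots> \<le> N" using c(4) c'(4) Cons.prems(5) by (simp add: algebra_simps)
      finally have "pw x (height p d) = 0" using Cons.prems(2)[of d x D] by (simp add: g)
      then have "pw x (i + i') = 0"
        unfolding j pw_add[OF x] using zero_mul[OF pw_closed[OF x]] by simp
      then have "(c \<star> c') \<star> pw x (i + i') = 0" using mul_zero[OF mul_closed[OF cA]] by simp
      then show ?thesis by (simp only: subspace_0[OF subspace_monomials])
    qed
    then show ?thesis unfolding eq by (rule subspace_scale[OF subspace_monomials])
  qed
  have a: "a \<in> span (?M n w)" and a': "a' \<in> span (?M n' w')"
    using Cons.prems by (simp_all only: g monomials.simps)
  \<comment> \<open>Linearity is used first in \<open>a'\<close> and then in \<open>a\<close>.
    Membership in \<open>A\<close> is carried along because distributivity is available for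
    homogeneous summands only.\<close>
  have step1: "a' \<in> A n' \<and> t \<star> a' \<in> ?S" if t: "t \<in> ?M n w" for t
    using a'
  proof (induction rule: span_induct_alt)
    case base
    show ?case using mul_zero[OF subsetD[OF MA t]] by (simp add: subspace_0[OF subspace_monomials] del: monomials.simps)
  next
    case (step b u u')
    have A: "t \<in> A n" "u \<in> A n'" "u' \<in> A n'"
      using subsetD[OF MA t] subsetD[OF MA step(1)] step(2) by auto
    have "t \<star> (b *\<^sub>k u + u') = b *\<^sub>k (t \<star> u) + t \<star> u'"
      using mul_add[OF A(1) subspace_scale[OF subspace_A A(2)] A(3)] mul_scale[OF A(1,2)] by simp
    then show ?case
      using gen[OF t step(1)] step A
      by (simp only: subspace_add[OF subspace_monomials] subspace_scale[OF subspace_monomials]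
          subspace_add[OF subspace_A] subspace_scale[OF subspace_A] simp_thms)
  qed
  have "a \<in> A n \<and> a \<star> a' \<in> ?S"
    using a
  proof (induction rule: span_induct_alt)
    case base
    have "a' \<in> A n'" using monomials_subset[OF Cons.prems(1)] Cons.prems(4) by blast
    then show ?case using zero_mul by (simp add: subspace_0[OF subspace_monomials] del: monomials.simps)
  next
    case (step b u u')
    have A: "u \<in> A n" "u' \<in> A n" "a' \<in> A n'"
      using subsetD[OF MA step(1)] step(2) step1[OF step(1)] by auto
    have "(b *\<^sub>k u + u') \<star> a' = b *\<^sub>k (u \<star> a') + u' \<star> a'"
      using add_mul[OF subspace_scale[OF subspace_A A(1)] A(2,3)] scale_mul[OF A(1,3)] by simp
    then show ?case
      using step1[OF step(1)] step A
      by (simp only: subspace_add[OF subspace_monomials] subspace_scale[OF subspace_monomials]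
          subspace_add[OF subspace_A] subspace_scale[OF subspace_A] simp_thms)
  qed
  then show ?case by blast
qed

section \<open>Additivity of the \<open>p\<close>-th power map\<close>

lemma mul_sum: "\<lbrakk>x \<in> A m; \<And>i. i \<in> I \<Longrightarrow> f i \<in> A n\<rbrakk> \<Longrightarrow> x \<star> (\<Sum>i\<in>I. f i) = (\<Sum>i\<in>I. x \<star> f i)"
  by (induction I rule: infinite_finite_induct)
    (auto simp: mul_zero[of x m] mul_add[of x m _ n] subspace_sum[OF subspace_A])

lemma pw_scale: "x \<in> A d \<Longrightarrow> pw (c *\<^sub>k x) n = c ^ n *\<^sub>k pw x n"
proof (induction n)
  case (Suc n)
  then show ?case
    using scale_mul[OF Suc.prems subspace_scale[OF subspace_A pw_closed[OF Suc.prems]], of c "c ^ n" n]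
      mul_scale[OF Suc.prems pw_closed[OF Suc.prems]] by simp
qed simp

lemma pw_binomial:
  assumes x: "x \<in> A d" and y: "y \<in> A d" and comm: "y \<star> x = x \<star> y"
  shows "pw (x + y) n = (\<Sum>k\<le>n. of_nat (n choose k) *\<^sub>k (pw x k \<star> pw y (n - k)))"
proof (induction n)
  case 0
  show ?case using unit_mul[OF unit_closed] by simp
next
  case (Suc n)
  define T where "T k j = pw x k \<star> pw y j" for k j
  have T: "T k j \<in> A ((k + j) * d)" for k j
    using mul_closed[OF pw_closed[OF x, of k] pw_closed[OF y, of j]]
    by (simp add: T_def add_mult_distrib)
  let ?S = "\<Sum>k\<le>n. of_nat (n choose k) *\<^sub>k T k (n - k)"
  have Tn: "of_nat (n choose k) *\<^sub>k T k (n - k) \<in> A (n * d)" if "k \<in> {..n}" for k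
    using T[of k "n - k"] that by (auto intro: subspace_scale subspace_A)
  have xT: "x \<star> T k j = T (Suc k) j" for k j
    using mul_assoc[OF x pw_closed[OF x] pw_closed[OF y]] by (simp add: T_def)
  have "y \<star> pw x k = pw x k \<star> y" for k
  proof (induction k)
    case 0
    show ?case using unit_mul[OF y] mul_unit[OF y] by simp
  next
    case (Suc k)
    have "y \<star> (x \<star> pw x k) = x \<star> (y \<star> pw x k)"
      using mul_assoc[OF y x pw_closed[OF x]] mul_assoc[OF x y pw_closed[OF x]] comm by simp
    then show ?case using Suc mul_assoc[OF x pw_closed[OF x] y] by simp
  qed
  then have yT: "y \<star> T k j = T k (Suc j)" for k j
    using mul_assoc[OF y pw_closed[OF x] pw_closed[OF y]]
      mul_assoc[OF pw_closed[OF x] y pw_closed[OF y]] by (simp add: T_def)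
  have "pw (x + y) (Suc n) = (x + y) \<star> ?S"
    using Suc by (simp add: T_def)
  also have "\<dots> = x \<star> ?S
      + y \<star> ?S"
    by (rule add_mul[OF x y subspace_sum[OF subspace_A[of "n * d"]]]) (rule Tn)
  also have "x \<star> ?S
      = (\<Sum>k\<le>n. of_nat (n choose k) *\<^sub>k T (Suc k) (n - k))"
    by (subst mul_sum[OF x, where n="n * d"], erule Tn) (simp only: mul_scale[OF x T] xT)
  also have "y \<star> ?S
      = (\<Sum>k\<le>n. of_nat (n choose k) *\<^sub>k T k (Suc n - k))"
    by (subst mul_sum[OF y, where n="n * d"], erule Tn)
      (auto simp: mul_scale[OF y T] yT Suc_diff_le intro!: sum.cong)
  \<comment> \<open>The added term is zero since \<open>n choose Suc n = 0\<close>; it prepares the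
    index shift that leads to Pascal's rule.\<close>
  also have "\<dots> = (\<Sum>k\<le>Suc n. of_nat (n choose k) *\<^sub>k T k (Suc n - k))"
    by (simp add: binomial_eq_0)
  also have "\<dots> = T 0 (Suc n) + (\<Sum>k\<le>n. of_nat (n choose Suc k) *\<^sub>k T (Suc k) (n - k))"
    by (subst sum.atMost_Suc_shift) simp
  also have "(\<Sum>k\<le>n. of_nat (n choose k) *\<^sub>k T (Suc k) (n - k)) + \<dots>
      = T 0 (Suc n) + (\<Sum>k\<le>n. of_nat (Suc n choose Suc k) *\<^sub>k T (Suc k) (n - k))"
    by (simp add: sum.distrib scale_left_distrib algebra_simps)
  also have "\<dots> = (\<Sum>k\<le>Suc n. of_nat (Suc n choose k) *\<^sub>k T k (Suc n - k))"
    by (subst sum.atMost_Suc_shift) simp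
  finally show ?case by (simp add: T_def)
qed

text \<open>In these degrees \<open>x\<close> and \<open>y\<close> commute, so the binomial theorem
  applies, and \<open>p\<close> divides all inner binomial coefficients.\<close>

lemma frobenius_add:
  assumes x: "x \<in> A d" and y: "y \<in> A d" and V: "V_defined p d"
  shows "pw (x + y) p = pw x p + pw y p"
proof -
  have "y \<star> x = x \<star> y" using mul_commute[OF y x] V_defined_sign[of d d] V char by simp
  then have "pw (x + y) p = (\<Sum>k\<le>p. of_nat (p choose k) *\<^sub>k (pw x k \<star> pw y (p - k)))"
    by (rule pw_binomial[OF x y])
  also have "\<dots> = (\<Sum>k\<in>{0, p}. of_nat (p choose k) *\<^sub>k (pw x k \<star> pw y (p - k)))"
  proof (rule sum.mono_neutral_right)
    show "\<forall>k\<in>{..p} - {0, p}. of_nat (p choose k) *\<^sub>k (pw x k \<star> pw y (p - k)) = 0"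
    proof
      fix k assume "k \<in> {..p} - {0, p}"
      then have "p dvd p choose k" by (intro dvd_choose_prime[OF _ _ _ prime_char]) auto
      then have "of_nat (p choose k) = (0::'k)"
        unfolding of_nat_eq_0_iff_char_dvd char .
      then show "of_nat (p choose k) *\<^sub>k (pw x k \<star> pw y (p - k)) = 0" by simp
    qed
  qed auto
  also have "\<dots> = pw x p + pw y p"
    using p_pos unit_mul[OF pw_closed[OF y]] mul_unit[OF pw_closed[OF x]] by simp
  finally show ?thesis .
qed

text \<open>The power rule yields the factor \<open>p\<close>, which is 0 in the field.\<close>

lemma derivation_frobenius:
  assumes "derivation d D" "x \<in> A n" "V_defined p n"
  shows "D (pw x p) = 0"
proof -
  obtain q where q: "p = Suc q" using p_pos by (cases p) auto
  have "of_nat p = (0::'k)" using char of_nat_CHAR[where 'a='k] by simp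
  then show ?thesis using derivation_pw[OF assms(1,2), of q] assms(3) char by (simp only: q scale_zero_left)
qed

text \<open>Terms with the same power of the head generator are collected into one coefficient.
  Subtraction of degrees is truncated, so for \<open>n < i * d\<close> the coefficient is set to 0
  explicitly.\<close>

lemma monomials_normal_form:
  assumes "a \<in> monomials ((d, x, D) # gs) n w" and tri: "triangular ((d, x, D) # gs)"
  shows "\<exists>c. a = (\<Sum>i<height p d. c i \<star> pw x i) \<and>
    (\<forall>i. c i \<in> monomials gs (n - i * d) (w - i) \<and> (n < i * d \<longrightarrow> c i = 0))"
  using assms(1) unfolding monomials.simps
proof (induction rule: span_induct_alt)
  case base
  have "0 = (\<Sum>i<height p d. 0 \<star> pw x i)"
    using tri zero_mul[OF pw_closed[of x d]] by simp
  then show ?case by (intro exI[of _ "\<lambda>_. 0"]) (simp add: subspace_0[OF subspace_monomials])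
next
  case (step b t a)
  have x: "x \<in> A d" and gs: "triangular gs" using tri by auto
  obtain c0 i0 l v where c0: "t = c0 \<star> pw x i0" "i0 < height p d" "c0 \<in> monomials gs l v"
    "l + i0 * d = n" "w \<le> v + i0" using step(1) by blast
  obtain c where c: "a = (\<Sum>i<height p d. c i \<star> pw x i)"
    "\<And>i. c i \<in> monomials gs (n - i * d) (w - i)" "\<And>i. n < i * d \<Longrightarrow> c i = 0"
    using step(2) by blast
  define c' where "c' i = (if i = i0 then b *\<^sub>k c0 + c i else c i)" for i
  have l: "n - i0 * d = l" "w - i0 \<le> v" using c0 by auto
  have c0': "c0 \<in> monomials gs (n - i0 * d) (w - i0)"
    using c0(3) monomials_mono[OF l(2)] unfolding l(1) by blast
  have cA: "c0 \<in> A (n - i0 * d)" "c i \<in> A (n - i * d)" for i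
    using monomials_subset[OF gs] c0' c(2) by blast+
  have "(b *\<^sub>k c0 + c i0) \<star> pw x i0 = b *\<^sub>k t + c i0 \<star> pw x i0"
    unfolding c0(1) using add_mul[OF subspace_scale[OF subspace_A cA(1)] cA(2) pw_closed[OF x]]
      scale_mul[OF cA(1) pw_closed[OF x]] by simp
  then have "c' i \<star> pw x i = (if i = i0 then b *\<^sub>k t else 0) + c i \<star> pw x i" for i
    by (simp add: c'_def)
  then have "(\<Sum>i<height p d. c' i \<star> pw x i) =
      (\<Sum>i<height p d. if i = i0 then b *\<^sub>k t else 0) + (\<Sum>i<height p d. c i \<star> pw x i)"
    by (simp only: sum.distrib)
  also have "\<dots> = b *\<^sub>k t + a" using c0(2) by (simp add: c(1) sum.delta)
  finally have "b *\<^sub>k t + a = (\<Sum>i<height p d. c' i \<star> pw x i)" ..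
  moreover have "c' i \<in> monomials gs (n - i * d) (w - i)" for i
    using c(2)[of i] c0' by (auto simp: c'_def subspace_add subspace_scale subspace_monomials)
  moreover have "n < i * d \<Longrightarrow> c' i = 0" for i
    using c(3) c0(4) by (auto simp: c'_def)
  ultimately show ?case by blast
qed

text \<open>By the Leibniz rule the kernel of \<open>D\<close> is closed under the products that
  form monomials, and it contains the unit and all generators of the list.\<close>

lemma derivation_monomials:
  assumes D: "derivation d D" and gs: "triangular gs"
    and "\<forall>(d', x', D')\<in>set gs. D x' = 0" and "a \<in> monomials gs n w"
  shows "D a = 0"
proof -
  interpret D: Vector_Spaces.linear sc sc D by (rule derivation_linear[OF D])
  show ?thesis using gs assms(3,4)
  proof (induction gs arbitrary: a n w)
    case Nil
    then show ?case using derivation_unit[OF D]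
      by (auto simp: span_singleton D.scale split: if_splits)
  next
    case (Cons g gs)
    obtain d' x' D' where g: "g = (d', x', D')" by (cases g)
    have x': "x' \<in> A d'" "D x' = 0" and gs: "triangular gs" using Cons.prems by (auto simp: g)
    have pw0: "D (pw x' i) = 0" for i
    proof (induction i)
      case (Suc i)
      then show ?case
        using derivation_mul[OF D x'(1) pw_closed[OF x'(1)]] x' zero_mul[OF pw_closed[OF x'(1)]]
        by (simp add: mul_zero[OF x'(1)])
    qed (simp add: derivation_unit[OF D])
    show ?case using Cons.prems(3) unfolding g monomials.simps
    proof (induction rule: span_induct_alt)
      case (step b t u)
      obtain c i l v where c: "t = c \<star> pw x' i" "c \<in> monomials gs l v" using step(1) by blast
      have cA: "c \<in> A l" using monomials_subset[OF gs] c(2) by blast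
      have "D c = 0" using Cons.IH[OF gs _ c(2)] Cons.prems(2) by auto
      then have "D t = 0"
        unfolding c(1) derivation_mul[OF D cA pw_closed[OF x'(1)]] pw0
        using zero_mul[OF pw_closed[OF x'(1)]] mul_zero[OF cA] by simp
      then show ?case using step(2) by (simp add: D.add D.scale)
    qed simp
  qed
qed

text \<open>Induction along the list, removing the generator adjoined last. The equation
  \<open>D z = 0\<close> for its operator leaves only the constant coefficient of the expansion of
  \<open>z\<close> in its powers, so \<open>z\<close> already lies over the tail. Over the empty
  list, weight 2 leaves only 0.\<close>

lemma monomials_eq_0:
  assumes "triangular gs" "z \<in> monomials gs n 2" "\<forall>(d, x, D)\<in>set gs. D z = 0"
  shows "z = 0"
  using assms
proof (induction gs)
  case (Cons g gs)
  obtain d x D where g: "g = (d, x, D)" by (cases g)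
  have D: "derivation d D" "x \<in> A d" "D x = e" "\<forall>(d', x', D')\<in>set gs. D x' = 0" "D z = 0"
    and gs: "triangular gs" using Cons.prems by (auto simp: g)
  interpret D: Vector_Spaces.linear sc sc D by (rule derivation_linear[OF D(1)])
  obtain c where c: "z = (\<Sum>i<height p d. c i \<star> pw x i)"
    "\<And>i. c i \<in> monomials gs (n - i * d) (2 - i)"
    using monomials_normal_form[of z d x D gs n 2] Cons.prems by (auto simp: g)
  have cA: "c i \<in> A (n - i * d)" for i using monomials_subset[OF gs] c(2) by blast
  have Dc: "D (c i) = 0" for i by (rule derivation_monomials[OF D(1) gs D(4) c(2)])
  obtain q where q: "height p d = Suc q" using height_gt_1[of d] by (cases "height p d") auto
  have "\<exists>\<kappa>. \<kappa> \<noteq> 0 \<and> D (c (Suc i) \<star> pw x (Suc i)) = (\<kappa> *\<^sub>k c (Suc i)) \<star> pw x i" if "i < q" for i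
    using derivation_mul_pw[OF D(1,2,3) cA Dc] that q by simp
  then obtain \<kappa> where \<kappa>: "\<And>i. i < q \<Longrightarrow> \<kappa> i \<noteq> 0"
    "\<And>i. i < q \<Longrightarrow> D (c (Suc i) \<star> pw x (Suc i)) = (\<kappa> i *\<^sub>k c (Suc i)) \<star> pw x i"
    by metis
  have c0: "c 0 \<star> pw x 0 = c 0" using mul_unit[OF cA] by simp
  have "D z = D (c 0) + (\<Sum>i<q. D (c (Suc i) \<star> pw x (Suc i)))"
    unfolding c(1) q sum.lessThan_Suc_shift D.add D.sum c0 ..
  \<comment> \<open>\<open>D z = 0\<close> becomes a relation of length
    \<open>q = height p d - 1\<close> whose coefficients are again killed by \<open>D\<close>, so
    \<open>taylor\<close> applies.\<close>
  then have sum0: "(\<Sum>i<q. (\<kappa> i *\<^sub>k c (Suc i)) \<star> pw x i) = 0" using \<kappa>(2) D(5) Dc by simp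
  have "\<forall>i<q. \<kappa> i *\<^sub>k c (Suc i) = 0"
  proof (rule taylor[OF D(1,2,3) _ _ _ sum0])
    show "\<exists>l. \<kappa> i *\<^sub>k c (Suc i) \<in> A l" for i
      using cA subspace_scale[OF subspace_A] by blast
    show "D (\<kappa> i *\<^sub>k c (Suc i)) = 0" for i by (simp add: D.scale Dc)
  qed (simp add: q)
  then have "c (Suc i) = 0" if "i < q" for i using \<kappa>(1) that by auto
  then have "z = c 0"
    unfolding c(1) q sum.lessThan_Suc_shift c0 using zero_mul[OF pw_closed[OF D(2)]] by (simp del: pw.simps)
  \<comment> \<open>The coefficient at exponent 0 keeps the weight \<open>2 - 0 = 2\<close>, as the
    induction hypothesis demands.\<close>
  then show ?case using Cons.IH[OF gs] c(2)[of 0] Cons.prems(3) by (auto simp: numeral_2_eq_2)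
qed simp

end

section \<open>Tensors and graded duals\<close>

interpretation fun_space: vector_space "fun_scale :: 'k::field \<Rightarrow> ('a \<Rightarrow> 'k) \<Rightarrow> _"
  by (rule vector_space_fun_scale)

lemma fun_scale_apply: "fun_scale c t x = c * t x"
  by (simp add: fun_scale_def)

lemma sum_fun_apply: "(\<Sum>i\<in>I. f i) x = (\<Sum>i\<in>I. f i x)"
  by (induction I rule: infinite_finite_induct) simp_all

lemma pure_tensor_apply: "bilinear_map s1 s2 (*) \<beta> \<Longrightarrow> pure_tensor s1 s2 a b \<beta> = \<beta> a b"
  by (simp add: pure_tensor_def)

lemma bilinear_map_iff:
  assumes "vector_space s1" "vector_space s2" "vector_space s3"
  shows "bilinear_map s1 s2 s3 f \<longleftrightarrow>
    (\<forall>x x' y. f (x + x') y = f x y + f x' y) \<and> (\<forall>c x y. f (s1 c x) y = s3 c (f x y)) \<and>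
    (\<forall>x y y'. f x (y + y') = f x y + f x y') \<and> (\<forall>c x y. f x (s2 c y) = s3 c (f x y))"
  using assms by (auto simp: bilinear_map_def linear_iff_raw)

lemma separating_functional:
  assumes V: "vector_space (s :: 'k::field \<Rightarrow> 'v::ab_group_add \<Rightarrow> 'v)" and x: "x \<notin> module.span s S"
  shows "\<exists>\<phi>. Vector_Spaces.linear s (*) \<phi> \<and> \<phi> x \<noteq> 0 \<and> (\<forall>y\<in>S. \<phi> y = 0)"
proof -
  interpret vector_space_pair s "(*) :: 'k \<Rightarrow> 'k \<Rightarrow> 'k"
    using V vector_space_mult by (simp add: vector_space_pair_def)
  obtain B where B: "B \<subseteq> S" "vs1.independent B" "S \<subseteq> vs1.span B"
    using vs1.maximal_independent_subset by metis
  have xB: "x \<notin> vs1.span B" using x B(1) vs1.span_mono by blast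
  then have "vs1.independent (insert x B)" using B(2) by (rule vs1.independent_insertI)
  from linear_independent_extend[OF this, of "\<lambda>b. if b = x then 1 else 0"]
  obtain \<phi> where \<phi>: "Vector_Spaces.linear s (*) \<phi>" "\<phi> x = 1" "\<And>b. b \<in> B \<Longrightarrow> b \<noteq> x \<Longrightarrow> \<phi> b = 0"
    by auto
  have "\<phi> b = 0" if "b \<in> B" for b using \<phi>(3)[OF that] that xB vs1.span_base by blast
  then have "\<phi> y = 0" if "y \<in> S" for y
    using that B(3) linear_eq_0_on_span[OF \<phi>(1)] by blast
  with \<phi> show ?thesis by auto
qed

section \<open>Evaluating tensors at bilinear forms\<close>

context
  fixes s1 :: "'k::field \<Rightarrow> 'a::ab_group_add \<Rightarrow> 'a" and s2 :: "'k \<Rightarrow> 'b::ab_group_add \<Rightarrow> 'b"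
  assumes V1: "vector_space s1" and V2: "vector_space s2"
begin

lemma tensor_product_induct [consumes 1, case_names zero add scale pure]:
  assumes "t \<in> tensor_product s1 s2" "P 0" "\<And>t u. P t \<Longrightarrow> P u \<Longrightarrow> P (t + u)"
    "\<And>c t. P t \<Longrightarrow> P (fun_scale c t)" "\<And>a b. P (pure_tensor s1 s2 a b)"
  shows "P t"
  using assms(1) unfolding tensor_product_def
proof (induction rule: fun_space.span_induct_alt)
  case (step c x y)
  then obtain a b where "x = pure_tensor s1 s2 a b" by auto
  then show ?case using assms(3)[OF assms(4)[OF assms(5)] step(2)] by blast
qed (rule assms(2))

text \<open>The encoding makes a tensor a function of the form; elements of
  \<open>tensor_product\<close> are combinations of evaluations, hence linear in it. Bilinearity
  matters because a pure tensor is 0 at every other argument.\<close>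

lemma tensor_apply_add:
  assumes "t \<in> tensor_product s1 s2" "bilinear_map s1 s2 (*) \<beta>" "bilinear_map s1 s2 (*) \<gamma>"
  shows "t (\<lambda>a b. \<beta> a b + \<gamma> a b) = t \<beta> + t \<gamma>"
proof -
  have "bilinear_map s1 s2 (*) (\<lambda>a b. \<beta> a b + \<gamma> a b)"
    using assms(2,3) by (simp add: bilinear_map_iff V1 V2 vector_space_mult algebra_simps)
  with assms show ?thesis
    by (induction rule: tensor_product_induct)
      (simp_all add: fun_scale_def pure_tensor_def algebra_simps)
qed

lemma tensor_apply_scale:
  assumes "t \<in> tensor_product s1 s2" "bilinear_map s1 s2 (*) \<beta>"
  shows "t (\<lambda>a b. c * \<beta> a b) = c * t \<beta>"
proof -
  have "bilinear_map s1 s2 (*) (\<lambda>a b. c * \<beta> a b)"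
    using assms(2) by (simp add: bilinear_map_iff V1 V2 vector_space_mult algebra_simps)
  with assms show ?thesis
    by (induction rule: tensor_product_induct)
      (simp_all add: fun_scale_def pure_tensor_def algebra_simps)
qed

lemma tensor_lift_linear:
  assumes "vector_space s3" "bilinear_map s1 s2 s3 f"
  shows "Vector_Spaces.linear fun_scale s3 (tensor_lift s1 s2 s3 f)"
    and tensor_lift_pure: "tensor_lift s1 s2 s3 f (pure_tensor s1 s2 a b) = f a b"
  using someI_ex[OF tensor_universal[OF V1 V2 assms]] unfolding tensor_lift_def by blast+

text \<open>Both sides are linear in \<open>t\<close> and agree on pure tensors. This turns the
  lift, which is defined by choice, into an evaluation of the tensor; the later computations with
  \<open>\<Delta>\<close> rely on such evaluations.\<close>

lemma functional_tensor_lift: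
  assumes V3: "vector_space s3" and f: "bilinear_map s1 s2 s3 f"
    and \<phi>: "Vector_Spaces.linear s3 (*) \<phi>" and t: "t \<in> tensor_product s1 s2"
  shows "\<phi> (tensor_lift s1 s2 s3 f t) = t (\<lambda>a b. \<phi> (f a b))"
proof -
  have \<beta>: "bilinear_map s1 s2 (*) (\<lambda>a b. \<phi> (f a b))"
    using f \<phi> by (simp add: bilinear_map_iff V1 V2 V3 linear_iff_raw vector_space_mult)
  interpret L: Vector_Spaces.linear fun_scale s3 "tensor_lift s1 s2 s3 f"
    by (rule tensor_lift_linear[OF V3 f])
  interpret \<phi>: Vector_Spaces.linear s3 "(*)" \<phi> by (rule \<phi>)
  show ?thesis using t
    by (induction rule: tensor_product_induct)
      (simp_all only: L.zero L.add L.scale \<phi>.zero \<phi>.add \<phi>.scale tensor_lift_pure[OF V3 f]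
        pure_tensor_apply[OF \<beta>], simp_all only: plus_fun_apply zero_fun_apply fun_scale_apply)
qed

lemma tensor_lift_apply:
  assumes f: "bilinear_map s1 s2 fun_scale f" and t: "t \<in> tensor_product s1 s2"
  shows "tensor_lift s1 s2 fun_scale f t \<gamma> = t (\<lambda>a b. f a b \<gamma>)"
proof (rule functional_tensor_lift[OF vector_space_fun_scale f _ t])
  show "Vector_Spaces.linear fun_scale (*) (\<lambda>t. t \<gamma>)"
    by (simp add: linear_iff_raw vector_space_fun_scale vector_space_mult fun_scale_def)
qed

lemma tensor_lift_mult:
  assumes "bilinear_map s1 s2 (*) \<beta>" and "t \<in> tensor_product s1 s2"
  shows "tensor_lift s1 s2 (*) \<beta> t = t \<beta>"
  using functional_tensor_lift[OF vector_space_mult assms(1) _ assms(2), of "\<lambda>x. x"]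
  by (simp add: linear_iff_raw vector_space_mult)

lemma bilinear_rank_one:
  "\<lbrakk>Vector_Spaces.linear s1 (*) a; Vector_Spaces.linear s2 (*) b\<rbrakk> \<Longrightarrow>
   bilinear_map s1 s2 (*) (\<lambda>u v. a u * b v)"
  by (simp add: bilinear_map_iff linear_iff_raw V1 V2 vector_space_mult algebra_simps)

text \<open>Write \<open>t\<close> as a finite sum of tensors \<open>f b \<otimes> b\<close> over
  elements \<open>b\<close> of a basis of the second factor. Pairing with the coordinate functional
  of \<open>b\<close> and any functional \<open>a\<close> leaves \<open>a (f b)\<close>, so every
  \<open>f b\<close> is 0.\<close>

lemma tensor_eq_0I:
  assumes t: "t \<in> tensor_product s1 s2"
    and 0: "\<And>a b. \<lbrakk>Vector_Spaces.linear s1 (*) a; Vector_Spaces.linear s2 (*) b\<rbrakk> \<Longrightarrow> t (\<lambda>u v. a u * b v) = 0"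
  shows "t = 0"
proof -
  interpret v1: vector_space s1 by (rule V1)
  interpret v2: vector_space_pair s2 "(*) :: 'k \<Rightarrow> 'k \<Rightarrow> 'k"
    using V2 vector_space_mult by (simp add: vector_space_pair_def)
  have pt: "pure_tensor s1 s2 (x + x') y = pure_tensor s1 s2 x y + pure_tensor s1 s2 x' y"
    "pure_tensor s1 s2 (s1 c x) y = fun_scale c (pure_tensor s1 s2 x y)"
    "pure_tensor s1 s2 x (y + y') = pure_tensor s1 s2 x y + pure_tensor s1 s2 x y'"
    "pure_tensor s1 s2 x (s2 c y) = fun_scale c (pure_tensor s1 s2 x y)" for c x x' y y'
    using pure_tensor_bilinear[OF V1 V2]
    by (auto simp: bilinear_map_iff V1 V2 vector_space_fun_scale)
  have pure0: "pure_tensor s1 s2 0 y = 0" for y using pt(2)[where c=0 and x=0 and y=y] by (simp only: fun_space.scale_zero_left v1.scale_zero_left)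
  obtain B where B: "v2.vs1.independent B" "v2.vs1.span B = UNIV"
    using v2.vs1.maximal_independent_subset[of UNIV] by (metis top.extremum_uniqueI)
  have "\<exists>F f. finite F \<and> F \<subseteq> B \<and> t = (\<Sum>b\<in>F. pure_tensor s1 s2 (f b) b)"
    using t
  proof (induction rule: tensor_product_induct)
    case zero
    show ?case by (intro exI[of _ "{}"]) simp
  next
    case (add t u)
    then obtain F f F' f' where F: "finite F" "F \<subseteq> B" "t = (\<Sum>b\<in>F. pure_tensor s1 s2 (f b) b)"
      "finite F'" "F' \<subseteq> B" "u = (\<Sum>b\<in>F'. pure_tensor s1 s2 (f' b) b)" by auto
    \<comment> \<open>Both coefficient families are extended by 0 to the union of their index sets,
      so that they can be added termwise.\<close>
    let ?g = "\<lambda>b. if b \<in> F then f b else 0" and ?g' = "\<lambda>b. if b \<in> F' then f' b else 0"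
    have "t = (\<Sum>b\<in>F \<union> F'. pure_tensor s1 s2 (?g b) b)"
      unfolding F(3) by (rule sum.mono_neutral_cong_left) (use F in \<open>auto simp: pure0\<close>)
    moreover have "u = (\<Sum>b\<in>F \<union> F'. pure_tensor s1 s2 (?g' b) b)"
      unfolding F(6) by (rule sum.mono_neutral_cong_left) (use F in \<open>auto simp: pure0\<close>)
    ultimately have "t + u = (\<Sum>b\<in>F \<union> F'. pure_tensor s1 s2 (?g b + ?g' b) b)"
      by (simp only: pt sum.distrib)
    then show ?case using F by (intro exI[of _ "F \<union> F'"] exI[of _ "\<lambda>b. ?g b + ?g' b"]) auto
  next
    case (scale c t)
    then obtain F f where "finite F" "F \<subseteq> B" "t = (\<Sum>b\<in>F. pure_tensor s1 s2 (f b) b)" by auto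
    then show ?case
      by (intro exI[of _ F] exI[of _ "\<lambda>b. s1 c (f b)"]) (simp add: pt fun_space.scale_sum_right)
  next
    case (pure x y)
    have "y \<in> v2.vs1.span B" using B(2) by simp
    then show ?case
    proof (induction rule: v2.vs1.span_induct_alt)
      case base
      show ?case using pt(4)[of x 0 0] by (intro exI[of _ "{}"]) simp
    next
      case (step c b y)
      then obtain F f where F: "finite F" "F \<subseteq> B" "pure_tensor s1 s2 x y = (\<Sum>b\<in>F. pure_tensor s1 s2 (f b) b)"
        by auto
      let ?g = "\<lambda>b. if b \<in> F then f b else 0" and ?g' = "\<lambda>b'. if b' = b then s1 c x else 0"
      have "pure_tensor s1 s2 x y = (\<Sum>b\<in>insert b F. pure_tensor s1 s2 (?g b) b)"
        unfolding F(3) by (rule sum.mono_neutral_cong_left) (use F in \<open>auto simp: pure0\<close>)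
      moreover have "pure_tensor s1 s2 x (s2 c b) = (\<Sum>b\<in>insert b F. pure_tensor s1 s2 (?g' b) b)"
      proof -
        have "(\<Sum>b\<in>insert b F. pure_tensor s1 s2 (?g' b) b) = (\<Sum>b\<in>{b}. pure_tensor s1 s2 (?g' b) b)"
          by (rule sum.mono_neutral_cong_right) (use F in \<open>auto simp: pure0\<close>)
        then show ?thesis by (simp add: pt)
      qed
      ultimately have "pure_tensor s1 s2 x (s2 c b + y) = (\<Sum>b\<in>insert b F. pure_tensor s1 s2 (?g' b + ?g b) b)"
        by (simp only: pt sum.distrib)
      then show ?case using F step(1)
        by (intro exI[of _ "insert b F"] exI[of _ "\<lambda>b. ?g' b + ?g b"]) auto
    qed
  qed
  then obtain F f where F: "finite F" "F \<subseteq> B" "t = (\<Sum>b\<in>F. pure_tensor s1 s2 (f b) b)" by auto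
  have "f b = 0" if b: "b \<in> F" for b
  proof (rule ccontr)
    assume "f b \<noteq> 0"
    then obtain a where a: "Vector_Spaces.linear s1 (*) a" "a (f b) \<noteq> 0"
      using functional_separates[OF V1] by blast
    obtain b' where b': "Vector_Spaces.linear s2 (*) b'" "\<And>x. x \<in> B \<Longrightarrow> b' x = (if x = b then 1 else 0)"
      using v2.linear_independent_extend[OF B(1), of "\<lambda>x. if x = b then 1 else 0"] by auto
    have "t (\<lambda>u v. a u * b' v) = (\<Sum>x\<in>F. a (f x) * b' x)"
      unfolding F(3) by (simp add: pure_tensor_def bilinear_rank_one[OF a(1) b'(1)] sum_fun_apply)
    also have "\<dots> = (\<Sum>x\<in>F. if x = b then a (f b) else 0)"
      by (rule sum.cong) (use F b'(2) in auto)
    also have "\<dots> = a (f b)" using F(1) b by simp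
    finally show False using 0[OF a(1) b'(1)] a(2) by simp
  qed
  then show ?thesis unfolding F(3) by (simp add: pure0)
qed

end

section \<open>Components, graded duals and the Koszul sign\<close>

context graded_vector_space
begin

lemma linear_functional_iff:
  "Vector_Spaces.linear s (*) a \<longleftrightarrow> (\<forall>x y. a (x + y) = a x + a y) \<and> (\<forall>c x. a (s c x) = c * a x)"
  by (simp add: linear_iff_raw vector_space_axioms vector_space_mult)

lemma functional_add: "Vector_Spaces.linear s (*) a \<Longrightarrow> a (x + y) = a x + a y"
  and functional_scale: "Vector_Spaces.linear s (*) a \<Longrightarrow> a (s c x) = c * a x"
  and functional_zero: "Vector_Spaces.linear s (*) a \<Longrightarrow> a 0 = 0"
  and functional_diff: "Vector_Spaces.linear s (*) a \<Longrightarrow> a (x - y) = a x - a y"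
  and functional_sum: "Vector_Spaces.linear s (*) a \<Longrightarrow> a (sum f I) = (\<Sum>i\<in>I. a (f i))"
proof -
  show "a (x + y) = a x + a y" "a (s c x) = c * a x" if "Vector_Spaces.linear s (*) a"
    using that by (auto simp: linear_functional_iff)
  show "a 0 = 0" "a (x - y) = a x - a y" "a (sum f I) = (\<Sum>i\<in>I. a (f i))"
    if "Vector_Spaces.linear s (*) a"
    using Vector_Spaces.linear.axioms(3)[OF that]
    by (rule module_hom.zero module_hom.diff module_hom.sum)+
qed

lemma subspace_G: "subspace (G n)"
  by (rule subspace_piece)

lemma
  shows component_in: "component G x n \<in> G n"
    and finite_component: "finite {n. component G x n \<noteq> 0}"
    and component_sum': "x = (\<Sum>n | component G x n \<noteq> 0. component G x n)"
  using theI'[OF decomposition[of x], folded component_def] by (iprover)+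

lemma component_eqI:
  assumes "\<And>n. c n \<in> G n" "finite I" "\<And>n. n \<notin> I \<Longrightarrow> c n = 0" "x = (\<Sum>n\<in>I. c n)"
  shows "component G x n = c n"
proof -
  have "finite {n. c n \<noteq> 0}" by (rule finite_subset[OF _ assms(2)]) (use assms(3) in auto)
  moreover have "x = (\<Sum>n | c n \<noteq> 0. c n)"
    unfolding assms(4) by (rule sum.mono_neutral_right[OF assms(2)]) (use assms(3) in auto)
  ultimately have "(\<forall>n. c n \<in> G n) \<and> finite {n. c n \<noteq> 0} \<and> x = (\<Sum>n | c n \<noteq> 0. c n)"
    using assms(1) by iprover
  then have "component G x = c"
    unfolding component_def by (rule the1_equality[OF decomposition])
  then show ?thesis by simp
qed

lemma component_sum:
  assumes "finite I" "\<And>n. component G x n \<noteq> 0 \<Longrightarrow> n \<in> I"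
  shows "(\<Sum>n\<in>I. component G x n) = x"
proof -
  have "(\<Sum>n\<in>I. component G x n) = (\<Sum>n | component G x n \<noteq> 0. component G x n)"
    by (rule sum.mono_neutral_right) (use assms in auto)
  then show ?thesis by (rule trans[OF _ component_sum'[symmetric]])
qed

lemma component_add: "component G (x + y) n = component G x n + component G y n"
proof (rule component_eqI[where c = "\<lambda>n. component G x n + component G y n"])
  let ?I = "{n. component G x n \<noteq> 0} \<union> {n. component G y n \<noteq> 0}"
  show fin: "finite ?I" by (intro finite_UnI finite_component)
  have 1: "(\<Sum>n\<in>?I. component G x n) = x"
    by (rule component_sum[OF fin]) simp
  have 2: "(\<Sum>n\<in>?I. component G y n) = y"
    by (rule component_sum[OF fin]) simp
  show "x + y = (\<Sum>n\<in>?I. component G x n + component G y n)"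
    unfolding sum.distrib 1 2 ..
  show "component G x n + component G y n \<in> G n" for n
    by (intro subspace_add[OF subspace_G] component_in)
  show "component G x n + component G y n = 0" if "n \<notin> ?I" for n
    using that by simp
qed

lemma component_scale: "component G (s c x) n = s c (component G x n)"
proof (rule component_eqI[where c = "\<lambda>n. s c (component G x n)"])
  let ?I = "{n. component G x n \<noteq> 0}"
  show fin: "finite ?I" by (rule finite_component)
  show "s c x = (\<Sum>n\<in>?I. s c (component G x n))"
    unfolding scale_sum_right[symmetric] component_sum'[symmetric] ..
  show "s c (component G x n) \<in> G n" for n
    by (intro subspace_scale[OF subspace_G] component_in)
qed auto

lemma component_homogeneous:
  assumes "x \<in> G n"
  shows "component G x m = (if m = n then x else 0)"
  by (rule component_eqI[of "\<lambda>m. if m = n then x else 0" "{n}"]) (use assms subspace_0[OF subspace_G] in auto)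

lemma component_zero [simp]: "component G 0 n = 0"
  using component_homogeneous[OF subspace_0[OF subspace_G]] by simp

lemma graded_induct [case_names homogeneous add]:
  assumes "\<And>x n. x \<in> G n \<Longrightarrow> P x" "\<And>x y. P x \<Longrightarrow> P y \<Longrightarrow> P (x + y)"
  shows "P x"
proof -
  have "P (\<Sum>n\<in>I. component G x n)" if "finite I" for I
    using that
  proof (induction I)
    case empty
    show ?case using assms(1)[OF subspace_0[OF subspace_G]] by simp
  qed (auto intro: assms component_in)
  from this[OF finite_component] show ?thesis by (subst component_sum'[of x])
qed

lemma functional_component:
  assumes "a \<in> dual_piece s G n"
  shows "a (component G x n) = a x"
proof -
  have a: "Vector_Spaces.linear s (*) a" "\<And>m x. m \<noteq> n \<Longrightarrow> x \<in> G m \<Longrightarrow> a x = 0"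
    using assms by (auto simp: dual_piece_def)
  let ?I = "insert n {n. component G x n \<noteq> 0}"
  have "a x = a (\<Sum>m\<in>?I. component G x m)" by (subst component_sum) (auto simp: finite_component)
  also have "\<dots> = (\<Sum>m\<in>?I. if m = n then a (component G x n) else 0)"
    unfolding functional_sum[OF a(1)] by (intro sum.cong) (auto simp: a(2)[OF _ component_in])
  also have "\<dots> = a (component G x n)" by (subst sum.delta) (auto simp: finite_component)
  finally show ?thesis ..
qed

lemma dual_piece_linear: "a \<in> dual_piece s G n \<Longrightarrow> Vector_Spaces.linear s (*) a"
  and dual_piece_eq_0: "\<lbrakk>a \<in> dual_piece s G n; x \<in> G m; m \<noteq> n\<rbrakk> \<Longrightarrow> a x = 0"
  by (auto simp: dual_piece_def)

lemma dual_pieceI: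
  "\<lbrakk>Vector_Spaces.linear s (*) a; \<And>m x. \<lbrakk>m \<noteq> n; x \<in> G m\<rbrakk> \<Longrightarrow> a x = 0\<rbrakk> \<Longrightarrow> a \<in> dual_piece s G n"
  by (auto simp: dual_piece_def)

lemma dual_piece_eqI:
  assumes "a \<in> dual_piece s G n" "b \<in> dual_piece s G n" "\<And>x. x \<in> G n \<Longrightarrow> a x = b x"
  shows "a = b"
  using functional_component[OF assms(1)] functional_component[OF assms(2)] assms(3)[OF component_in]
  by (intro ext) metis

lemma subspace_dual_piece: "fun_space.subspace (dual_piece s G n)"
  by (auto simp: fun_space.subspace_def dual_piece_def linear_functional_iff fun_scale_apply algebra_simps)

lemma component_dual_piece:
  assumes "Vector_Spaces.linear s (*) a"
  shows "(\<lambda>x. a (component G x n)) \<in> dual_piece s G n"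
  by (rule dual_pieceI)
    (use assms functional_zero[OF assms] in
      \<open>auto simp: linear_functional_iff component_add component_scale component_homogeneous\<close>)

lemma dual_piece_separates:
  assumes "x \<in> G n" "\<And>a. a \<in> dual_piece s G n \<Longrightarrow> a x = 0"
  shows "x = 0"
proof (rule ccontr)
  assume "x \<noteq> 0"
  then obtain a where a: "Vector_Spaces.linear s (*) a" "a x \<noteq> 0"
    using functional_separates[OF vector_space_axioms] by blast
  from assms(2)[OF component_dual_piece[OF a(1)]] show False
    using a(2) assms(1) component_homogeneous[OF assms(1)] by simp
qed

lemma dual_basis_exists:
  assumes B: "B \<subseteq> G n" "independent B"
  shows "\<exists>d. \<forall>b\<in>B. d b \<in> dual_piece s G n \<and> (\<forall>b'\<in>B. d b b' = (if b' = b then 1 else 0))"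
proof -
  interpret v: vector_space_pair s "(*) :: 'k \<Rightarrow> 'k \<Rightarrow> 'k"
    using vector_space_axioms vector_space_mult by (simp add: vector_space_pair_def)
  have "\<exists>f. f \<in> dual_piece s G n \<and> (\<forall>b'\<in>B. f b' = (if b' = b then 1 else 0))" for b
  proof -
    obtain f where f: "Vector_Spaces.linear s (*) f" "\<forall>b'\<in>B. f b' = (if b' = b then 1 else 0)"
      using v.linear_independent_extend[OF B(2), of "\<lambda>b'. if b' = b then 1 else 0"] by auto
    then show ?thesis
      using component_dual_piece[OF f(1), of n] B(1)
      by (intro exI[of _ "\<lambda>x. f (component G x n)"]) (auto simp: component_homogeneous subset_iff)
  qed
  then show ?thesis by metis
qed

lemma finite_basis_exists:
  assumes S: "S \<subseteq> G n" "subspace S"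
  shows "\<exists>B. finite B \<and> B \<subseteq> S \<and> independent B \<and> span B = S"
proof -
  obtain B where B: "B \<subseteq> S" "independent B" "S \<subseteq> span B" "card B = dim S"
    using basis_exists by blast
  obtain B' where B': "finite B'" "span B' = G n" using finite_type by metis
  have "B \<subseteq> span B'" using B(1) S(1) B'(2) by simp
  then have "finite B" using independent_span_bound[OF B'(1) B(2)] by simp
  moreover have "span B = S" using span_minimal[OF B(1) S(2)] B(3) by (rule equalityI)
  ultimately show ?thesis using B(1,2) by (intro exI[of _ B]) simp
qed

text \<open>Finite type gives a finite basis \<open>B\<close> of \<open>G n\<close> with dual
  functionals \<open>d b\<close>, and \<open>h\<close> is the sum of the multiples
  \<open>\<phi> (d b)\<close> of \<open>b\<close>. Linearity of \<open>\<phi>\<close> is asked on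
  the dual piece only, since \<open>verschiebung_ex1\<close> establishes it only there for the
  \<open>p\<close>-th root of the Frobenius.\<close>

lemma dual_piece_reflexive:
  assumes add: "\<And>a b. \<lbrakk>a \<in> dual_piece s G n; b \<in> dual_piece s G n\<rbrakk> \<Longrightarrow> \<phi> (a + b) = \<phi> a + \<phi> b"
    and scale: "\<And>c a. a \<in> dual_piece s G n \<Longrightarrow> \<phi> (fun_scale c a) = c * \<phi> a"
  shows "\<exists>h\<in>G n. \<forall>a\<in>dual_piece s G n. a h = \<phi> a"
proof -
  obtain B where B: "finite B" "B \<subseteq> G n" "independent B" "span B = G n"
    using finite_basis_exists[OF subset_refl subspace_G] by blast
  obtain d where d: "\<And>b. b \<in> B \<Longrightarrow> d b \<in> dual_piece s G n"
    "\<And>b b'. \<lbrakk>b \<in> B; b' \<in> B\<rbrakk> \<Longrightarrow> d b b' = (if b' = b then 1 else 0)"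
    using dual_basis_exists[OF B(2,3)] by blast
  let ?h = "\<Sum>b\<in>B. s (\<phi> (d b)) b"
  note S = subspace_dual_piece[of n]
  have sub: "(\<Sum>b\<in>I. fun_scale (f b) (d b)) \<in> dual_piece s G n" if "I \<subseteq> B" for I f
    by (rule fun_space.subspace_sum[OF S]) (use that d(1) fun_space.subspace_scale[OF S] in blast)
  have \<phi>0: "\<phi> 0 = 0" using scale[OF fun_space.subspace_0[OF S], of 0] by (simp only: fun_space.scale_zero_left mult_zero_left)
  have \<phi>sum: "\<phi> (\<Sum>b\<in>I. fun_scale (f b) (d b)) = (\<Sum>b\<in>I. f b * \<phi> (d b))" if "I \<subseteq> B" for I f
    using finite_subset[OF that B(1)] that
  proof (induction I rule: finite_induct)
    case empty
    show ?case by (simp only: sum.empty \<phi>0)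
  next
    case (insert b I)
    then have "d b \<in> dual_piece s G n" "I \<subseteq> B" using d(1) by auto
    then show ?case
      using insert(3) add[OF fun_space.subspace_scale[OF S \<open>d b \<in> _\<close>] sub[OF \<open>I \<subseteq> B\<close>]]
      by (simp only: sum.insert[OF insert(1,2)] scale)
  qed
  have exp: "a = (\<Sum>b\<in>B. fun_scale (a b) (d b))" if a: "a \<in> dual_piece s G n" for a
  proof (rule dual_piece_eqI[OF a sub[OF subset_refl]])
    fix x assume "x \<in> G n"
    then have "x \<in> span B" using B(4) by simp
    then show "a x = (\<Sum>b\<in>B. fun_scale (a b) (d b)) x"
    proof (induction rule: span_induct_alt)
      case base
      show ?case
        by (simp only: functional_zero[OF dual_piece_linear[OF a]]
            functional_zero[OF dual_piece_linear[OF sub[OF subset_refl]]])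
    next
      case (step c b y)
      have "(\<Sum>b'\<in>B. fun_scale (a b') (d b')) b = (\<Sum>b'\<in>B. if b' = b then a b else 0)"
        unfolding sum_fun_apply by (rule sum.cong) (use step(1) d(2) in \<open>auto simp: fun_scale_apply\<close>)
      then have "(\<Sum>b'\<in>B. fun_scale (a b') (d b')) b = a b" using step(1) B(1) by simp
      then show ?case
        by (simp only: step functional_add[OF dual_piece_linear[OF a]] functional_scale[OF dual_piece_linear[OF a]]
            functional_add[OF dual_piece_linear[OF sub[OF subset_refl]]]
            functional_scale[OF dual_piece_linear[OF sub[OF subset_refl]]])
    qed
  qed
  have "a ?h = \<phi> a" if a: "a \<in> dual_piece s G n" for a
  proof -
    have "\<phi> a = (\<Sum>b\<in>B. a b * \<phi> (d b))" using exp[OF a] \<phi>sum[OF subset_refl] by metis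
    also have "\<dots> = a ?h"
      unfolding functional_sum[OF dual_piece_linear[OF a]] functional_scale[OF dual_piece_linear[OF a]]
      by (simp add: mult.commute)
    finally show ?thesis ..
  qed
  moreover have "?h \<in> G n"
    by (rule subspace_sum[OF subspace_G]) (use B(2) subspace_scale[OF subspace_G] in blast)
  ultimately show ?thesis by blast
qed

text \<open>A double annihilator argument: a linear form on functionals that kills \<open>F\<close>
  but not \<open>z\<close> would, by reflexivity, be evaluation at some \<open>h\<close>, against
  the hypothesis.\<close>

lemma in_span_functionals:
  assumes F: "F \<subseteq> dual_piece s G n" and z: "z \<in> dual_piece s G n"
    and ker: "\<And>h. \<lbrakk>h \<in> G n; \<And>f. f \<in> F \<Longrightarrow> f h = 0\<rbrakk> \<Longrightarrow> z h = 0"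
  shows "z \<in> fun_space.span F"
proof (rule ccontr)
  assume "z \<notin> fun_space.span F"
  then obtain \<phi> where \<phi>: "Vector_Spaces.linear fun_scale (*) \<phi>" "\<phi> z \<noteq> 0" "\<forall>f\<in>F. \<phi> f = 0"
    using separating_functional[OF vector_space_fun_scale] by blast
  obtain h where h: "h \<in> G n" "\<forall>a\<in>dual_piece s G n. a h = \<phi> a"
    using dual_piece_reflexive[of n \<phi>] \<phi>(1)
    by (auto simp: linear_iff_raw vector_space_fun_scale vector_space_mult)
  have "f h = 0" if "f \<in> F" for f using that F h(2) \<phi>(3) by (metis in_mono)
  then have "z h = 0" by (rule ker[OF h(1)])
  with \<phi>(2) h(2) z show False by auto
qed

text \<open>The sums in \<open>koszul\<close> run over exact supports, which change under addition.
  Larger finite index sets add only zero terms, so the values at \<open>x\<close>, \<open>x'\<close>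
  and \<open>x + x'\<close> can be compared over a common set.\<close>

lemma koszul_finite:
  assumes V: "vector_space s3" and F: "bilinear_map s s s3 F"
    and IJ: "finite I" "\<And>n. component G x n \<noteq> 0 \<Longrightarrow> n \<in> I" "finite J" "\<And>n. component G y n \<noteq> 0 \<Longrightarrow> n \<in> J"
  shows "koszul G F x y = (\<Sum>i\<in>I. \<Sum>j\<in>J. if even (i * j) then F (component G x i) (component G y j)
    else - F (component G x i) (component G y j))"
proof -
  interpret V: vector_space s3 by (rule V)
  have F0: "F 0 y = 0" "F x 0 = 0" for x y
  proof -
    have 1: "F (s 0 0) y = s3 0 (F 0 y)" "F x (s 0 0) = s3 0 (F x 0)"
      using F unfolding bilinear_map_iff[OF vector_space_axioms vector_space_axioms V] by blast+
    then show "F 0 y = 0" "F x 0 = 0" by simp_all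
  qed
  define K where "K i j = (if even (i * j) then F (component G x i) (component G y j)
    else - F (component G x i) (component G y j))" for i j
  have K0: "component G x i = 0 \<Longrightarrow> K i j = 0" "component G y j = 0 \<Longrightarrow> K i j = 0" for i j
    by (simp_all add: K_def F0)
  have "(\<Sum>j | component G y j \<noteq> 0. K i j) = (\<Sum>j\<in>J. K i j)" for i
    by (rule sum.mono_neutral_left[OF IJ(3)]) (use IJ(4) K0 in auto)
  moreover have "(\<Sum>i | component G x i \<noteq> 0. \<Sum>j\<in>J. K i j) = (\<Sum>i\<in>I. \<Sum>j\<in>J. K i j)"
    by (rule sum.mono_neutral_left[OF IJ(1)]) (use IJ(2) K0 in auto)
  ultimately show ?thesis unfolding koszul_def K_def[symmetric] by simp
qed

lemma koszul_bilinear: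
  assumes V: "vector_space s3" and F: "bilinear_map s s s3 F"
  shows "bilinear_map s s s3 (koszul G F)"
proof -
  interpret V: vector_space s3 by (rule V)
  note iff = bilinear_map_iff[OF vector_space_axioms vector_space_axioms V]
  have F': "F (x + x') y = F x y + F x' y" "F (s c x) y = s3 c (F x y)"
    "F x (y + y') = F x y + F x y'" "F x (s c y) = s3 c (F x y)" for c x x' y y'
    using F unfolding iff by blast+
  note K = koszul_finite[OF V F]
  let ?supp = "\<lambda>x. {n. component G x n \<noteq> 0}"
  have fin: "finite (?supp x)" for x by (rule finite_component)
  have "koszul G F (x + x') y = koszul G F x y + koszul G F x' y" for x x' y
    by (subst (1 2 3) K[of "?supp x \<union> ?supp x'" _ "?supp y"])
      (auto simp: fin component_add F' sum.distrib[symmetric] intro!: sum.cong)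
  moreover have "koszul G F y (x + x') = koszul G F y x + koszul G F y x'" for x x' y
    by (subst (1 2 3) K[of "?supp y" _ "?supp x \<union> ?supp x'"])
      (auto simp: fin component_add F' sum.distrib[symmetric] intro!: sum.cong)
  moreover have "koszul G F (s c x) y = s3 c (koszul G F x y)" for c x y
    by (subst (1 2) K[of "?supp x" _ "?supp y"])
      (auto simp: fin component_scale F' V.scale_sum_right intro!: sum.cong)
  moreover have "koszul G F x (s c y) = s3 c (koszul G F x y)" for c x y
    by (subst (1 2) K[of "?supp x" _ "?supp y"])
      (auto simp: fin component_scale F' V.scale_sum_right intro!: sum.cong)
  ultimately show ?thesis unfolding iff by blast
qed

lemma functional_koszul:
  assumes "vector_space s3" "Vector_Spaces.linear s3 (*) \<phi>"
  shows "\<phi> (koszul G F x y) = koszul G (\<lambda>a b. \<phi> (F a b)) x y"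
proof -
  interpret \<phi>: Vector_Spaces.linear s3 "(*)" \<phi> by fact
  show ?thesis unfolding koszul_def by (auto simp: \<phi>.sum \<phi>.neg intro!: sum.cong)
qed

lemma koszul_homogeneous:
  assumes V: "vector_space s3" and F: "bilinear_map s s s3 F" and "x \<in> G i" "y \<in> G j"
  shows "koszul G F x y = (if even (i * j) then F x y else - F x y)"
  by (subst koszul_finite[OF V F, of "{i}" _ "{j}"])
    (auto simp: component_homogeneous[OF assms(3)] component_homogeneous[OF assms(4)] split: if_splits)

lemma koszul_unit_left:
  assumes V: "vector_space s3" and F: "bilinear_map s s s3 F" and "x \<in> G 0"
  shows "koszul G F x y = F x y"
proof (induction y rule: graded_induct)
  case (homogeneous y n)
  then show ?case using koszul_homogeneous[OF V F assms(3)] by simp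
next
  case (add y y')
  then show ?case
    using koszul_bilinear[OF V F] F
    by (simp add: bilinear_map_iff[OF vector_space_axioms vector_space_axioms V])
qed

text \<open>Only the component of \<open>y\<close> in degree \<open>j\<close> survives
  \<open>g\<close>, so the sign is constant although \<open>y\<close> is arbitrary. Homogeneity is
  asked of \<open>x\<close> and not of \<open>f\<close>, to cover the functional
  \<open>\<lambda>b'. b (b' * v)\<close> in \<open>primitive_derivation\<close>.\<close>

lemma koszul_dual_right:
  assumes f: "Vector_Spaces.linear s (*) f" and g: "g \<in> dual_piece s G j" and x: "x \<in> G i"
  shows "koszul G (\<lambda>a b. f a * g b) x y = (- 1) ^ (i * j) * (f x * g y)"
proof -
  note bil = bilinear_rank_one[OF vector_space_axioms vector_space_axioms f dual_piece_linear[OF g]]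
  show ?thesis
  proof (induction y rule: graded_induct)
    case (homogeneous y n)
    then show ?case
      using koszul_homogeneous[OF vector_space_mult bil x homogeneous] dual_piece_eq_0[OF g homogeneous]
      by (cases "n = j") auto
  next
    case (add y y')
    then show ?case
      using koszul_bilinear[OF vector_space_mult bil] functional_add[OF dual_piece_linear[OF g]]
      by (simp add: bilinear_map_iff[OF vector_space_axioms vector_space_axioms vector_space_mult] algebra_simps)
  qed
qed

lemma koszul_dual:
  assumes f: "f \<in> dual_piece s G i" and g: "g \<in> dual_piece s G j"
  shows "koszul G (\<lambda>a b. f a * g b) x y = (- 1) ^ (i * j) * (f x * g y)"
proof -
  note bil = bilinear_rank_one[OF vector_space_axioms vector_space_axioms dual_piece_linear[OF f] dual_piece_linear[OF g]]
  show ?thesis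
  proof (induction x rule: graded_induct)
    case (homogeneous x n)
    then show ?case
      using koszul_dual_right[OF dual_piece_linear[OF f] g homogeneous] dual_piece_eq_0[OF f homogeneous]
      by (cases "n = i") auto
  next
    case (add x x')
    then show ?case
      using koszul_bilinear[OF vector_space_mult bil] functional_add[OF dual_piece_linear[OF f]]
      by (simp add: bilinear_map_iff[OF vector_space_axioms vector_space_axioms vector_space_mult] algebra_simps)
  qed
qed

lemma tensor_piece_subset: "tensor_piece s G n \<subseteq> tensor_product s s"
  unfolding tensor_piece_def tensor_product_def by (rule fun_space.span_mono) auto

lemma tensor_piece_bidegree:
  assumes "t \<in> tensor_piece s G n" "bilinear_map s s (*) \<beta>" "i + j \<noteq> n"
  shows "t (\<lambda>u v. \<beta> (component G u i) (component G v j)) = 0"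
proof -
  have b: "bilinear_map s s (*) (\<lambda>u v. \<beta> (component G u i) (component G v j))"
    using assms(2) by (simp add: bilinear_map_iff[OF vector_space_axioms vector_space_axioms vector_space_mult]
        component_add component_scale)
  have \<beta>0: "\<beta> 0 y = 0" "\<beta> x 0 = 0" for x y
  proof -
    have 1: "\<beta> (s 0 0) y = 0 * (\<beta> 0 y)" "\<beta> x (s 0 0) = 0 * (\<beta> x 0)"
      using assms(2) unfolding bilinear_map_iff[OF vector_space_axioms vector_space_axioms vector_space_mult]
      by blast+
    then show "\<beta> 0 y = 0" "\<beta> x 0 = 0" by simp_all
  qed
  show ?thesis using assms(1) unfolding tensor_piece_def
  proof (induction rule: fun_space.span_induct_alt)
    case (step c t u)
    then obtain a b i' j' where "t = pure_tensor s s a b" "a \<in> G i'" "b \<in> G j'" "i' + j' = n" by auto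
    with step(2) assms(3) \<beta>0 b show ?case
      by (auto simp: fun_scale_apply pure_tensor_apply component_homogeneous)
  qed simp
qed

end

section \<open>Lifts as functions of the bilinear map\<close>

context
  fixes s1 :: "'k::field \<Rightarrow> 'a::ab_group_add \<Rightarrow> 'a" and s2 :: "'k \<Rightarrow> 'b::ab_group_add \<Rightarrow> 'b"
  assumes V1: "vector_space s1" and V2: "vector_space s2"
begin

lemma bilinear_apply:
  assumes "bilinear_map s1 s2 fun_scale f"
  shows "bilinear_map s1 s2 (*) (\<lambda>a b. f a b \<gamma>)"
  using assms by (simp add: bilinear_map_iff V1 V2 vector_space_fun_scale vector_space_mult fun_scale_apply)

lemma bilinear_plus:
  assumes "bilinear_map s1 s2 fun_scale f" "bilinear_map s1 s2 fun_scale g"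
  shows "bilinear_map s1 s2 fun_scale (\<lambda>a b. f a b + g a b)"
  using assms
  by (simp add: bilinear_map_iff V1 V2 vector_space_fun_scale fun_space.scale_right_distrib algebra_simps)

lemma bilinear_fun_scale:
  assumes "bilinear_map s1 s2 fun_scale f"
  shows "bilinear_map s1 s2 fun_scale (\<lambda>a b. fun_scale c (f a b))"
  using assms
  by (simp add: bilinear_map_iff V1 V2 vector_space_fun_scale fun_space.scale_right_distrib mult.commute)

text \<open>The lifts of \<open>f\<close>, \<open>g\<close> and their sum are chosen independently
  of each other, so they are comparable only on \<open>tensor_product\<close>, where each is given
  by evaluating \<open>t\<close> at bilinear forms.\<close>

lemma tensor_lift_fun_add:
  assumes f: "bilinear_map s1 s2 fun_scale f" and g: "bilinear_map s1 s2 fun_scale g"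
    and t: "t \<in> tensor_product s1 s2"
  shows "tensor_lift s1 s2 fun_scale (\<lambda>a b. f a b + g a b) t
    = tensor_lift s1 s2 fun_scale f t + tensor_lift s1 s2 fun_scale g t"
proof
  fix \<gamma>
  show "tensor_lift s1 s2 fun_scale (\<lambda>a b. f a b + g a b) t \<gamma>
    = (tensor_lift s1 s2 fun_scale f t + tensor_lift s1 s2 fun_scale g t) \<gamma>"
    unfolding plus_fun_apply tensor_lift_apply[OF V1 V2 f t] tensor_lift_apply[OF V1 V2 g t]
      tensor_lift_apply[OF V1 V2 bilinear_plus[OF f g] t]
    by (rule tensor_apply_add[OF V1 V2 t bilinear_apply[OF f] bilinear_apply[OF g]])
qed

lemma tensor_lift_fun_scale:
  assumes f: "bilinear_map s1 s2 fun_scale f" and t: "t \<in> tensor_product s1 s2"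
  shows "tensor_lift s1 s2 fun_scale (\<lambda>a b. fun_scale c (f a b)) t
    = fun_scale c (tensor_lift s1 s2 fun_scale f t)"
proof
  fix \<gamma>
  show "tensor_lift s1 s2 fun_scale (\<lambda>a b. fun_scale c (f a b)) t \<gamma>
    = fun_scale c (tensor_lift s1 s2 fun_scale f t) \<gamma>"
    unfolding fun_scale_apply tensor_lift_apply[OF V1 V2 f t]
      tensor_lift_apply[OF V1 V2 bilinear_fun_scale[OF f] t]
    by (rule tensor_apply_scale[OF V1 V2 t bilinear_apply[OF f]])
qed

end

lemma koszul_fun_add: "koszul G (\<lambda>x y. f x y + g x y) x y = koszul G f x y + koszul G g x y"
  unfolding koszul_def sum.distrib[symmetric] by (intro sum.cong) auto

lemma koszul_fun_scale:
  "koszul G (\<lambda>x y. fun_scale c (f x y)) x y = fun_scale c (koszul G f x y)"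
  unfolding koszul_def fun_space.scale_sum_right
  by (intro sum.cong refl) (simp only: if_distrib[of "fun_scale c"] fun_space.scale_minus_right)

section \<open>The dual algebra\<close>

context connected_cocommutative_hopf_algebra
begin

abbreviation conv :: "('h \<Rightarrow> 'k) \<Rightarrow> ('h \<Rightarrow> 'k) \<Rightarrow> 'h \<Rightarrow> 'k" (infixl "\<star>" 70) where
  "a \<star> b \<equiv> dual_mult s \<Delta> a b"

abbreviation dual :: "nat \<Rightarrow> ('h \<Rightarrow> 'k) set" where
  "dual \<equiv> dual_piece s G"

lemmas Vs = vector_space_axioms

lemma comult_add: "\<Delta> (x + y) = \<Delta> x + \<Delta> y"
  and comult_scale: "\<Delta> (s c x) = fun_scale c (\<Delta> x)"
  using comult_linear by (auto simp: linear_iff_raw Vs vector_space_fun_scale)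

lemma comult_in: "\<Delta> x \<in> tensor_product s s"
proof (induction x rule: graded_induct)
  case (homogeneous x n)
  then show ?case using comult_graded tensor_piece_subset by (metis subsetD)
next
  case (add x y)
  then show ?case unfolding comult_add tensor_product_def by (rule fun_space.span_add)
qed

lemma conv_apply:
  "\<lbrakk>Vector_Spaces.linear s (*) a; Vector_Spaces.linear s (*) b\<rbrakk> \<Longrightarrow> (a \<star> b) x = \<Delta> x (\<lambda>u v. a u * b v)"
  unfolding dual_mult_def by (rule tensor_lift_mult[OF Vs Vs bilinear_rank_one[OF Vs Vs] comult_in])

lemma conv_linear:
  "\<lbrakk>Vector_Spaces.linear s (*) a; Vector_Spaces.linear s (*) b\<rbrakk> \<Longrightarrow> Vector_Spaces.linear s (*) (a \<star> b)"
  unfolding linear_functional_iff[of "a \<star> b"]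
  by (simp only: conv_apply comult_add comult_scale plus_fun_apply fun_scale_apply simp_thms)

text \<open>\<open>a\<close> and \<open>b\<close> see only the part of bidegree
  \<open>(i, j)\<close>, and the comultiplication preserves the total degree.\<close>

lemma conv_closed:
  assumes a: "a \<in> dual i" and b: "b \<in> dual j"
  shows "a \<star> b \<in> dual (i + j)"
proof (rule dual_pieceI)
  note lin = dual_piece_linear[OF a] dual_piece_linear[OF b]
  show "Vector_Spaces.linear s (*) (a \<star> b)" by (rule conv_linear[OF lin])
  fix m x assume "m \<noteq> i + j" "x \<in> G m"
  then have "\<Delta> x (\<lambda>u v. a (component G u i) * b (component G v j)) = 0"
    by (intro tensor_piece_bidegree[OF comult_graded bilinear_rank_one[OF Vs Vs lin]]) auto
  then show "(a \<star> b) x = 0"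
    by (simp only: conv_apply[OF lin] functional_component[OF a] functional_component[OF b])
qed

lemma functional_plus:
  "\<lbrakk>Vector_Spaces.linear s (*) a; Vector_Spaces.linear s (*) b\<rbrakk> \<Longrightarrow> Vector_Spaces.linear s (*) (a + b)"
  "Vector_Spaces.linear s (*) a \<Longrightarrow> Vector_Spaces.linear s (*) (fun_scale c a)"
  by (simp_all add: linear_functional_iff fun_scale_apply algebra_simps)

lemma conv_bilinear:
  assumes a: "Vector_Spaces.linear s (*) a" and a': "Vector_Spaces.linear s (*) a'"
    and b: "Vector_Spaces.linear s (*) b"
  shows "(a + a') \<star> b = a \<star> b + a' \<star> b" "b \<star> (a + a') = b \<star> a + b \<star> a'"
    "(fun_scale c a) \<star> b = fun_scale c (a \<star> b)" "b \<star> (fun_scale c a) = fun_scale c (b \<star> a)"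
proof -
  note bil = bilinear_rank_one[OF Vs Vs]
  show "(a + a') \<star> b = a \<star> b + a' \<star> b"
  proof
    fix x
    have "\<Delta> x (\<lambda>u v. a u * b v + a' u * b v) = \<Delta> x (\<lambda>u v. a u * b v) + \<Delta> x (\<lambda>u v. a' u * b v)"
      by (rule tensor_apply_add[OF Vs Vs comult_in bil[OF a b] bil[OF a' b]])
    then show "((a + a') \<star> b) x = (a \<star> b + a' \<star> b) x"
      by (simp only: plus_fun_apply conv_apply[OF functional_plus(1)[OF a a'] b] conv_apply[OF a b]
          conv_apply[OF a' b] distrib_right)
  qed
  show "b \<star> (a + a') = b \<star> a + b \<star> a'"
  proof
    fix x
    have "\<Delta> x (\<lambda>u v. b u * a v + b u * a' v) = \<Delta> x (\<lambda>u v. b u * a v) + \<Delta> x (\<lambda>u v. b u * a' v)"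
      by (rule tensor_apply_add[OF Vs Vs comult_in bil[OF b a] bil[OF b a']])
    then show "(b \<star> (a + a')) x = (b \<star> a + b \<star> a') x"
      by (simp only: plus_fun_apply conv_apply[OF b functional_plus(1)[OF a a']] conv_apply[OF b a]
          conv_apply[OF b a'] distrib_left)
  qed
  show "(fun_scale c a) \<star> b = fun_scale c (a \<star> b)"
  proof
    fix x
    have "\<Delta> x (\<lambda>u v. c * (a u * b v)) = c * \<Delta> x (\<lambda>u v. a u * b v)"
      by (rule tensor_apply_scale[OF Vs Vs comult_in bil[OF a b]])
    then show "(fun_scale c a \<star> b) x = fun_scale c (a \<star> b) x"
      by (simp only: fun_scale_apply conv_apply[OF functional_plus(2)[OF a] b] conv_apply[OF a b] mult.assoc)
  qed
  show "b \<star> (fun_scale c a) = fun_scale c (b \<star> a)"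
  proof
    fix x
    have "\<Delta> x (\<lambda>u v. c * (b u * a v)) = c * \<Delta> x (\<lambda>u v. b u * a v)"
      by (rule tensor_apply_scale[OF Vs Vs comult_in bil[OF b a]])
    then show "(b \<star> fun_scale c a) x = fun_scale c (b \<star> a) x"
      by (simp only: fun_scale_apply conv_apply[OF b functional_plus(2)[OF a]] conv_apply[OF b a]
          mult.left_commute)
  qed
qed

lemma counit_conv:
  assumes a: "Vector_Spaces.linear s (*) a"
  shows "\<epsilon> \<star> a = a" "a \<star> \<epsilon> = a"
proof -
  note \<epsilon> = counit_linear
  have 1: "bilinear_map s s s (\<lambda>u v. s (\<epsilon> u) v)" "bilinear_map s s s (\<lambda>u v. s (\<epsilon> v) u)"
    by (simp_all add: bilinear_map_iff[OF Vs Vs Vs] functional_add[OF \<epsilon>] functional_scale[OF \<epsilon>]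
        scale_left_distrib scale_right_distrib mult.commute)
  show "\<epsilon> \<star> a = a"
  proof
    fix x
    show "(\<epsilon> \<star> a) x = a x"
      using functional_tensor_lift[OF Vs Vs Vs 1(1) a comult_in[of x]]
      by (simp only: counit_left conv_apply[OF \<epsilon> a] functional_scale[OF a])
  qed
  show "a \<star> \<epsilon> = a"
  proof
    fix x
    show "(a \<star> \<epsilon>) x = a x"
      using functional_tensor_lift[OF Vs Vs Vs 1(2) a comult_in[of x]]
      by (simp only: counit_right conv_apply[OF a \<epsilon>] functional_scale[OF a] mult.commute)
  qed
qed

text \<open>Both products are values of the two sides of \<open>coassoc\<close> at one and the same
  form \<open>\<gamma>\<close>.\<close>

lemma conv_assoc:
  assumes a: "Vector_Spaces.linear s (*) a" and b: "Vector_Spaces.linear s (*) b"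
    and c: "Vector_Spaces.linear s (*) c"
  shows "(a \<star> b) \<star> c = a \<star> (b \<star> c)"
proof
  fix x
  note VF = vector_space_fun_scale
  \<comment> \<open>The trilinear form built from \<open>a\<close>, \<open>b\<close> and
    \<open>c\<close>, regarded as a bilinear form in an element and a tensor, because both sides of
    \<open>coassoc\<close> live in \<open>H \<otimes> (H \<otimes> H)\<close>.\<close>
  define \<gamma> :: "'h \<Rightarrow> ('k, 'h, 'h) tensor \<Rightarrow> 'k" where
    "\<gamma> = (\<lambda>u w. a u * w (\<lambda>v v'. b v * c v'))"
  have \<gamma>: "bilinear_map s fun_scale (*) \<gamma>"
    using a by (simp add: \<gamma>_def bilinear_map_iff[OF Vs VF vector_space_mult] linear_functional_iff
        fun_scale_apply algebra_simps)
  define P where "P = pure_tensor s (fun_scale :: 'k \<Rightarrow> ('k, 'h, 'h) tensor \<Rightarrow> _)"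
  define Q where "Q = pure_tensor s s"
  have P: "bilinear_map s fun_scale fun_scale P" unfolding P_def by (rule pure_tensor_bilinear[OF Vs VF])
  have Q: "bilinear_map s s fun_scale Q" unfolding Q_def by (rule pure_tensor_bilinear[OF Vs Vs])
  note P' = P[unfolded bilinear_map_iff[OF Vs VF VF]] and Q' = Q[unfolded bilinear_map_iff[OF Vs Vs VF]]
  have bc: "bilinear_map s s (*) (\<lambda>v v'. b v * c v')" by (rule bilinear_rank_one[OF Vs Vs b c])
  have \<gamma>P: "P u w \<gamma> = \<gamma> u w" for u w unfolding P_def by (rule pure_tensor_apply[OF \<gamma>])
  have g: "bilinear_map s s fun_scale (\<lambda>u v. P u (Q v b'))" for b'
    using P' Q' by (simp add: bilinear_map_iff[OF Vs Vs VF])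
  \<comment> \<open>The inner lift on the left side of \<open>coassoc\<close>. The outer lift can be
    evaluated only once \<open>f\<close> is known to be bilinear.\<close>
  define f where "f a' b' = tensor_lift s s fun_scale (\<lambda>u v. P u (Q v b')) (\<Delta> a')" for a' b'
  interpret L: Vector_Spaces.linear fun_scale fun_scale "tensor_lift s s fun_scale (\<lambda>u v. P u (Q v b'))" for b'
    by (rule tensor_lift_linear[OF Vs Vs VF g])
  have f: "bilinear_map s s fun_scale f"
    unfolding bilinear_map_iff[OF Vs Vs VF]
  proof (intro conjI allI)
    show "f (x + x') y = f x y + f x' y" for x x' y
      unfolding f_def comult_add L.add ..
    show "f (s k x) y = fun_scale k (f x y)" for k x y
      unfolding f_def comult_scale L.scale ..
    show "f x (y + y') = f x y + f x y'" for x y y'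
    proof -
      have "P u (Q v (y + y')) = P u (Q v y) + P u (Q v y')" for u v using P' Q' by simp
      then show ?thesis unfolding f_def using tensor_lift_fun_add[OF Vs Vs g g comult_in] by simp
    qed
    show "f x (s k y) = fun_scale k (f x y)" for k x y
    proof -
      have "P u (Q v (s k y)) = fun_scale k (P u (Q v y))" for u v using P' Q' by simp
      then show ?thesis unfolding f_def using tensor_lift_fun_scale[OF Vs Vs g comult_in] by simp
    qed
  qed
  have f': "bilinear_map s s fun_scale (\<lambda>a' b'. P a' (\<Delta> b'))"
    using P' by (simp add: bilinear_map_iff[OF Vs Vs VF] comult_add comult_scale)
  have eq: "tensor_lift s s fun_scale f (\<Delta> x) \<gamma> = tensor_lift s s fun_scale (\<lambda>a' b'. P a' (\<Delta> b')) (\<Delta> x) \<gamma>"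
    unfolding f_def P_def Q_def coassoc ..
  have f\<gamma>: "f a' b' \<gamma> = (a \<star> b) a' * c b'" for a' b'
  proof -
    have "f a' b' \<gamma> = \<Delta> a' (\<lambda>u v. P u (Q v b') \<gamma>)"
      unfolding f_def by (rule tensor_lift_apply[OF Vs Vs g comult_in])
    also have "(\<lambda>u v. P u (Q v b') \<gamma>) = (\<lambda>u v. c b' * (a u * b v))"
      unfolding \<gamma>P by (simp add: \<gamma>_def Q_def pure_tensor_apply[OF bc] mult.commute mult.left_commute)
    also have "\<Delta> a' \<dots> = c b' * \<Delta> a' (\<lambda>u v. a u * b v)"
      by (rule tensor_apply_scale[OF Vs Vs comult_in bilinear_rank_one[OF Vs Vs a b]])
    finally show ?thesis by (simp only: conv_apply[OF a b] mult.commute)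
  qed
  have "((a \<star> b) \<star> c) x = \<Delta> x (\<lambda>a' b'. f a' b' \<gamma>)"
    unfolding conv_apply[OF conv_linear[OF a b] c] f\<gamma> ..
  also have "\<dots> = tensor_lift s s fun_scale f (\<Delta> x) \<gamma>"
    by (rule tensor_lift_apply[OF Vs Vs f comult_in, symmetric])
  also have "\<dots> = \<Delta> x (\<lambda>a' b'. P a' (\<Delta> b') \<gamma>)"
    unfolding eq by (rule tensor_lift_apply[OF Vs Vs f' comult_in])
  also have "\<dots> = (a \<star> (b \<star> c)) x"
    unfolding conv_apply[OF a conv_linear[OF b c]] \<gamma>P unfolding \<gamma>_def conv_apply[OF b c] ..
  finally show "((a \<star> b) \<star> c) x = (a \<star> (b \<star> c)) x" .
qed

text \<open>Evaluate cocommutativity at \<open>a u * b v\<close>: since \<open>a\<close> and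
  \<open>b\<close> are homogeneous, the Koszul sign of the braiding becomes a constant.\<close>

lemma conv_commute:
  assumes a: "a \<in> dual i" and b: "b \<in> dual j"
  shows "a \<star> b = fun_scale ((- 1) ^ (i * j)) (b \<star> a)"
proof
  fix x
  note lin = dual_piece_linear[OF a] dual_piece_linear[OF b]
  note VF = vector_space_fun_scale
  let ?Q = "\<lambda>u v. pure_tensor s s v u" and ?\<beta> = "\<lambda>u v. a u * b v"
  have \<beta>: "bilinear_map s s (*) ?\<beta>" by (rule bilinear_rank_one[OF Vs Vs lin])
  have Q: "bilinear_map s s fun_scale ?Q"
    using pure_tensor_bilinear[OF Vs Vs] by (simp add: bilinear_map_iff[OF Vs Vs VF])
  have ev: "Vector_Spaces.linear fun_scale (*) (\<lambda>t. t ?\<beta>)"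
    by (simp add: linear_iff_raw VF vector_space_mult fun_scale_apply)
  have "(a \<star> b) x = \<Delta> x ?\<beta>" by (rule conv_apply[OF lin])
  also have "\<dots> = braiding s G (\<Delta> x) ?\<beta>" by (simp only: cocommutative)
  also have "\<dots> = \<Delta> x (\<lambda>u v. koszul G ?Q u v ?\<beta>)"
    unfolding braiding_def by (rule tensor_lift_apply[OF Vs Vs koszul_bilinear[OF VF Q] comult_in])
  also have "(\<lambda>u v. koszul G ?Q u v ?\<beta>) = (\<lambda>u v. koszul G (\<lambda>u v. b u * a v) u v)"
    by (simp only: functional_koszul[OF VF ev] pure_tensor_apply[OF \<beta>] mult.commute)
  also have "\<dots> = (\<lambda>u v. (- 1) ^ (i * j) * (b u * a v))"
    by (intro ext) (simp only: koszul_dual[OF b a] mult.commute[of i j])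
  also have "\<Delta> x \<dots> = (- 1) ^ (i * j) * \<Delta> x (\<lambda>u v. b u * a v)"
    by (rule tensor_apply_scale[OF Vs Vs comult_in bilinear_rank_one[OF Vs Vs lin(2,1)]])
  finally show "(a \<star> b) x = fun_scale ((- 1) ^ (i * j)) (b \<star> a) x"
    by (simp only: fun_scale_apply conv_apply[OF lin(2,1)])
qed

lemma counit_closed: "\<epsilon> \<in> dual 0"
  by (rule dual_pieceI[OF counit_linear]) (use counit_graded in blast)

sublocale dual: graded_commutative_algebra fun_scale dual "dual_mult s \<Delta>" \<epsilon>
proof unfold_locales
  note lin = dual_piece_linear
  show "fun_space.subspace (dual n)" for n by (rule subspace_dual_piece)
  show "x \<star> y \<in> dual (m + n)" if "x \<in> dual m" "y \<in> dual n" for x y m n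
    using that by (rule conv_closed)
  show "(x + x') \<star> y = x \<star> y + x' \<star> y" if "x \<in> dual m" "x' \<in> dual m" "y \<in> dual n" for x x' y m n
    using conv_bilinear(1)[OF lin lin lin] that by blast
  show "x \<star> (y + y') = x \<star> y + x \<star> y'" if "x \<in> dual m" "y \<in> dual n" "y' \<in> dual n" for x y y' m n
    using conv_bilinear(2)[OF lin lin lin] that by blast
  show "fun_scale c x \<star> y = fun_scale c (x \<star> y)" if "x \<in> dual m" "y \<in> dual n" for x y m n c
    using conv_bilinear(3)[OF lin lin lin] that by blast
  show "x \<star> fun_scale c y = fun_scale c (x \<star> y)" if "x \<in> dual m" "y \<in> dual n" for x y m n c
    using conv_bilinear(4)[OF lin lin lin] that by blast
  show "x \<star> y \<star> z = x \<star> (y \<star> z)" if "x \<in> dual l" "y \<in> dual m" "z \<in> dual n" for x y z l m n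
    using conv_assoc[OF lin lin lin] that by blast
  show "\<epsilon> \<in> dual 0" by (rule counit_closed)
  show "\<epsilon> \<star> x = x" "x \<star> \<epsilon> = x" if "x \<in> dual n" for x n
    using counit_conv[OF lin[OF that]] by simp_all
  show "x \<star> y = fun_scale ((- 1) ^ (m * n)) (y \<star> x)" if "x \<in> dual m" "y \<in> dual n" for x y m n
    using that by (rule conv_commute)
qed

lemma dual_power_eq: "dual_power s \<Delta> \<epsilon> n a = dual.pw a n"
  by (induction n) simp_all

section \<open>Left multiplication by a primitive as a derivation of the dual algebra\<close>

lemma one_in: "1 \<in> G 0"
  unfolding connected by (rule range_eqI[of _ _ 1]) simp

text \<open>This evaluates the product of \<open>h \<otimes> 1 + 1 \<otimes> h\<close> with
  \<open>\<Delta> y\<close>. The first summand carries no Koszul sign, because 1 has degree 0; in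
  the second, \<open>h\<close> has to pass the left factor of \<open>\<Delta> y\<close>.\<close>

lemma comult_mult_primitive:
  assumes h: "\<Delta> h = pure_tensor s s h 1 + pure_tensor s s 1 h" and \<beta>: "bilinear_map s s (*) \<beta>"
  shows "\<Delta> (h * y) \<beta> = \<Delta> y (\<lambda>c d. \<beta> (h * c) d) + \<Delta> y (\<lambda>c d. koszul G (\<lambda>b' c'. \<beta> c' (b' * d)) h c)"
proof -
  note VF = vector_space_fun_scale
  note iff = bilinear_map_iff[OF Vs Vs VF]
  define Q where "Q = pure_tensor s s"
  have Q: "bilinear_map s s fun_scale Q" unfolding Q_def by (rule pure_tensor_bilinear[OF Vs Vs])
  note Q' = Q[unfolded iff]
  \<comment> \<open>\<open>F\<close>, \<open>g\<close> and \<open>f\<close> are the three layers of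
    \<open>tensor_mult\<close>: the map of the two middle factors, the map lifted over the right
    tensor and the map lifted over the left one. Each must be shown bilinear before the next can be
    evaluated.\<close>
  define F where "F a d = (\<lambda>b' c'. Q (a * c') (b' * d))" for a d
  have F: "bilinear_map s s fun_scale (F a d)" for a d
    using Q' by (simp add: F_def iff scale_mult_left scale_mult_right distrib_left distrib_right)
  note K = koszul_bilinear[OF VF F, unfolded iff]
  have Fa: "F (a + a') d = (\<lambda>b' c'. F a d b' c' + F a' d b' c')"
    "F (s k a) d = (\<lambda>b' c'. fun_scale k (F a d b' c'))"
    "F a (d + d') = (\<lambda>b' c'. F a d b' c' + F a d' b' c')"
    "F a (s k d) = (\<lambda>b' c'. fun_scale k (F a d b' c'))" for a a' d d' k
    using Q' by (simp_all add: F_def scale_mult_left scale_mult_right distrib_left distrib_right)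
  define g where "g a b = (\<lambda>c d. koszul G (F a d) b c)" for a b
  have g: "bilinear_map s s fun_scale (g a b)" for a b
    using K by (simp add: g_def iff Fa koszul_fun_add koszul_fun_scale)
  have ga: "g (a + a') b = (\<lambda>c d. g a b c d + g a' b c d)"
    "g (s k a) b = (\<lambda>c d. fun_scale k (g a b c d))"
    "g a (b + b') = (\<lambda>c d. g a b c d + g a b' c d)"
    "g a (s k b) = (\<lambda>c d. fun_scale k (g a b c d))" for a a' b b' k
    using K by (simp_all add: g_def Fa koszul_fun_add koszul_fun_scale)
  define f where "f a b = tensor_lift s s fun_scale (g a b) (\<Delta> y)" for a b
  have f: "bilinear_map s s fun_scale f"
    unfolding iff f_def ga
    by (intro conjI allI tensor_lift_fun_add[OF Vs Vs g g comult_in] tensor_lift_fun_scale[OF Vs Vs g comult_in])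
  interpret L: Vector_Spaces.linear fun_scale fun_scale "tensor_lift s s fun_scale f"
    by (rule tensor_lift_linear[OF Vs Vs VF f])
  have "\<Delta> (h * y) = tensor_lift s s fun_scale f (\<Delta> h)"
    unfolding comult_mult tensor_mult_def f_def g_def F_def Q_def ..
  also have "\<dots> = f h 1 + f 1 h"
    unfolding h L.add tensor_lift_pure[OF Vs Vs VF f] ..
  finally have "\<Delta> (h * y) \<beta> = f h 1 \<beta> + f 1 h \<beta>" by simp
  also have "f h 1 \<beta> = \<Delta> y (\<lambda>c d. g h 1 c d \<beta>)"
    unfolding f_def by (rule tensor_lift_apply[OF Vs Vs g comult_in])
  also have "(\<lambda>c d. g h 1 c d \<beta>) = (\<lambda>c d. \<beta> (h * c) d)"
    unfolding g_def koszul_unit_left[OF VF F one_in] unfolding F_def Q_def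
    by (simp only: pure_tensor_apply[OF \<beta>] mult_1_left)
  also have "f 1 h \<beta> = \<Delta> y (\<lambda>c d. g 1 h c d \<beta>)"
    unfolding f_def by (rule tensor_lift_apply[OF Vs Vs g comult_in])
  also have "(\<lambda>c d. g 1 h c d \<beta>) = (\<lambda>c d. koszul G (\<lambda>b' c'. \<beta> c' (b' * d)) h c)"
  proof -
    have ev: "Vector_Spaces.linear fun_scale (*) (\<lambda>t. t \<beta>)"
      by (simp add: linear_iff_raw VF vector_space_mult fun_scale_apply)
    show ?thesis
      unfolding g_def F_def Q_def
      by (simp only: functional_koszul[OF VF ev] pure_tensor_apply[OF \<beta>] mult_1_left)
  qed
  finally show ?thesis .
qed

lemma left_mult_linear: "Vector_Spaces.linear s (*) a \<Longrightarrow> Vector_Spaces.linear s (*) (\<lambda>y. a (h * y))"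
  by (simp add: linear_functional_iff scale_mult_right distrib_left)

text \<open>\<open>a (h * y)\<close> sees only the component of \<open>y\<close> in degree
  \<open>n - d\<close>. For \<open>n < d\<close> there is none; this vanishing makes the truncated
  subtraction harmless and later yields triangularity of the generators.\<close>

lemma left_mult_closed:
  assumes "a \<in> dual n" "h \<in> G d"
  shows "(\<lambda>y. a (h * y)) \<in> dual (n - d)" and "n < d \<Longrightarrow> (\<lambda>y. a (h * y)) = 0"
proof -
  note lin = left_mult_linear[OF dual_piece_linear[OF assms(1)]]
  have 0: "a (h * y) = 0" if "y \<in> G m" "d + m \<noteq> n" for y m
    using dual_piece_eq_0[OF assms(1) graded_mult[OF assms(2) that(1)] that(2)] .
  show D0: "(\<lambda>y. a (h * y)) = 0" if "n < d"
  proof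
    fix y
    show "a (h * y) = 0 y"
    proof (induction y rule: graded_induct)
      case (homogeneous y m)
      then show ?case using 0[OF homogeneous] that by simp
    qed (simp add: distrib_left functional_add[OF dual_piece_linear[OF assms(1)]])
  qed
  show "(\<lambda>y. a (h * y)) \<in> dual (n - d)"
  proof (cases "n < d")
    case True
    show ?thesis unfolding D0[OF True] by (rule fun_space.subspace_0[OF subspace_dual_piece])
  next
    case False
    show ?thesis by (rule dual_pieceI[OF lin]) (use 0 False in auto)
  qed
qed

text \<open>Dual to \<open>comult_mult_primitive\<close>: \<open>h \<otimes> 1\<close> acts on
  \<open>a\<close> and \<open>1 \<otimes> h\<close> acts on \<open>b\<close>, with the sign of
  moving \<open>h\<close>, of degree \<open>d\<close>, past the argument of \<open>a\<close>, of
  degree \<open>m\<close>.\<close>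

lemma primitive_derivation:
  assumes h: "\<Delta> h = pure_tensor s s h 1 + pure_tensor s s 1 h" "h \<in> G d"
  shows "dual.derivation d (\<lambda>a y. a (h * y))"
  unfolding dual.derivation_def
proof (intro conjI allI ballI)
  show "Vector_Spaces.linear fun_scale fun_scale (\<lambda>a y. a (h * y))"
    by (auto simp: linear_iff_raw vector_space_fun_scale fun_scale_def fun_eq_iff)
  show "(\<lambda>y. a (h * y)) \<in> dual (n - d)" if "a \<in> dual n" for a n
    by (rule left_mult_closed(1)[OF that h(2)])
  fix m n a b assume a: "a \<in> dual m" and b: "b \<in> dual n"
  note lin = dual_piece_linear[OF a] dual_piece_linear[OF b]
  show "(\<lambda>y. (a \<star> b) (h * y)) = (\<lambda>y. a (h * y)) \<star> b + fun_scale ((- 1) ^ (d * m)) (a \<star> (\<lambda>y. b (h * y)))"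
  proof
    fix y
    note bil = bilinear_rank_one[OF Vs Vs]
    have "(a \<star> b) (h * y) = \<Delta> y (\<lambda>u v. a (h * u) * b v) + \<Delta> y (\<lambda>u v. koszul G (\<lambda>b' c'. a c' * b (b' * v)) h u)"
      unfolding conv_apply[OF lin] by (rule comult_mult_primitive[OF h(1) bil[OF lin]])
    also have "(\<lambda>u v. koszul G (\<lambda>b' c'. a c' * b (b' * v)) h u) =
        (\<lambda>u v. (- 1) ^ (d * m) * (a u * b (h * v)))"
    proof (intro ext)
      fix u v
      \<comment> \<open>For arbitrary \<open>v\<close> this functional is linear but may fail to be
        homogeneous; \<open>h\<close> is homogeneous instead, as \<open>koszul_dual_right\<close>
        requires.\<close>
      have "Vector_Spaces.linear s (*) (\<lambda>b'. b (b' * v))"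
        using lin(2) by (simp add: linear_functional_iff scale_mult_left distrib_right)
      from koszul_dual_right[OF this a h(2), of u]
      show "koszul G (\<lambda>b' c'. a c' * b (b' * v)) h u = (- 1) ^ (d * m) * (a u * b (h * v))"
        by (simp add: mult.commute)
    qed
    also have "\<Delta> y \<dots> = (- 1) ^ (d * m) * \<Delta> y (\<lambda>u v. a u * b (h * v))"
      by (rule tensor_apply_scale[OF Vs Vs comult_in bil[OF lin(1) left_mult_linear[OF lin(2)]]])
    finally show "(a \<star> b) (h * y) = ((\<lambda>y. a (h * y)) \<star> b + fun_scale ((- 1) ^ (d * m)) (a \<star> (\<lambda>y. b (h * y)))) y"
      by (simp only: plus_fun_apply fun_scale_apply conv_apply[OF left_mult_linear[OF lin(1)] lin(2)]
          conv_apply[OF lin(1) left_mult_linear[OF lin(2)]])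
  qed
qed

lemma dual_0_eq:
  assumes "a \<in> dual 0"
  shows "a = fun_scale (a 1) \<epsilon>"
proof (rule dual_piece_eqI[OF assms])
  show "fun_scale (a 1) \<epsilon> \<in> dual 0"
    by (rule fun_space.subspace_scale[OF subspace_dual_piece counit_closed])
  fix x assume "x \<in> G 0"
  then obtain c where "x = s c 1" unfolding connected by blast
  then show "a x = fun_scale (a 1) \<epsilon> x"
    by (simp add: functional_scale[OF dual_piece_linear[OF assms]] fun_scale_apply
        functional_scale[OF counit_linear] counit_one)
qed

text \<open>The result has degree 0, so by connectedness it is a multiple of
  \<open>\<epsilon>\<close>, and its value at 1 is \<open>a h\<close>. Dual bases thus provide the
  condition \<open>D x = e\<close> of \<open>triangular\<close>.\<close>

lemma left_mult_same_degree:
  assumes "a \<in> dual n" "h \<in> G n"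
  shows "(\<lambda>y. a (h * y)) = fun_scale (a h) \<epsilon>"
  using dual_0_eq[of "\<lambda>y. a (h * y)"] left_mult_closed(1)[OF assms] by simp

end

section \<open>Primitive and decomposable elements\<close>

context connected_cocommutative_hopf_algebra
begin

lemma subspace_tensor_piece: "fun_space.subspace (tensor_piece s G n)"
  unfolding tensor_piece_def by (rule fun_space.subspace_span)

lemma tensor_piece_apply_sum:
  assumes "t \<in> tensor_piece s G n" and \<beta>: "bilinear_map s s (*) \<beta>"
  shows "t \<beta> = (\<Sum>i\<le>n. t (\<lambda>u v. \<beta> (component G u i) (component G v (n - i))))"
  using assms(1) unfolding tensor_piece_def
proof (induction rule: fun_space.span_induct_alt)
  case (step c t w)
  then obtain a b i j where t: "t = pure_tensor s s a b" "a \<in> G i" "b \<in> G j" "i + j = n" by auto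
  note iff = bilinear_map_iff[OF Vs Vs vector_space_mult]
  have \<beta>0: "\<beta> 0 y = 0" "\<beta> x 0 = 0" for x y
  proof -
    have "\<beta> (s 0 0) y = 0 * (\<beta> 0 y)" "\<beta> x (s 0 0) = 0 * (\<beta> x 0)"
      using \<beta> unfolding iff by blast+
    then show "\<beta> 0 y = 0" "\<beta> x 0 = 0" by simp_all
  qed
  have bil: "bilinear_map s s (*) (\<lambda>u v. \<beta> (component G u i) (component G v j))" for i j
    using \<beta> by (simp add: iff component_add component_scale)
  have "(\<Sum>i'\<le>n. t (\<lambda>u v. \<beta> (component G u i') (component G v (n - i')))) =
      (\<Sum>i'\<le>n. if i' = i then \<beta> a b else 0)"
    unfolding t(1) pure_tensor_apply[OF bil]
    by (intro sum.cong refl) (use t in \<open>auto simp: component_homogeneous \<beta>0\<close>)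
  also have "\<dots> = t \<beta>" using t by (simp add: pure_tensor_apply[OF \<beta>])
  finally show ?case using step(2)
    by (simp only: plus_fun_apply fun_scale_apply sum.distrib sum_distrib_left[symmetric])
qed simp

lemma tensor_piece_eq_0I:
  assumes t: "t \<in> tensor_piece s G n"
    and 0: "\<And>i j a b. \<lbrakk>a \<in> dual i; b \<in> dual j; i + j = n\<rbrakk> \<Longrightarrow> t (\<lambda>u v. a u * b v) = 0"
  shows "t = 0"
proof (rule tensor_eq_0I[OF Vs Vs])
  show "t \<in> tensor_product s s" using t tensor_piece_subset by (rule subsetD[rotated])
  fix a b assume ab: "Vector_Spaces.linear s (*) a" "Vector_Spaces.linear s (*) b"
  have "t (\<lambda>u v. a u * b v) = (\<Sum>i\<le>n. t (\<lambda>u v. a (component G u i) * b (component G v (n - i))))"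
    by (rule tensor_piece_apply_sum[OF t bilinear_rank_one[OF Vs Vs ab]])
  also have "\<dots> = 0"
    by (intro sum.neutral ballI 0[OF component_dual_piece[OF ab(1)] component_dual_piece[OF ab(2)]]) simp
  finally show "t (\<lambda>u v. a u * b v) = 0" .
qed

definition primitive_piece :: "nat \<Rightarrow> 'h set" where
  "primitive_piece n = {h \<in> G n. \<Delta> h = pure_tensor s s h 1 + pure_tensor s s 1 h}"

text \<open>Both sides of the primitivity equation lie in the tensor piece of degree
  \<open>n\<close>, where products of homogeneous functionals separate tensors. So primitivity can
  be tested in the dual algebra.\<close>

lemma primitive_pieceI:
  assumes h: "h \<in> G n"
    and eq: "\<And>i j a b. \<lbrakk>a \<in> dual i; b \<in> dual j; i + j = n\<rbrakk> \<Longrightarrow> (a \<star> b) h = a h * b 1 + a 1 * b h"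
  shows "h \<in> primitive_piece n"
proof -
  let ?p = "pure_tensor s s h 1 + pure_tensor s s 1 h"
  have "pure_tensor s s h 1 \<in> tensor_piece s G n" "pure_tensor s s 1 h \<in> tensor_piece s G n"
    using h one_in unfolding tensor_piece_def by (force intro: fun_space.span_base)+
  then have p: "?p \<in> tensor_piece s G n" by (rule fun_space.subspace_add[OF subspace_tensor_piece])
  have "\<Delta> h - ?p = 0"
  proof (rule tensor_piece_eq_0I[OF fun_space.subspace_diff[OF subspace_tensor_piece comult_graded[OF h] p]])
    fix i j a b assume ab: "a \<in> dual i" "b \<in> dual j" "i + j = n"
    note lin = dual_piece_linear[OF ab(1)] dual_piece_linear[OF ab(2)]
    have "\<Delta> h (\<lambda>u v. a u * b v) = ?p (\<lambda>u v. a u * b v)"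
      using eq[OF ab] unfolding conv_apply[OF lin]
      by (simp only: plus_fun_apply pure_tensor_apply[OF bilinear_rank_one[OF Vs Vs lin]])
    then show "(\<Delta> h - ?p) (\<lambda>u v. a u * b v) = 0" by simp
  qed
  then show ?thesis using h by (simp add: primitive_piece_def)
qed

lemma subspace_primitive_piece: "subspace (primitive_piece n)"
proof (rule subspaceI)
  have "\<Delta> 0 = 0" using comult_scale[of 0 0] by simp
  note pt = pure_tensor_bilinear[OF Vs Vs, unfolded bilinear_map_iff[OF Vs Vs vector_space_fun_scale]]
  have pt0: "pure_tensor s s 0 y = 0" "pure_tensor s s y 0 = 0" for y
  proof -
    have "pure_tensor s s (s 0 0) y = fun_scale 0 (pure_tensor s s 0 y)"
      "pure_tensor s s y (s 0 0) = fun_scale 0 (pure_tensor s s y 0)"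
      using pt by blast+
    then show "pure_tensor s s 0 y = 0" "pure_tensor s s y 0 = 0" by simp_all
  qed
  show "0 \<in> primitive_piece n"
    by (simp only: primitive_piece_def mem_Collect_eq \<open>\<Delta> 0 = 0\<close> pt0 subspace_0[OF subspace_G] add_0_left simp_thms)
  show "x + y \<in> primitive_piece n" if "x \<in> primitive_piece n" "y \<in> primitive_piece n" for x y
    using that pt by (simp add: primitive_piece_def comult_add subspace_add[OF subspace_G] algebra_simps)
  show "s c x \<in> primitive_piece n" if "x \<in> primitive_piece n" for c x
    using that pt by (simp add: primitive_piece_def comult_scale subspace_scale[OF subspace_G]
        fun_space.scale_right_distrib)
qed

lemma dual_one: "\<lbrakk>a \<in> dual i; i \<noteq> 0\<rbrakk> \<Longrightarrow> a 1 = 0"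
  using dual_piece_eq_0[OF _ one_in] by metis

lemma primitive_component:
  assumes x: "\<Delta> x = pure_tensor s s x 1 + pure_tensor s s 1 x"
  shows "component G x n \<in> primitive_piece n"
proof (rule primitive_pieceI[OF component_in])
  fix i j a b assume ab: "a \<in> dual i" "b \<in> dual j" "i + j = n"
  note lin = dual_piece_linear[OF ab(1)] dual_piece_linear[OF ab(2)]
  have "(a \<star> b) (component G x n) = (a \<star> b) x"
    by (rule functional_component) (use conv_closed[OF ab(1,2)] ab(3) in simp)
  also have "\<dots> = a x * b 1 + a 1 * b x"
    unfolding conv_apply[OF lin] x plus_fun_apply
    by (simp only: pure_tensor_apply[OF bilinear_rank_one[OF Vs Vs lin]])
  \<comment> \<open>If \<open>j = 0\<close>, then \<open>i = n\<close> and \<open>a\<close> sees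
    only the component of degree \<open>n\<close>; if \<open>j > 0\<close>, then
    \<open>b 1 = 0\<close> and both sides vanish.\<close>
  also have "a x * b 1 = a (component G x n) * b 1"
    using dual_one[OF ab(2)] functional_component[OF ab(1), of x] ab(3) by (cases "j = 0") auto
  also have "a 1 * b x = a 1 * b (component G x n)"
    using dual_one[OF ab(1)] functional_component[OF ab(2), of x] ab(3) by (cases "i = 0") auto
  finally show "(a \<star> b) (component G x n) = a (component G x n) * b 1 + a 1 * b (component G x n)" .
qed

text \<open>An \<open>h\<close> killed by all products of functionals of positive degree is
  primitive, so \<open>z h = 0\<close>; then \<open>in_span_functionals\<close> puts
  \<open>z\<close> into the span of these products.\<close>

lemma dual_decomposable:
  assumes n: "n > 0" and z: "z \<in> dual n" and 0: "\<And>h. h \<in> primitive_piece n \<Longrightarrow> z h = 0"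
  shows "z \<in> fun_space.span {a \<star> b | a b i j. a \<in> dual i \<and> b \<in> dual j \<and> i > 0 \<and> j > 0 \<and> i + j = n}"
    (is "z \<in> fun_space.span ?F")
proof (rule in_span_functionals[OF _ z])
  show "?F \<subseteq> dual n" using conv_closed by blast
  fix h assume h: "h \<in> G n" and F: "\<And>f. f \<in> ?F \<Longrightarrow> f h = 0"
  have "h \<in> primitive_piece n"
  proof (rule primitive_pieceI[OF h])
    fix i j a b assume ab: "a \<in> dual i" "b \<in> dual j" "i + j = n"
    note lin = dual_piece_linear[OF ab(1)] dual_piece_linear[OF ab(2)]
    \<comment> \<open>A factor of degree 0 is a multiple of \<open>\<epsilon>\<close>, and such
      products account for the two terms of the primitivity equation; if both degrees are positive,
      both sides are 0.\<close>
    consider "i = 0" "j = n" | "j = 0" "i = n" | "i > 0" "j > 0" using ab(3) by fastforce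
    then show "(a \<star> b) h = a h * b 1 + a 1 * b h"
    proof cases
      case 1
      then have "a = fun_scale (a 1) \<epsilon>" using dual_0_eq ab(1) by blast
      then have "a \<star> b = fun_scale (a 1) (\<epsilon> \<star> b)"
        using conv_bilinear(3)[OF counit_linear counit_linear lin(2)] by metis
      then have "(a \<star> b) h = a 1 * b h"
        by (simp only: counit_conv(1)[OF lin(2)] fun_scale_apply)
      then show ?thesis using dual_one[OF ab(2)] 1 n by simp
    next
      case 2
      then have "b = fun_scale (b 1) \<epsilon>" using dual_0_eq ab(2) by blast
      then have "a \<star> b = fun_scale (b 1) (a \<star> \<epsilon>)"
        using conv_bilinear(4)[OF counit_linear counit_linear lin(1)] by metis
      then have "(a \<star> b) h = b 1 * a h"
        by (simp only: counit_conv(2)[OF lin(1)] fun_scale_apply)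
      then show ?thesis using dual_one[OF ab(1)] 2 n by simp
    next
      case 3
      then have "(a \<star> b) h = 0" using F ab by blast
      then show ?thesis using 3 dual_one[OF ab(1)] dual_one[OF ab(2)] by simp
    qed
  qed
  then show "z h = 0" by (rule 0)
qed

text \<open>The right ideal generated by the homogeneous primitives of positive degree. The
  primitive stands on the left because its left multiplication acts on the dual algebra as a
  derivation.\<close>

definition primitive_ideal :: "'h set" where
  "primitive_ideal = span {h * y | h y n. n > 0 \<and> h \<in> primitive_piece n}"

lemma primitive_ideal_mult: "w \<in> primitive_ideal \<Longrightarrow> w * x \<in> primitive_ideal"
  unfolding primitive_ideal_def
proof (induction rule: span_induct_alt)
  case base
  show ?case by (simp add: span_zero)
next
  case (step c t u)
  then obtain h y n where t: "t = h * y" "n > 0" "h \<in> primitive_piece n" by blast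
  have "h * (y * x) \<in> span {h * y | h y n. n > 0 \<and> h \<in> primitive_piece n}"
    by (rule span_base) (use t in blast)
  then show ?case using step(2) unfolding t(1)
    by (simp only: distrib_right scale_mult_left mult.assoc span_add span_scale)
qed

lemma positive_part_component: "x \<in> positive_part s G \<Longrightarrow> component G x 0 = 0"
  unfolding positive_part_def
proof (induction rule: span_induct_alt)
  case (step c t u)
  then obtain n where "n > 0" "t \<in> G n" by auto
  then show ?case using step(2) by (simp add: component_add component_scale component_homogeneous)
qed simp

lemma subalgebra_hull: "subalgebra s (subalgebra s hull X)"
proof (rule hull_in)
  fix T assume "Ball T (subalgebra s)"
  then show "subalgebra s (\<Inter>T)"
    unfolding subalgebra_def using subspace_Inter[of T] by blast
qed

lemma primitive_piece_primitives: "n > 0 \<Longrightarrow> primitive_piece n \<subseteq> primitives s G \<Delta>"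
  unfolding primitive_piece_def primitives_def positive_part_def by (auto intro: span_base)

text \<open>The elements that are scalars modulo \<open>primitive_ideal\<close> contain the
  primitives and form a subalgebra.\<close>

lemma hull_primitives_ideal:
  assumes "x \<in> subalgebra s hull primitives s G \<Delta>"
  shows "\<exists>c. x - s c 1 \<in> primitive_ideal"
proof (rule hull_induct[OF assms])
  fix x assume "x \<in> primitives s G \<Delta>"
  then have x: "x \<in> positive_part s G" "\<Delta> x = pure_tensor s s x 1 + pure_tensor s s 1 x"
    by (auto simp: primitives_def)
  have "component G x n \<in> primitive_ideal" for n
  proof (cases "n = 0")
    case True
    then show ?thesis using positive_part_component[OF x(1)]
      by (simp add: primitive_ideal_def span_zero)
  next
    case False
    then have "component G x n * 1 \<in> primitive_ideal"
      unfolding primitive_ideal_def using primitive_component[OF x(2)]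
      by (intro span_base CollectI exI[of _ "component G x n"] exI[of _ 1] exI[of _ n]) simp
    then show ?thesis by simp
  qed
  then have "(\<Sum>n | component G x n \<noteq> 0. component G x n) \<in> primitive_ideal"
    unfolding primitive_ideal_def by (intro span_sum)
  then have "x \<in> primitive_ideal" by (subst component_sum'[of x])
  then show "\<exists>c. x - s c 1 \<in> primitive_ideal" by (intro exI[of _ 0]) simp
next
  note I = primitive_ideal_def
  have sub: "subspace primitive_ideal" unfolding I by (rule subspace_span)
  show "subalgebra s {x. \<exists>c. x - s c 1 \<in> primitive_ideal}"
    unfolding subalgebra_def
  proof (intro conjI ballI)
    show "subspace {x. \<exists>c. x - s c 1 \<in> primitive_ideal}"
    proof (rule subspaceI; unfold mem_Collect_eq)
      show "\<exists>c. 0 - s c 1 \<in> primitive_ideal"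
        by (rule exI[of _ 0]) (simp add: subspace_0[OF sub])
      show "\<exists>c. x + y - s c 1 \<in> primitive_ideal"
        if "\<exists>c. x - s c 1 \<in> primitive_ideal" "\<exists>c. y - s c 1 \<in> primitive_ideal" for x y
      proof -
        from that obtain c d where "x - s c 1 \<in> primitive_ideal" "y - s d 1 \<in> primitive_ideal" by blast
        from subspace_add[OF sub this] show ?thesis
          by (intro exI[of _ "c + d"]) (simp add: scale_left_distrib algebra_simps)
      qed
      show "\<exists>d. s c x - s d 1 \<in> primitive_ideal" if "\<exists>c. x - s c 1 \<in> primitive_ideal" for c x
      proof -
        from that obtain d where "x - s d 1 \<in> primitive_ideal" by blast
        from subspace_scale[OF sub this, of c] show ?thesis
          by (intro exI[of _ "c * d"]) (simp add: scale_right_diff_distrib)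
      qed
    qed
    show "1 \<in> {x. \<exists>c. x - s c 1 \<in> primitive_ideal}"
      unfolding mem_Collect_eq by (rule exI[of _ 1]) (simp add: subspace_0[OF sub])
    fix x y assume "x \<in> {x. \<exists>c. x - s c 1 \<in> primitive_ideal}" "y \<in> {x. \<exists>c. x - s c 1 \<in> primitive_ideal}"
    then obtain c d where cd: "x - s c 1 \<in> primitive_ideal" "y - s d 1 \<in> primitive_ideal" by blast
    \<comment> \<open>\<open>primitive_ideal\<close> is a right ideal, so the product is split such
      that the factor from the ideal stands on the left and the other summand is a scalar
      multiple.\<close>
    have "(x - s c 1) * y + s c (y - s d 1) \<in> primitive_ideal"
      by (intro subspace_add[OF sub] primitive_ideal_mult cd subspace_scale[OF sub])
    also have "(x - s c 1) * y + s c (y - s d 1) = x * y - s (c * d) 1"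
      by (simp add: left_diff_distrib scale_mult_left scale_right_diff_distrib)
    finally show "x * y \<in> {x. \<exists>c. x - s c 1 \<in> primitive_ideal}" by blast
  qed
qed

section \<open>The decomposables as a graded subspace\<close>

lemma decomposables_eq:
  "decomposables s G = span {u * v | u v i j. u \<in> G i \<and> v \<in> G j \<and> i > 0 \<and> j > 0}"
    (is "_ = span ?D")
proof
  have 1: "u * v \<in> span ?D" if u: "u \<in> G i" "i > 0" and v: "v \<in> positive_part s G" for u v i
    using v unfolding positive_part_def
  proof (induction rule: span_induct_alt)
    case base
    show ?case by (simp add: span_zero)
  next
    case (step c t w)
    then have "u * t \<in> span ?D" using u by (intro span_base) auto
    then show ?case using step(2) by (simp only: distrib_left scale_mult_right span_add span_scale)
  qed
  have 2: "u * v \<in> span ?D" if u: "u \<in> positive_part s G" and v: "v \<in> positive_part s G" for u v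
    using u unfolding positive_part_def
  proof (induction rule: span_induct_alt)
    case base
    show ?case by (simp add: span_zero)
  next
    case (step c t w)
    then have "t * v \<in> span ?D" using 1 v by auto
    then show ?case using step(2) by (simp only: distrib_right scale_mult_left span_add span_scale)
  qed
  show "decomposables s G \<subseteq> span ?D"
    unfolding decomposables_def by (rule span_minimal) (use 2 in auto)
  show "span ?D \<subseteq> decomposables s G"
    unfolding decomposables_def
  proof (rule span_mono, clarify)
    fix u v i j assume "u \<in> G i" "v \<in> G j" "0 < (i::nat)" "0 < (j::nat)"
    then have "u \<in> positive_part s G" "v \<in> positive_part s G"
      unfolding positive_part_def by (auto intro: span_base)
    then show "\<exists>x y. u * v = x * y \<and> x \<in> positive_part s G \<and> y \<in> positive_part s G" by blast
  qed
qed

lemma subspace_decomposables: "subspace (decomposables s G)"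
  unfolding decomposables_def by (rule subspace_span)

lemma decomposables_component: "x \<in> decomposables s G \<Longrightarrow> component G x n \<in> decomposables s G"
  unfolding decomposables_eq
proof (induction rule: span_induct_alt)
  case base
  show ?case by (simp add: span_zero)
next
  case (step c t w)
  then obtain u v i j where t: "t = u * v" "u \<in> G i" "v \<in> G j" "i > 0" "j > 0" by blast
  have "component G t n \<in> span {u * v | u v i j. u \<in> G i \<and> v \<in> G j \<and> i > 0 \<and> j > 0}"
    unfolding t(1) component_homogeneous[OF graded_mult[OF t(2,3)]]
    by (cases "n = i + j") (use t in \<open>auto simp: span_zero intro!: span_base\<close>)
  then show ?case using step(2) by (simp only: component_add component_scale span_add span_scale)
qed

lemma functional_decomposables:
  assumes f: "Vector_Spaces.linear s (*) f"
    and 0: "\<And>u v i j. \<lbrakk>u \<in> G i; v \<in> G j; i > 0; j > 0\<rbrakk> \<Longrightarrow> f (u * v) = 0"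
    and d: "d \<in> decomposables s G"
  shows "f d = 0"
  using d unfolding decomposables_eq
proof (induction rule: span_induct_alt)
  case base
  show ?case by (rule functional_zero[OF f])
next
  case (step c t w)
  then have "f t = 0" using 0 by blast
  then show ?case using step(2) by (simp add: functional_add[OF f] functional_scale[OF f])
qed

end

section \<open>Vanishing of Frobenius\<close>

locale connected_cocommutative_hopf_algebra_char_p =
  connected_cocommutative_hopf_algebra s G \<Delta> \<epsilon>
  for s :: "'k::field \<Rightarrow> 'h::ring_1 \<Rightarrow> 'h" and G and \<Delta> and \<epsilon> +
  fixes p :: nat
  assumes char: "CHAR('k) = p" and p_pos: "p > 0"
    and perfect: "surj (\<lambda>c::'k. c ^ p)"
begin

sublocale dual: graded_commutative_algebra_char_p fun_scale dual "dual_mult s \<Delta>" \<epsilon> p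
  by unfold_locales (rule char p_pos)+

lemma pw_dual: "a \<in> dual n \<Longrightarrow> dual.pw a p \<in> dual (p * n)"
  by (rule dual.pw_closed)

text \<open>The value of \<open>dual.pw a p\<close> at \<open>h * y\<close> is the value at
  \<open>y\<close> of its derivative along \<open>h\<close>, and derivations kill
  \<open>p\<close>-th powers.\<close>

lemma frobenius_primitive_ideal:
  assumes a: "a \<in> dual n" "V_defined p n" and w: "w \<in> primitive_ideal"
  shows "dual.pw a p w = 0"
  using w unfolding primitive_ideal_def
proof (induction rule: span_induct_alt)
  case base
  show ?case by (rule functional_zero[OF dual_piece_linear[OF pw_dual[OF a(1)]]])
next
  case (step c t u)
  then obtain h y m where t: "t = h * y" "h \<in> primitive_piece m" by blast
  then have h: "h \<in> G m" "\<Delta> h = pure_tensor s s h 1 + pure_tensor s s 1 h"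
    by (auto simp: primitive_piece_def)
  have "(\<lambda>y. dual.pw a p (h * y)) = 0"
    by (rule dual.derivation_frobenius[OF primitive_derivation[OF h(2,1)] a])
  then have "dual.pw a p t = 0" unfolding t(1) by (rule fun_cong[of _ 0, simplified])
  then show ?case using step(2) dual_piece_linear[OF pw_dual[OF a(1)]]
    by (simp add: functional_add functional_scale)
qed

text \<open>Modulo the ideal \<open>x\<close> is a scalar, and a functional of positive degree
  \<open>p * n\<close> vanishes on scalars.\<close>

lemma frobenius_hull_primitives:
  assumes a: "a \<in> dual n" "V_defined p n" and n: "n > 0"
    and x: "x \<in> subalgebra s hull primitives s G \<Delta>"
  shows "dual.pw a p x = 0"
proof -
  obtain c where c: "x - s c 1 \<in> primitive_ideal" using hull_primitives_ideal[OF x] by blast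
  note lin = dual_piece_linear[OF pw_dual[OF a(1)]]
  have "dual.pw a p 1 = 0" using dual_one[OF pw_dual[OF a(1)]] n p_pos by simp
  then show ?thesis using frobenius_primitive_ideal[OF a c]
    by (simp add: functional_diff[OF lin] functional_scale[OF lin])
qed

section \<open>The Verschiebung in terms of \<open>p\<close>-th powers in the dual algebra\<close>

lemma power_p_add: "((x::'k) + y) ^ p = x ^ p + y ^ p"
  using freshmans_dream[where 'a='k] dual.prime_char char by simp

lemma power_p_inject:
  assumes "(x::'k) ^ p = y ^ p"
  shows "x = y"
  using power_p_add[of "x - y" y] assms p_pos by simp

text \<open>This makes the \<open>THE\<close> in \<open>verschiebung\<close> meaningful. Sending
  \<open>a\<close> to the \<open>p\<close>-th root of \<open>dual.pw a p x\<close> is linear, as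
  Frobenius is additive on the dual and in the field, so by reflexivity it is evaluation at some
  \<open>y\<close>. For uniqueness, \<open>p\<close>-th roots are unique and functionals separate
  points.\<close>

lemma verschiebung_ex1:
  assumes V: "V_defined p n"
  shows "\<exists>!y. y \<in> G n \<and> (\<forall>a\<in>dual n. a y ^ p = dual_power s \<Delta> \<epsilon> p a x)"
proof -
  obtain r :: "'k \<Rightarrow> 'k" where r: "\<And>c. r c ^ p = c" using perfect by (metis surjD)
  define \<phi> where "\<phi> a = r (dual.pw a p x)" for a
  have "\<phi> (a + b) = \<phi> a + \<phi> b" if "a \<in> dual n" "b \<in> dual n" for a b
    by (rule power_p_inject) (simp add: power_p_add \<phi>_def r dual.frobenius_add[OF that V])
  moreover have "\<phi> (fun_scale c a) = c * \<phi> a" if "a \<in> dual n" for a c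
    by (rule power_p_inject)
      (simp add: \<phi>_def r dual.pw_scale[OF that] power_mult_distrib fun_scale_apply)
  ultimately obtain y where y: "y \<in> G n" "\<forall>a\<in>dual n. a y = \<phi> a"
    using dual_piece_reflexive[of n \<phi>] by blast
  show ?thesis
  proof (rule ex1I[of _ y])
    show "y \<in> G n \<and> (\<forall>a\<in>dual n. a y ^ p = dual_power s \<Delta> \<epsilon> p a x)"
      using y by (auto simp: \<phi>_def r dual_power_eq)
  next
    fix y' assume y': "y' \<in> G n \<and> (\<forall>a\<in>dual n. a y' ^ p = dual_power s \<Delta> \<epsilon> p a x)"
    have "y' - y = 0"
    proof (rule dual_piece_separates[OF subspace_diff[OF subspace_G]])
      fix a assume a: "a \<in> dual n"
      have "a y = r (dual.pw a p x)" using y(2) a by (simp add: \<phi>_def)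
      then have "a y' ^ p = a y ^ p" using y' a by (simp add: r dual_power_eq)
      then show "a (y' - y) = 0"
        using power_p_inject functional_diff[OF dual_piece_linear[OF a]] by simp
    qed (use y y' in auto)
    then show "y' = y" by simp
  qed
qed

text \<open>\<open>V x\<close> is determined by the values of \<open>p\<close>-th powers at
  \<open>x\<close>. From here on the vanishing of \<open>V\<close> is used in this dual
  form.\<close>

lemma verschiebung_eq_0_iff:
  assumes V: "V_defined p n"
  shows "verschiebung s G \<Delta> \<epsilon> p n x = 0 \<longleftrightarrow> (\<forall>a\<in>dual n. dual.pw a p x = 0)"
proof
  note ex1 = verschiebung_ex1[OF V, of x]
  have *: "verschiebung s G \<Delta> \<epsilon> p n x \<in> G n \<and>
      (\<forall>a\<in>dual n. a (verschiebung s G \<Delta> \<epsilon> p n x) ^ p = dual_power s \<Delta> \<epsilon> p a x)"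
    unfolding verschiebung_def by (rule theI'[OF ex1])
  show "\<forall>a\<in>dual n. dual.pw a p x = 0" if "verschiebung s G \<Delta> \<epsilon> p n x = 0"
  proof
    fix a assume a: "a \<in> dual n"
    then have "dual.pw a p x = a 0 ^ p" using * unfolding that dual_power_eq by simp
    then show "dual.pw a p x = 0" using p_pos by (simp add: functional_zero[OF dual_piece_linear[OF a]])
  qed
  show "verschiebung s G \<Delta> \<epsilon> p n x = 0" if "\<forall>a\<in>dual n. dual.pw a p x = 0"
    unfolding verschiebung_def
    by (rule the1_equality[OF ex1])
      (use that p_pos in \<open>auto simp: dual_power_eq functional_zero[OF dual_piece_linear] subspace_0[OF subspace_G]\<close>)
qed

section \<open>Generators of the dual algebra that are dual to primitives\<close>

lemma monomials_append:
  "dual.triangular (gs' @ gs) \<Longrightarrow> dual.monomials gs n w \<subseteq> dual.monomials (gs' @ gs) n w"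
proof (induction gs')
  case (Cons g gs')
  obtain d x D where g: "g = (d, x, D)" by (cases g)
  have "dual.triangular (gs' @ gs)" using Cons.prems by (simp add: g)
  then show ?case using Cons.IH dual.monomials_Cons unfolding g append_Cons by blast
qed simp

text \<open>Where \<open>V\<close> is defined this is the hypothesis on \<open>p\<close>-th powers.
  Otherwise \<open>m\<close> and \<open>p\<close> are odd, graded commutativity gives
  \<open>x \<star> x = - (x \<star> x)\<close>, and 2 is invertible.\<close>

lemma pw_height:
  assumes frob: "\<forall>n a. a \<in> dual n \<and> n > 0 \<and> V_defined p n \<and> p * n \<le> N \<longrightarrow> dual.pw a p = 0"
    and x: "x \<in> dual m" and m: "m > 0" and N: "height p m * m \<le> N"
  shows "dual.pw x (height p m) = 0"
proof (cases "V_defined p m")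
  case True
  then show ?thesis using frob x m N by (simp add: height_def)
next
  case False
  then have "odd m" "p \<noteq> 2" by (auto simp: V_defined_def)
  have "x \<star> x = fun_scale (- 1) (x \<star> x)"
    using dual.mul_commute[OF x x] \<open>odd m\<close> by simp
  then have "(x \<star> x) y = - (x \<star> x) y" for y by (metis fun_scale_apply mult_minus1)
  then have "2 * (x \<star> x) y = 0" for y by (metis mult_2 add.right_inverse)
  moreover have "(2::'k) \<noteq> 0"
  proof
    assume "(2::'k) = 0"
    then have "p dvd 2" using of_nat_eq_0_iff_char_dvd[of 2, where 'a='k] char by simp
    then show False using \<open>p \<noteq> 2\<close> dual.prime_char primes_dvd_imp_eq two_is_prime_nat by blast
  qed
  ultimately have "x \<star> x = 0" by (intro ext) simp
  then show ?thesis using False dual.mul_unit[OF x] by (simp add: height_def numeral_2_eq_2)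
qed

text \<open>
  Triangularity holds because a primitive element of degree \<open>d\<close> annihilates every functional of
  smaller degree, so generators are adjoined in order of increasing degree.
\<close>

lemma dual_generators:
  assumes frob: "\<forall>n a. a \<in> dual n \<and> n > 0 \<and> V_defined p n \<and> p * n \<le> N \<longrightarrow> dual.pw a p = 0"
    and "d \<le> N"
  shows "\<exists>gs. dual.triangular gs \<and>
    (\<forall>(m, x, D)\<in>set gs. 0 < m \<and> m < d \<and> (\<exists>h\<in>G m. D = (\<lambda>a y. a (h * y)))) \<and>
    (\<forall>m. 0 < m \<and> m < d \<longrightarrow> dual m \<subseteq> dual.monomials gs m 1)"
  using assms(2)
proof (induction d)
  case 0
  show ?case by (rule exI[of _ "[]"]) simp
next
  case (Suc d)
  then obtain gs where gs: "dual.triangular gs"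
    "\<And>m x D. (m, x, D) \<in> set gs \<Longrightarrow> 0 < m \<and> m < d \<and> (\<exists>h\<in>G m. D = (\<lambda>a y. a (h * y)))"
    "\<And>m. \<lbrakk>0 < m; m < d\<rbrakk> \<Longrightarrow> dual m \<subseteq> dual.monomials gs m 1"
    by fastforce
  show ?case
  proof (cases "d = 0")
    case True
    \<comment> \<open>There is no positive degree below \<open>Suc 0\<close>, so nothing is adjoined
      in degree 0.\<close>
    with gs show ?thesis by (intro exI[of _ gs]) fastforce
  next
    case False
    have pG: "primitive_piece d \<subseteq> G d" by (auto simp: primitive_piece_def)
    obtain B where B: "finite B" "B \<subseteq> primitive_piece d" "independent B" "span B = primitive_piece d"
      using finite_basis_exists[OF pG subspace_primitive_piece] by blast
    have BG: "B \<subseteq> G d" using B(2) pG by blast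
    \<comment> \<open>The new generators are functionals dual to a basis of the primitives of degree
      \<open>d\<close>.\<close>
    obtain e where e: "\<And>b. b \<in> B \<Longrightarrow> e b \<in> dual d"
      "\<And>b b'. \<lbrakk>b \<in> B; b' \<in> B\<rbrakk> \<Longrightarrow> e b b' = (if b' = b then 1 else 0)"
      using dual_basis_exists[OF BG B(3)] by blast
    obtain L where L: "set L = B" "distinct L" using finite_distinct_list[OF B(1)] by blast
    define g :: "'h \<Rightarrow> nat \<times> ('h \<Rightarrow> 'k) \<times> (('h \<Rightarrow> 'k) \<Rightarrow> 'h \<Rightarrow> 'k)" where
      "g h = (d, e h, \<lambda>a y. a (h * y))" for h
    have tri: "dual.triangular (map g l @ gs)" if "set l \<subseteq> B" "distinct l" for l
      using that
    proof (induction l)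
      case Nil
      then show ?case using gs(1) by simp
    next
      case (Cons h l)
      have h: "h \<in> B" "h \<in> G d" using Cons.prems BG by auto
      then have "h \<in> primitive_piece d" using B(2) by blast
      then have der: "dual.derivation d (\<lambda>a y. a (h * y))"
        by (intro primitive_derivation) (auto simp: primitive_piece_def)
      have "(\<lambda>y. e h (h * y)) = \<epsilon>"
        using left_mult_same_degree[OF e(1)[OF h(1)] h(2)] e(2)[OF h(1) h(1)] by simp
      \<comment> \<open>A generator from \<open>gs\<close> has degree below \<open>d\<close>, so the
        operator of \<open>h\<close> kills it; one of degree \<open>d\<close> is dual to a different
        basis vector.\<close>
      moreover have "(\<lambda>y. x' (h * y)) = 0" if g': "(d', x', D') \<in> set (map g l @ gs)" for d' x' D'
      proof (cases "(d', x', D') \<in> set gs")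
        case True
        then show ?thesis
          using left_mult_closed(2)[OF dual.triangularD[OF gs(1) True] h(2)] gs(2)[OF True] by blast
      next
        case False
        then obtain h' where h': "h' \<in> set l" "x' = e h'" using g' by (auto simp: g_def)
        then have "h' \<in> B" "h' \<noteq> h" using Cons.prems by auto
        then show ?thesis
          unfolding h'(2) using left_mult_same_degree[OF e(1) h(2)] e(2)[of h' h] h(1) by simp
      qed
      ultimately have "\<forall>(d', x', D')\<in>set (map g l @ gs). (\<lambda>y. x' (h * y)) = 0" "(\<lambda>y. e h (h * y)) = \<epsilon>"
        by blast+
      then show ?case
        unfolding list.map append_Cons g_def[of h] dual.triangular.simps
        using Cons e(1)[OF h(1)] der by auto
    qed
    define gs' where "gs' = map g L @ gs"
    have tri': "dual.triangular gs'" unfolding gs'_def by (rule tri) (use L in auto)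
    note sub = monomials_append[OF tri'[unfolded gs'_def], folded gs'_def]
    have nilp: "dual.pw x (height p m) = 0" if "(m, x, D) \<in> set gs" "height p m * m \<le> N" for m x D
      using pw_height[OF frob dual.triangularD[OF gs(1) that(1)] _ that(2)] gs(2)[OF that(1)] by blast
    have gen: "dual d \<subseteq> dual.monomials gs' d 1"
    proof
      fix a assume a: "a \<in> dual d"
      note S = subspace_dual_piece[of d]
      \<comment> \<open>\<open>c\<close> is the combination of the new generators that agrees with
        \<open>a\<close> on the primitives of degree \<open>d\<close>. Hence \<open>a - c\<close> is
        decomposable with factors of degree below \<open>d\<close>, and it has weight 2 in the old
        generators.\<close>
      define c where "c = (\<Sum>h\<in>B. fun_scale (a h) (e h))"
      have c: "c \<in> dual d" unfolding c_def
        by (rule fun_space.subspace_sum[OF S]) (rule fun_space.subspace_scale[OF S e(1)])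
      have ac: "a - c \<in> dual d" by (rule fun_space.subspace_diff[OF S a c])
      have "a - c \<in> fun_space.span {x \<star> y | x y i j. x \<in> dual i \<and> y \<in> dual j \<and> i > 0 \<and> j > 0 \<and> i + j = d}"
      proof (rule dual_decomposable[OF _ ac])
        show "d > 0" using False by simp
        fix h assume "h \<in> primitive_piece d"
        then have "h \<in> span B" using B(4) by simp
        then show "(a - c) h = 0"
        proof (induction rule: span_induct_alt)
          case base
          show ?case by (rule functional_zero[OF dual_piece_linear[OF ac]])
        next
          case (step k b h)
          have "c b = (\<Sum>h\<in>B. if h = b then a b else 0)"
            unfolding c_def sum_fun_apply
            by (rule sum.cong) (use e(2) step(1) in \<open>auto simp: fun_scale_apply\<close>)
          then have "(a - c) b = 0" using B(1) step(1) by simp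
          then show ?case using step(2)
            by (simp only: functional_add[OF dual_piece_linear[OF ac]]
                functional_scale[OF dual_piece_linear[OF ac]] mult_zero_right add_0_left)
        qed
      qed
      also have "fun_space.span {x \<star> y | x y i j. x \<in> dual i \<and> y \<in> dual j \<and> i > 0 \<and> j > 0 \<and> i + j = d}
          \<subseteq> dual.monomials gs d 2"
      proof (rule fun_space.span_minimal[OF _ dual.subspace_monomials], clarify)
        fix x y i j assume xy: "x \<in> dual i" "y \<in> dual j" "0 < i" "0 < j" "d = i + j"
        then have "x \<in> dual.monomials gs i 1" "y \<in> dual.monomials gs j 1"
          using gs(3)[of i] gs(3)[of j] by auto
        from dual.monomials_mul[OF gs(1) nilp this, of N] show "x \<star> y \<in> dual.monomials gs (i + j) 2"
          using Suc.prems xy(5) by (simp add: numeral_2_eq_2)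
      qed
      also have "dual.monomials gs d 2 \<subseteq> dual.monomials gs' d 1"
        using dual.monomials_mono[of 1 2 gs' d] sub[of d 2] by auto
      finally have "a - c \<in> dual.monomials gs' d 1" .
      moreover have "c \<in> dual.monomials gs' d 1"
        unfolding c_def
      proof (rule fun_space.subspace_sum[OF dual.subspace_monomials],
          rule fun_space.subspace_scale[OF dual.subspace_monomials])
        fix h assume "h \<in> B"
        then show "e h \<in> dual.monomials gs' d 1"
          by (intro dual.generator_monomials[OF tri', of _ _ "\<lambda>a y. a (h * y)"])
            (use L in \<open>auto simp: gs'_def g_def\<close>)
      qed
      ultimately have "(a - c) + c \<in> dual.monomials gs' d 1"
        by (rule fun_space.subspace_add[OF dual.subspace_monomials])
      then show "a \<in> dual.monomials gs' d 1" by (simp only: diff_add_cancel)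
    qed
    show ?thesis
    proof (intro exI[of _ gs'] conjI tri')
      show "\<forall>(m, x, D)\<in>set gs'. 0 < m \<and> m < Suc d \<and> (\<exists>h\<in>G m. D = (\<lambda>a y. a (h * y)))"
        using gs(2) False L(1) BG unfolding gs'_def g_def by fastforce
      show "\<forall>m. 0 < m \<and> m < Suc d \<longrightarrow> dual m \<subseteq> dual.monomials gs' m 1"
        using gs(3) sub gen less_Suc_eq by (metis subset_trans)
    qed
  qed
qed

text \<open>By \<open>prim\<close>, \<open>z\<close> is decomposable in the dual algebra, hence of
  weight 2 in generators of degree below \<open>N\<close>; by \<open>dec\<close>, the operators of
  all these generators kill it. Then \<open>monomials_eq_0\<close> applies.\<close>

lemma dual_eq_0:
  assumes frob: "\<forall>n a. a \<in> dual n \<and> n > 0 \<and> V_defined p n \<and> p * n \<le> N \<longrightarrow> dual.pw a p = 0"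
    and N: "N > 0" and z: "z \<in> dual N"
    and prim: "\<And>h. h \<in> primitive_piece N \<Longrightarrow> z h = 0"
    and dec: "\<And>u v i j. \<lbrakk>u \<in> G i; v \<in> G j; i > 0; j > 0; i + j = N\<rbrakk> \<Longrightarrow> z (u * v) = 0"
  shows "z = 0"
proof -
  obtain gs where gs: "dual.triangular gs"
    "\<And>m x D. (m, x, D) \<in> set gs \<Longrightarrow> 0 < m \<and> m < N \<and> (\<exists>h\<in>G m. D = (\<lambda>a y. a (h * y)))"
    "\<And>m. \<lbrakk>0 < m; m < N\<rbrakk> \<Longrightarrow> dual m \<subseteq> dual.monomials gs m 1"
    using dual_generators[OF frob order_refl] by fastforce
  have nilp: "dual.pw x (height p m) = 0" if "(m, x, D) \<in> set gs" "height p m * m \<le> N" for m x D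
    using pw_height[OF frob dual.triangularD[OF gs(1) that(1)] _ that(2)] gs(2)[OF that(1)] by blast
  note lin = dual_piece_linear[OF z]
  have "z \<in> fun_space.span {x \<star> y | x y i j. x \<in> dual i \<and> y \<in> dual j \<and> i > 0 \<and> j > 0 \<and> i + j = N}"
    by (rule dual_decomposable[OF N z prim])
  also have "\<dots> \<subseteq> dual.monomials gs N 2"
  proof (rule fun_space.span_minimal[OF _ dual.subspace_monomials], clarify)
    fix x y i j assume xy: "x \<in> dual i" "y \<in> dual j" "0 < i" "0 < j" "N = i + j"
    then have "x \<in> dual.monomials gs i 1" "y \<in> dual.monomials gs j 1"
      using gs(3)[of i] gs(3)[of j] by auto
    from dual.monomials_mul[OF gs(1) nilp this, of N] show "x \<star> y \<in> dual.monomials gs (i + j) 2"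
      using xy(5) by (simp add: numeral_2_eq_2)
  qed
  finally have "z \<in> dual.monomials gs N 2" .
  moreover have "(\<lambda>y. z (h * y)) = 0" if h: "h \<in> G m" "0 < m" "m < N" for h m
  proof
    fix y
    show "z (h * y) = 0 y"
    proof (induction y rule: graded_induct)
      case (homogeneous y j)
      show ?case
      \<comment> \<open>If \<open>m + j = N\<close>, then \<open>j > 0\<close> since
        \<open>m < N\<close>, and \<open>dec\<close> applies to \<open>h * y\<close>; otherwise
        \<open>h * y\<close> has the wrong degree for \<open>z\<close>.\<close>
      proof (cases "m + j = N")
        case True
        then show ?thesis using dec[OF h(1) homogeneous] h by simp
      next
        case False
        then show ?thesis using dual_piece_eq_0[OF z graded_mult[OF h(1) homogeneous]] by simp
      qed
    qed (simp add: distrib_left functional_add[OF lin])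
  qed
  then have "\<forall>(m, x, D)\<in>set gs. D z = 0" using gs(2) by fastforce
  ultimately show ?thesis using dual.monomials_eq_0[OF gs(1)] by blast
qed

end

section \<open>Cosets of the decomposables\<close>

context connected_cocommutative_hopf_algebra
begin

lemma indec_class_eq_iff: "indec_class s G x = indec_class s G y \<longleftrightarrow> x - y \<in> decomposables s G"
proof
  note S = subspace_decomposables
  show "x - y \<in> decomposables s G" if "indec_class s G x = indec_class s G y"
  proof -
    have "x + 0 \<in> indec_class s G x"
      unfolding indec_class_def by (rule set_plus_intro2[OF subspace_0[OF S]])
    then have "x \<in> indec_class s G y" using that by simp
    then obtain d where "x = y + d" "d \<in> decomposables s G"
      unfolding indec_class_def elt_set_plus_def by auto
    then show ?thesis by simp
  qed
  show "indec_class s G x = indec_class s G y" if xy: "x - y \<in> decomposables s G"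
  proof -
    have 1: "indec_class s G a \<subseteq> indec_class s G b" if "a - b \<in> decomposables s G" for a b
    proof
      fix z assume "z \<in> indec_class s G a"
      then obtain d where "z = a + d" "d \<in> decomposables s G"
        unfolding indec_class_def elt_set_plus_def by auto
      moreover from this have "z = b + ((a - b) + d)" by simp
      ultimately show "z \<in> indec_class s G b"
        using subspace_add[OF S that] unfolding indec_class_def by (metis set_plus_intro2)
    qed
    show ?thesis using 1[OF xy] 1[of y x] subspace_neg[OF S xy] by simp
  qed
qed

lemma in_indec_class: "y \<in> indec_class s G x \<longleftrightarrow> y - x \<in> decomposables s G"
  unfolding indec_class_def elt_set_plus_def by (auto intro: bexI[of _ "y - x"])

lemma indec_class_0: "indec_class s G 0 = decomposables s G"
  using in_indec_class[of _ 0] by auto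

lemma indec_class_add: "indec_class s G x + indec_class s G y = indec_class s G (x + y)"
proof (intro equalityI subsetI)
  fix z assume "z \<in> indec_class s G x + indec_class s G y"
  then obtain a b where ab: "z = a + b" "a - x \<in> decomposables s G" "b - y \<in> decomposables s G"
    unfolding set_plus_def in_indec_class[symmetric] by blast
  from subspace_add[OF subspace_decomposables ab(2,3)] show "z \<in> indec_class s G (x + y)"
    unfolding in_indec_class ab(1) by (simp add: algebra_simps)
next
  fix z assume "z \<in> indec_class s G (x + y)"
  then have "(z - y) \<in> indec_class s G x" "y \<in> indec_class s G y"
    unfolding in_indec_class by (simp_all add: algebra_simps subspace_0[OF subspace_decomposables])
  then have "(z - y) + y \<in> indec_class s G x + indec_class s G y" by (rule set_plus_intro)
  then show "z \<in> indec_class s G x + indec_class s G y" by simp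
qed

lemma indec_class_scale: "s c ` indec_class s G x + decomposables s G = indec_class s G (s c x)"
proof (intro equalityI subsetI)
  fix z assume "z \<in> s c ` indec_class s G x + decomposables s G"
  then obtain a d where ad: "z = s c a + d" "a - x \<in> decomposables s G" "d \<in> decomposables s G"
    unfolding set_plus_def in_indec_class[symmetric] by blast
  from subspace_add[OF subspace_decomposables subspace_scale[OF subspace_decomposables ad(2), of c] ad(3)]
  show "z \<in> indec_class s G (s c x)"
    unfolding in_indec_class ad(1) by (simp add: scale_right_diff_distrib algebra_simps)
next
  fix z assume "z \<in> indec_class s G (s c x)"
  then have "z - s c x \<in> decomposables s G" unfolding in_indec_class .
  moreover have "s c x \<in> s c ` indec_class s G x"
    by (rule imageI) (simp add: in_indec_class subspace_0[OF subspace_decomposables])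
  ultimately have "s c x + (z - s c x) \<in> s c ` indec_class s G x + decomposables s G"
    by (intro set_plus_intro)
  then show "z \<in> s c ` indec_class s G x + decomposables s G" by simp
qed

text \<open>A basis of the decomposables in degree \<open>n\<close> is extended to one of
  \<open>G n\<close>; the old vectors are sent to 0 and the added ones are kept. On cosets
  \<open>\<rho>\<close> becomes a linear section of the quotient map in degree
  \<open>n\<close>.\<close>

lemma decomposables_projection:
  "\<exists>\<rho>. Vector_Spaces.linear s s \<rho> \<and> (\<forall>x\<in>G n. \<rho> x \<in> G n \<and> x - \<rho> x \<in> decomposables s G) \<and>
    (\<forall>x\<in>G n \<inter> decomposables s G. \<rho> x = 0)"
proof -
  let ?D = "G n \<inter> decomposables s G"
  interpret v: vector_space_pair s s by (simp add: vector_space_pair_def Vs)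
  have S: "subspace ?D" by (rule subspace_inter[OF subspace_G subspace_decomposables])
  obtain B where B: "B \<subseteq> ?D" "independent B" "?D \<subseteq> span B"
    using maximal_independent_subset by metis
  obtain C where C: "B \<subseteq> C" "C \<subseteq> G n" "independent C" "G n \<subseteq> span C"
    using maximal_independent_subset_extend[of B "G n"] B by blast
  obtain \<rho> where \<rho>: "Vector_Spaces.linear s s \<rho>" "\<And>c. c \<in> C \<Longrightarrow> \<rho> c = (if c \<in> B then 0 else c)"
    using v.linear_independent_extend[OF C(3), of "\<lambda>c. if c \<in> B then 0 else c"] by blast
  interpret \<rho>: Vector_Spaces.linear s s \<rho> by (rule \<rho>(1))
  have "\<rho> x \<in> G n \<and> x - \<rho> x \<in> decomposables s G" if "x \<in> span C" for x
    using that
  proof (induction rule: span_induct_alt)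
    case base
    show ?case by (simp add: \<rho>.zero subspace_0[OF subspace_G] subspace_0[OF subspace_decomposables])
  next
    case (step k c y)
    have c: "\<rho> c \<in> G n" "c - \<rho> c \<in> decomposables s G"
      using \<rho>(2)[OF step(1)] step(1) B(1) C(2) subspace_0[OF subspace_G] subspace_0[OF subspace_decomposables]
      by auto
    have "\<rho> (s k c + y) = s k (\<rho> c) + \<rho> y" by (simp add: \<rho>.add \<rho>.scale)
    moreover have "s k c + y - (s k (\<rho> c) + \<rho> y) = s k (c - \<rho> c) + (y - \<rho> y)"
      by (simp add: scale_right_diff_distrib)
    ultimately show ?case using c step(2)
      by (simp only: subspace_add[OF subspace_G] subspace_scale[OF subspace_G] simp_thms
          subspace_add[OF subspace_decomposables] subspace_scale[OF subspace_decomposables])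
  qed
  moreover have "\<rho> x = 0" if "x \<in> span B" for x
    using that
  proof (induction rule: span_induct_alt)
    case (step k b y)
    then have "\<rho> b = 0" using \<rho>(2)[of b] C(1) by auto
    then show ?case using step(2) by (simp add: \<rho>.add \<rho>.scale)
  qed (simp add: \<rho>.zero)
  ultimately show ?thesis using \<rho>(1) B(3) C(4) by (intro exI[of _ \<rho>]) auto
qed

end

section \<open>The two implications\<close>

context connected_cocommutative_hopf_algebra_char_p
begin

text \<open>The hypothesis is what a section compatible with \<open>V = 0\<close> provides: a
  representative modulo decomposables on which \<open>V\<close> vanishes, in dual terms. By strong
  induction on \<open>N\<close>, Frobenius vanishes on the dual up to degree \<open>N\<close>; then
  \<open>dual_eq_0\<close> shows that primitives and products from lower degrees span everything in
  \<open>G N\<close>.\<close>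

lemma hull_primitives_UNIV:
  assumes split: "\<And>n x. \<lbrakk>n > 0; V_defined p n; x \<in> G (p * n)\<rbrakk> \<Longrightarrow>
    \<exists>y\<in>G (p * n). x - y \<in> decomposables s G \<and> (\<forall>a\<in>dual n. dual.pw a p y = 0)"
  shows "subalgebra s hull primitives s G \<Delta> = UNIV" (is "?S = _")
proof -
  have sub: "subalgebra s ?S" by (rule subalgebra_hull)
  then have S: "subspace ?S" "1 \<in> ?S" and S_mult: "\<And>x y. \<lbrakk>x \<in> ?S; y \<in> ?S\<rbrakk> \<Longrightarrow> x * y \<in> ?S"
    by (auto simp: subalgebra_def)
  have G: "G N \<subseteq> ?S" for N
  proof (induction N rule: less_induct)
    case (less N)
    show ?case
    proof (cases "N = 0")
      case True
      then show ?thesis unfolding True connected using subspace_scale[OF S(1,2)] by auto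
    next
      case False
      have frob: "dual.pw a p = 0" if a: "a \<in> dual n" "n > 0" "V_defined p n" "p * n \<le> N" for n a
      proof (rule dual_piece_eqI[OF pw_dual[OF a(1)] fun_space.subspace_0[OF subspace_dual_piece]])
        note lin = dual_piece_linear[OF pw_dual[OF a(1)]]
        fix x assume x: "x \<in> G (p * n)"
        have "dual.pw a p x = 0"
        proof (cases "p * n < N")
          case True
          then show ?thesis using less[OF True] x frobenius_hull_primitives[OF a(1,3,2)] by blast
        next
          case False
          then have N: "p * n = N" using a(4) by simp
          \<comment> \<open>The induction hypothesis does not reach degree \<open>N\<close> itself.
            Instead \<open>x\<close> is replaced by a representative on which \<open>p\<close>-th
            powers vanish, and the decomposable difference is treated through its factors.\<close>
          obtain y where y: "x - y \<in> decomposables s G" "dual.pw a p y = 0"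
            using split[OF a(2,3) x] a(1) by blast
          have "dual.pw a p (x - y) = 0"
          proof (rule functional_decomposables[OF lin _ y(1)])
            fix u v i j assume uv: "u \<in> G i" "v \<in> G j" "0 < (i::nat)" "0 < (j::nat)"
            show "dual.pw a p (u * v) = 0"
            proof (cases "i + j = N")
              case True
              \<comment> \<open>The left factor has degree below \<open>N\<close>, so it is a scalar
                \<open>c\<close> modulo the right ideal, which absorbs the multiplication by
                \<open>v\<close>. The remaining term \<open>s c v\<close> has degree below
                \<open>N = p * n\<close>.\<close>
              then have "u \<in> ?S" using less[of i] uv by auto
              then obtain c where c: "u - s c 1 \<in> primitive_ideal" using hull_primitives_ideal by blast
              have "dual.pw a p ((u - s c 1) * v) = 0"
                by (rule frobenius_primitive_ideal[OF a(1,3) primitive_ideal_mult[OF c]])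
              moreover have "dual.pw a p v = 0"
                by (rule dual_piece_eq_0[OF pw_dual[OF a(1)] uv(2)]) (use N True uv(3) in simp)
              moreover have "u * v = (u - s c 1) * v + s c v"
                by (simp add: left_diff_distrib scale_mult_left)
              ultimately show ?thesis by (simp only: functional_add[OF lin] functional_scale[OF lin] mult_zero_right add_0_left)
            next
              case False
              then show ?thesis
                using dual_piece_eq_0[OF pw_dual[OF a(1)] graded_mult[OF uv(1,2)]] N by simp
            qed
          qed
          then show ?thesis using y(2) by (simp add: functional_diff[OF lin])
        qed
        then show "dual.pw a p x = 0 x" by simp
      qed
      then have frob': "\<forall>n a. a \<in> dual n \<and> n > 0 \<and> V_defined p n \<and> p * n \<le> N \<longrightarrow> dual.pw a p = 0"
        by blast
      let ?U = "primitive_piece N \<union> {u * v | u v i j. u \<in> G i \<and> v \<in> G j \<and> i > 0 \<and> j > 0 \<and> i + j = N}"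
      have "?U \<subseteq> ?S"
      proof
        fix x assume "x \<in> ?U"
        then consider "x \<in> primitive_piece N"
          | u v i j where "x = u * v" "u \<in> G i" "v \<in> G j" "i > 0" "j > 0" "i + j = N" by blast
        then show "x \<in> ?S"
        proof cases
          case 1
          then show ?thesis using primitive_piece_primitives[of N] False by (intro hull_inc) auto
        next
          case 2
          then show ?thesis using less[of i] less[of j] S_mult by auto
        qed
      qed
      moreover have "x \<in> span ?U" if x: "x \<in> G N" for x
      proof (rule ccontr)
        assume "x \<notin> span ?U"
        then obtain \<phi> where \<phi>: "Vector_Spaces.linear s (*) \<phi>" "\<phi> x \<noteq> 0" "\<forall>y\<in>?U. \<phi> y = 0"
          using separating_functional[OF Vs] by blast
        \<comment> \<open>\<open>\<phi>\<close> may be nonzero in other degrees; its restriction to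
          degree \<open>N\<close> lies in \<open>dual N\<close>.\<close>
        have "(\<lambda>x. \<phi> (component G x N)) = 0"
        proof (rule dual_eq_0[OF frob'])
          show "N > 0" using False by simp
          show "(\<lambda>x. \<phi> (component G x N)) \<in> dual N" by (rule component_dual_piece[OF \<phi>(1)])
          show "\<phi> (component G h N) = 0" if "h \<in> primitive_piece N" for h
            using that \<phi>(3) by (auto simp: primitive_piece_def component_homogeneous)
          show "\<phi> (component G (u * v) N) = 0"
            if "u \<in> G i" "v \<in> G j" "0 < i" "0 < j" "i + j = N" for u v i j
          proof -
            have "u * v \<in> ?U" using that by blast
            then have "\<phi> (u * v) = 0" using \<phi>(3) by blast
            then show ?thesis using graded_mult[OF that(1,2)] that(5) by (simp add: component_homogeneous)
          qed
        qed
        then have "\<phi> (component G x N) = 0" by (rule fun_cong[of _ 0, simplified])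
        then show False using \<phi>(2) component_homogeneous[OF x] by simp
      qed
      ultimately show ?thesis using span_minimal[OF _ S(1)] by blast
    qed
  qed
  show ?thesis
  proof (intro equalityI subsetI UNIV_I)
    show "x \<in> ?S" for x
      by (induction x rule: graded_induct) (use G subspace_add[OF S(1)] in blast)+
  qed
qed

text \<open>\<open>V\<close> vanishes on the whole positive part and hence on the quotient, so every
  graded linear section is compatible with \<open>V\<close>.\<close>

lemma split_of_primitively_generated:
  assumes gen: "primitively_generated s G \<Delta>"
  shows "split_hopf s G \<Delta> \<epsilon> p \<and> V_trivial p (indecomposables s G \<Delta> \<epsilon> p)"
proof -
  let ?M = "positive_V_module s G \<Delta> \<epsilon> p" and ?Q = "indecomposables s G \<Delta> \<epsilon> p"
  let ?cls = "indec_class s G"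
  let ?D = "decomposables s G"
  have V0: "verschiebung s G \<Delta> \<epsilon> p n x = 0" if "V_defined p n" "x \<in> piece ?M (p * n)" for n x
    unfolding verschiebung_eq_0_iff[OF that(1)]
  proof
    fix a assume a: "a \<in> dual n"
    show "dual.pw a p x = 0"
    proof (cases "n = 0")
      case True
      \<comment> \<open>In degree 0 a \<open>p\<close>-th power can be nonzero, as for
        \<open>\<epsilon>\<close>, but the piece of the V-module there is
        \<open>{0}\<close>.\<close>
      then show ?thesis using that(2) functional_zero[OF dual_piece_linear[OF pw_dual[OF a]]]
        by (simp add: positive_V_module_def)
    next
      case False
      then show ?thesis
        using frobenius_hull_primitives[OF a that(1)] gen by (simp add: primitively_generated_def)
    qed
  qed
  have vmap0: "vmap ?Q n X = ?D" if V: "V_defined p n" and X: "X \<in> piece ?Q (p * n)" for n X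
  proof -
    obtain x where x: "X = ?cls x" "x \<in> piece ?M (p * n)"
      using X by (auto simp: indecomposables_def Let_def)
    \<comment> \<open>Makes the intersection below nonempty, so that its image is a singleton and
      \<open>the_elem\<close> is defined.\<close>
    have "x \<in> X" unfolding x(1) in_indec_class by (simp add: subspace_0[OF subspace_decomposables])
    have "(\<lambda>x. ?cls (vmap ?M n x)) ` (X \<inter> piece ?M (p * n)) = (\<lambda>x. ?D) ` (X \<inter> piece ?M (p * n))"
      by (rule image_cong[OF refl]) (use V0[OF V] in \<open>simp add: positive_V_module_def indec_class_0\<close>)
    also have "\<dots> = {?D}" using \<open>x \<in> X\<close> x(2) by auto
    finally show ?thesis by (simp add: indecomposables_def Let_def)
  qed
  have triv: "V_trivial p ?Q"
    unfolding V_trivial_def using vmap0 by (simp add: indecomposables_def Let_def)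
  obtain \<rho> where \<rho>: "\<And>n. Vector_Spaces.linear s s (\<rho> n)" "\<And>n x. x \<in> G n \<Longrightarrow> \<rho> n x \<in> G n"
    "\<And>n x. x \<in> G n \<Longrightarrow> x - \<rho> n x \<in> ?D" "\<And>n x. \<lbrakk>x \<in> G n; x \<in> ?D\<rbrakk> \<Longrightarrow> \<rho> n x = 0"
    using decomposables_projection by (metis IntI)
  have \<rho>_linear: "\<rho> n (x + y) = \<rho> n x + \<rho> n y" "\<rho> n (s c x) = s c (\<rho> n x)" "\<rho> n (x - y) = \<rho> n x - \<rho> n y" "\<rho> n 0 = 0" for n x y c
  proof -
    interpret r: Vector_Spaces.linear s s "\<rho> n" by (rule \<rho>(1))
    show "\<rho> n (x + y) = \<rho> n x + \<rho> n y" "\<rho> n (s c x) = s c (\<rho> n x)" "\<rho> n (x - y) = \<rho> n x - \<rho> n y" "\<rho> n 0 = 0"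
      by (rule r.add r.scale r.diff r.zero)+
  qed
  \<comment> \<open>A coset does not record a degree, so a homogeneous representative and its degree
    are chosen; the next fact shows that the value is independent of this choice.\<close>
  define \<sigma> where "\<sigma> X = (SOME z. \<exists>n x. x \<in> piece ?M n \<and> X = ?cls x \<and> z = \<rho> n x)" for X
  have \<sigma>: "\<sigma> (?cls x) = \<rho> n x" if x: "x \<in> piece ?M n" for x n
  proof -
    have MG: "piece ?M n \<subseteq> G n" for n
      using subspace_0[OF subspace_G] by (simp add: positive_V_module_def)
    have "\<exists>m y. y \<in> piece ?M m \<and> ?cls x = ?cls y \<and> \<sigma> (?cls x) = \<rho> m y"
      unfolding \<sigma>_def by (rule someI[of _ "\<rho> n x"]) (use x in blast)
    then obtain m y where y: "y \<in> piece ?M m" "?cls x = ?cls y" "\<sigma> (?cls x) = \<rho> m y" by blast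
    have xy: "x - y \<in> ?D" using y(2) by (simp add: indec_class_eq_iff)
    have xG: "x \<in> G n" and yG: "y \<in> G m" using x y(1) MG by auto
    show ?thesis
    proof (cases "m = n")
      case True
      have "\<rho> n (x - y) = 0" by (rule \<rho>(4)[OF _ xy]) (use xG yG True subspace_diff[OF subspace_G] in simp)
      then show ?thesis using y(3) True by (simp add: \<rho>_linear)
    next
      case False
      \<comment> \<open>Representatives of different degrees are, up to sign, components of the
        decomposable \<open>x - y\<close>. Both are then decomposable, and both values are
        0.\<close>
      have "component G (x - y) n = x" "component G (x - y) m = - y"
        using False by (simp_all add: diff_conv_add_uminus component_add
            component_homogeneous[OF xG] component_homogeneous[OF subspace_neg[OF subspace_G yG]] del: add_uminus_conv_diff)
      then have "x \<in> ?D" "- y \<in> ?D" using decomposables_component[OF xy] by metis+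
      then have "x \<in> ?D" "y \<in> ?D" using subspace_neg[OF subspace_decomposables, of "- y"] by simp_all
      then show ?thesis using \<rho>(4)[OF xG] \<rho>(4)[OF yG] y(3) by simp
    qed
  qed
  have Mp: "piece ?M n \<subseteq> G n" "x \<in> piece ?M n \<Longrightarrow> \<rho> n x \<in> piece ?M n"
    "x \<in> piece ?M n \<Longrightarrow> y \<in> piece ?M n \<Longrightarrow> x + y \<in> piece ?M n"
    "x \<in> piece ?M n \<Longrightarrow> s c x \<in> piece ?M n" for n x y c
    using subspace_0[OF subspace_G] \<rho>(2) subspace_add[OF subspace_G] subspace_scale[OF subspace_G]
    by (auto simp: positive_V_module_def \<rho>_linear)
  have Qp: "piece ?Q n = ?cls ` piece ?M n" "vplus ?Q = (+)" "vscale ?Q c X = s c ` X + ?D" for n c X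
    by (simp_all add: indecomposables_def Let_def)
  have Ms: "vplus ?M = (+)" "vscale ?M = s" "vmap ?M = verschiebung s G \<Delta> \<epsilon> p"
    by (simp_all add: positive_V_module_def)
  have "V_morphism p ?Q ?M \<sigma>"
    unfolding V_morphism_def
  proof (intro conjI allI ballI impI)
    fix n X assume "X \<in> piece ?Q n"
    then obtain x where x: "X = ?cls x" "x \<in> piece ?M n" by (auto simp: Qp)
    show "\<sigma> X \<in> piece ?M n" unfolding x(1) \<sigma>[OF x(2)] by (rule Mp(2)[OF x(2)])
    show "\<sigma> (vscale ?Q c X) = vscale ?M c (\<sigma> X)" for c
      unfolding Qp Ms x(1) indec_class_scale \<sigma>[OF x(2)] \<sigma>[OF Mp(4)[OF x(2)]] by (rule \<rho>_linear)
    fix Y assume "Y \<in> piece ?Q n"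
    then obtain y where y: "Y = ?cls y" "y \<in> piece ?M n" by (auto simp: Qp)
    show "\<sigma> (vplus ?Q X Y) = vplus ?M (\<sigma> X) (\<sigma> Y)"
      unfolding Qp Ms x(1) y(1) indec_class_add \<sigma>[OF x(2)] \<sigma>[OF y(2)] \<sigma>[OF Mp(3)[OF x(2) y(2)]]
      by (rule \<rho>_linear)
  next
    fix n X assume V: "V_defined p n" and X: "X \<in> piece ?Q (p * n)"
    then obtain x where x: "X = ?cls x" "x \<in> piece ?M (p * n)" by (auto simp: Qp)
    have "0 \<in> piece ?M 0" by (simp add: positive_V_module_def)
    from \<sigma>[OF this] have "\<sigma> ?D = 0" by (simp add: indec_class_0 \<rho>_linear)
    then show "\<sigma> (vmap ?Q n X) = vmap ?M n (\<sigma> X)"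
      unfolding vmap0[OF V X] unfolding Ms x(1) \<sigma>[OF x(2)] by (simp add: V0[OF V Mp(2)[OF x(2)]])
  qed
  moreover have "?cls (\<sigma> X) = X" if "X \<in> piece ?Q n" for n X
  proof -
    obtain x where x: "X = ?cls x" "x \<in> piece ?M n" using \<open>X \<in> piece ?Q n\<close> by (auto simp: Qp)
    have "x - \<rho> n x \<in> ?D" using \<rho>(3) Mp(1) x(2) by blast
    then show ?thesis unfolding x(1) \<sigma>[OF x(2)] by (metis indec_class_eq_iff)
  qed
  ultimately show ?thesis using triv unfolding split_hopf_def by blast
qed

text \<open>If \<open>y\<close> is the image under \<open>\<sigma>\<close> of the class of
  \<open>x\<close>, then \<open>V y\<close> is the image of \<open>V\<close> of that class, hence 0,
  and \<open>x - y\<close> is decomposable. This is the hypothesis of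
  \<open>hull_primitives_UNIV\<close>.\<close>

lemma primitively_generated_of_split:
  assumes split: "split_hopf s G \<Delta> \<epsilon> p" and triv: "V_trivial p (indecomposables s G \<Delta> \<epsilon> p)"
  shows "primitively_generated s G \<Delta>"
  unfolding primitively_generated_def
proof (rule hull_primitives_UNIV)
  let ?M = "positive_V_module s G \<Delta> \<epsilon> p" and ?Q = "indecomposables s G \<Delta> \<epsilon> p"
  let ?cls = "indec_class s G"
  let ?D = "decomposables s G"
  obtain \<sigma> where \<sigma>: "V_morphism p ?Q ?M \<sigma>" "\<And>n X. X \<in> piece ?Q n \<Longrightarrow> ?cls (\<sigma> X) = X"
    using split unfolding split_hopf_def by blast
  have Qp: "piece ?Q n = ?cls ` piece ?M n" "vscale ?Q c X = s c ` X + ?D" "vzero ?Q = ?D" for n c X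
    by (simp_all add: indecomposables_def Let_def)
  have Ms: "vscale ?M = s" "vmap ?M = verschiebung s G \<Delta> \<epsilon> p"
    by (simp_all add: positive_V_module_def)
  \<comment> \<open>The zero coset is its own multiple by the scalar 0, so compatibility with
    scalars gives \<open>\<sigma> ?D = 0\<close>.\<close>
  have "?cls 0 \<in> piece ?Q 0" unfolding Qp by (rule imageI) (simp add: positive_V_module_def)
  then have "\<sigma> (vscale ?Q 0 (?cls 0)) = s 0 (\<sigma> (?cls 0))"
    using \<sigma>(1) unfolding V_morphism_def Ms by blast
  then have \<sigma>0: "\<sigma> ?D = 0" unfolding Qp indec_class_scale by (simp add: indec_class_0)
  fix n x assume n: "0 < n" and V: "V_defined p n" and x: "x \<in> G (p * n)"
  have M: "piece ?M (p * n) = G (p * n)" using n p_pos by (simp add: positive_V_module_def)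
  then have X: "?cls x \<in> piece ?Q (p * n)" using x unfolding Qp by blast
  have y: "\<sigma> (?cls x) \<in> G (p * n)" using \<sigma>(1) X M unfolding V_morphism_def by blast
  have 1: "vmap ?Q n (?cls x) = ?D" using triv V X unfolding V_trivial_def Qp by blast
  have 2: "\<sigma> (vmap ?Q n (?cls x)) = vmap ?M n (\<sigma> (?cls x))"
    using \<sigma>(1) V X unfolding V_morphism_def by blast
  have "verschiebung s G \<Delta> \<epsilon> p n (\<sigma> (?cls x)) = 0" using 2[unfolded 1 \<sigma>0 Ms] by (rule sym)
  then have "\<forall>a\<in>dual n. dual.pw a p (\<sigma> (?cls x)) = 0" unfolding verschiebung_eq_0_iff[OF V] .
  moreover have "x - \<sigma> (?cls x) \<in> ?D" using \<sigma>(2)[OF X] by (metis indec_class_eq_iff)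
  ultimately show "\<exists>y\<in>G (p * n). x - y \<in> ?D \<and> (\<forall>a\<in>dual n. dual.pw a p y = 0)" using y by blast
qed

end

theorem theorem7p1:
  fixes s :: "'k::field \<Rightarrow> 'h::ring_1 \<Rightarrow> 'h"
    and G :: "nat \<Rightarrow> 'h set"
    and \<Delta> :: "'h \<Rightarrow> ('k, 'h, 'h) tensor"
    and \<epsilon> :: "'h \<Rightarrow> 'k"
    and p :: nat
  assumes char: "CHAR('k) = p" "p > 0"
    and perfect: "surj (\<lambda>c::'k. c ^ p)"
    and hopf: "connected_cocommutative_hopf_algebra s G \<Delta> \<epsilon>"
  shows "primitively_generated s G \<Delta> \<longleftrightarrow>
    split_hopf s G \<Delta> \<epsilon> p \<and> V_trivial p (indecomposables s G \<Delta> \<epsilon> p)"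
proof -
  interpret connected_cocommutative_hopf_algebra_char_p s G \<Delta> \<epsilon> p
    using hopf char perfect
    by (simp add: connected_cocommutative_hopf_algebra_char_p_def
        connected_cocommutative_hopf_algebra_char_p_axioms_def)
  show ?thesis using split_of_primitively_generated primitively_generated_of_split by blast
qed

end
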